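(* For every fixed $k \le 11$, given an $m$-edge graph $H$ as input, the number of subgraphs of $H$ isomorphic to the cycle $C_k$ can be computed in $\widetilde{O}(m^3)$ time and constant space.
   Context: $C_k$ denotes the cycle on $k$ vertices. Computational model: unit-cost RAM (a vertex label fits in one word); the host graph is given by a representation allowing adjacency queries in $\widetilde{O}(1)$ time and iteration over all edges $xy$ ordered by $x$ in $\widetilde{O}(m)$ time. $\widetilde{O}$ hides factors polylogarithmic in the input size; constant space means $O(1)$ words. *)

theory Defs
  imports Complex_Main
begin

section \<open>Simple graphs and subgraph counts\<close>

type_synonym 'a ugraph = "'a set \<times> 'a set set"

definition ugraph_verts :: "'a ugraph \<Rightarrow> 'a set" where
  "ugraph_verts G = fst G"

definition ugraph_edges :: "'a ugraph \<Rightarrow> 'a set set" where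
  "ugraph_edges G = snd G"

definition simple_ugraph :: "'a ugraph \<Rightarrow> bool" where
  "simple_ugraph G \<longleftrightarrow>
     finite (ugraph_verts G) \<and> (\<forall>e \<in> ugraph_edges G. e \<subseteq> ugraph_verts G \<and> card e = 2)"

definition ugraph_subgraph :: "'a ugraph \<Rightarrow> 'a ugraph \<Rightarrow> bool" where
  "ugraph_subgraph S G \<longleftrightarrow> simple_ugraph S \<and>
     ugraph_verts S \<subseteq> ugraph_verts G \<and> ugraph_edges S \<subseteq> ugraph_edges G"

definition ugraph_iso :: "'a ugraph \<Rightarrow> 'b ugraph \<Rightarrow> bool" where
  "ugraph_iso F G \<longleftrightarrow> (\<exists>f. bij_betw f (ugraph_verts F) (ugraph_verts G) \<and>
     (\<forall>u \<in> ugraph_verts F. \<forall>v \<in> ugraph_verts F.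
        {u, v} \<in> ugraph_edges F \<longleftrightarrow> {f u, f v} \<in> ugraph_edges G))"

definition num_subgraphs_iso :: "'a ugraph \<Rightarrow> 'b ugraph \<Rightarrow> nat" where
  "num_subgraphs_iso F G = card {S. ugraph_subgraph S G \<and> ugraph_iso F S}"

definition cycle_ugraph :: "nat \<Rightarrow> nat ugraph" where
  "cycle_ugraph k = ({..<k}, {{i, (i + 1) mod k} | i. i < k})"

definition num_edges :: "'a ugraph \<Rightarrow> nat" where
  "num_edges G = card (ugraph_edges G)"

definition input_size :: "'a ugraph \<Rightarrow> nat" where
  "input_size G = card (ugraph_verts G) + card (ugraph_edges G)"

text \<open>The offset 2 keeps the logarithm at least 1, and the maximum with 1 keeps the bounds
  positive on edgeless graphs, where even an empty iteration takes a step.\<close>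

definition polylog :: "nat \<Rightarrow> 'a ugraph \<Rightarrow> real" where
  "polylog d G = log 2 (real (input_size G + 2)) ^ d"

definition edge_bound :: "nat \<Rightarrow> 'a ugraph \<Rightarrow> real" where
  "edge_bound r G = real (max 1 (num_edges G)) ^ r"


section \<open>Access to the host graph\<close>

text \<open>A representation lists every edge in both orientations, ordered by the first endpoint;
  the order among arcs with the same first endpoint is arbitrary. Programs see the list only
  through adjacency queries and sequential cursors, never by index. The cost
  \<open>next_cost R i\<close> is that of advancing a cursor that has already delivered \<open>i\<close> arcs; for
  \<open>i = length (arc_list R)\<close> it is the cost of noticing that the iteration is over.\<close>

record graph_rep =
  arc_list :: "(nat \<times> nat) list"
  adj_cost :: "nat \<Rightarrow> nat \<Rightarrow> nat"
  reset_cost :: nat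
  next_cost :: "nat \<Rightarrow> nat"

definition represents :: "graph_rep \<Rightarrow> nat ugraph \<Rightarrow> bool" where
  "represents R G \<longleftrightarrow>
     distinct (arc_list R) \<and> sorted (map fst (arc_list R)) \<and>
     set (arc_list R) = {(x, y). {x, y} \<in> ugraph_edges G}"

text \<open>Adjacency queries take polylogarithmic time and a full iteration over the edges takes time
  linear in the number of edges up to a polylogarithmic factor.\<close>

definition efficient_rep :: "real \<Rightarrow> nat \<Rightarrow> graph_rep \<Rightarrow> nat ugraph \<Rightarrow> bool" where
  "efficient_rep K e R G \<longleftrightarrow>
     (\<forall>u \<in> ugraph_verts G. \<forall>v \<in> ugraph_verts G. real (adj_cost R u v) \<le> K * polylog e G) \<and>
     real (reset_cost R + (\<Sum>i \<le> length (arc_list R). next_cost R i))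
       \<le> K * edge_bound 1 G * polylog e G"


section \<open>Unit-cost RAM\<close>

text \<open>Arguments \<open>a\<close>, \<open>b\<close>, \<open>c\<close> are memory addresses, \<open>l\<close> is a program position, \<open>j\<close> names a cursor.
  Subtraction is truncated, and division by zero yields 0. \<open>Next_Arc\<close> jumps to \<open>l\<close> if the
  iteration is over.\<close>

datatype ram_instr =
    Set_Const nat nat
  | Copy nat nat
  | Load_Ind nat nat
  | Store_Ind nat nat
  | Add_Op nat nat nat
  | Sub_Op nat nat nat
  | Mult_Op nat nat nat
  | Div_Op nat nat nat
  | Jump nat
  | Jump_Zero nat nat
  | Query_Adj nat nat nat
  | Reset_Cursor nat
  | Next_Arc nat nat nat nat

type_synonym ram_program = "ram_instr list"

record ram_config =
  pc :: nat
  mem :: "nat \<Rightarrow> nat"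
  cursor :: "nat \<Rightarrow> nat"

definition init_config :: ram_config where
  "init_config = \<lparr>pc = 0, mem = (\<lambda>_. 0), cursor = (\<lambda>_. 0)\<rparr>"

definition assign :: "nat \<Rightarrow> nat \<Rightarrow> ram_config \<Rightarrow> ram_config" where
  "assign a v s = s\<lparr>pc := pc s + 1, mem := (mem s)(a := v)\<rparr>"

fun exec_instr :: "graph_rep \<Rightarrow> ram_instr \<Rightarrow> ram_config \<Rightarrow> ram_config" where
  "exec_instr R (Set_Const a v) s = assign a v s"
| "exec_instr R (Copy a b) s = assign a (mem s b) s"
| "exec_instr R (Load_Ind a b) s = assign a (mem s (mem s b)) s"
| "exec_instr R (Store_Ind a b) s = assign (mem s a) (mem s b) s"
| "exec_instr R (Add_Op a b c) s = assign a (mem s b + mem s c) s"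
| "exec_instr R (Sub_Op a b c) s = assign a (mem s b - mem s c) s"
| "exec_instr R (Mult_Op a b c) s = assign a (mem s b * mem s c) s"
| "exec_instr R (Div_Op a b c) s = assign a (mem s b div mem s c) s"
| "exec_instr R (Jump l) s = s\<lparr>pc := l\<rparr>"
| "exec_instr R (Jump_Zero a l) s = s\<lparr>pc := (if mem s a = 0 then l else pc s + 1)\<rparr>"
| "exec_instr R (Query_Adj a b c) s =
     assign a (if (mem s b, mem s c) \<in> set (arc_list R) then 1 else 0) s"
| "exec_instr R (Reset_Cursor j) s = s\<lparr>pc := pc s + 1, cursor := (cursor s)(j := 0)\<rparr>"
| "exec_instr R (Next_Arc j a b l) s =
     (if cursor s j < length (arc_list R)
      then let (x, y) = arc_list R ! cursor s j in
        s\<lparr>pc := pc s + 1, mem := (mem s)(a := x, b := y),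
          cursor := (cursor s)(j := cursor s j + 1)\<rparr>
      else s\<lparr>pc := l\<rparr>)"

fun instr_cost :: "graph_rep \<Rightarrow> ram_instr \<Rightarrow> ram_config \<Rightarrow> nat" where
  "instr_cost R (Query_Adj a b c) s = 1 + adj_cost R (mem s b) (mem s c)"
| "instr_cost R (Reset_Cursor j) s = 1 + reset_cost R"
| "instr_cost R (Next_Arc j a b l) s = 1 + next_cost R (cursor s j)"
| "instr_cost R _ s = 1"

fun instr_cells :: "ram_instr \<Rightarrow> ram_config \<Rightarrow> nat set" where
  "instr_cells (Set_Const a v) s = {a}"
| "instr_cells (Copy a b) s = {a, b}"
| "instr_cells (Load_Ind a b) s = {a, b, mem s b}"
| "instr_cells (Store_Ind a b) s = {a, b, mem s a}"
| "instr_cells (Add_Op a b c) s = {a, b, c}"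
| "instr_cells (Sub_Op a b c) s = {a, b, c}"
| "instr_cells (Mult_Op a b c) s = {a, b, c}"
| "instr_cells (Div_Op a b c) s = {a, b, c}"
| "instr_cells (Jump l) s = {}"
| "instr_cells (Jump_Zero a l) s = {a}"
| "instr_cells (Query_Adj a b c) s = {a, b, c}"
| "instr_cells (Reset_Cursor j) s = {}"
| "instr_cells (Next_Arc j a b l) s = {a, b}"

fun instr_cursors :: "ram_instr \<Rightarrow> nat set" where
  "instr_cursors (Reset_Cursor j) = {j}"
| "instr_cursors (Next_Arc j a b l) = {j}"
| "instr_cursors _ = {}"

definition step :: "ram_program \<Rightarrow> graph_rep \<Rightarrow> ram_config \<Rightarrow> ram_config" where
  "step P R s = (if pc s < length P then exec_instr R (P ! pc s) s else s)"

definition config_at :: "ram_program \<Rightarrow> graph_rep \<Rightarrow> nat \<Rightarrow> ram_config" where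
  "config_at P R t = (step P R ^^ t) init_config"

definition instr_at :: "ram_program \<Rightarrow> graph_rep \<Rightarrow> nat \<Rightarrow> ram_instr" where
  "instr_at P R t = P ! pc (config_at P R t)"

text \<open>A program halts by leaving its range of positions; the argument \<open>T\<close> below is the number of
  executed instructions.\<close>

definition halts_after :: "ram_program \<Rightarrow> graph_rep \<Rightarrow> nat \<Rightarrow> bool" where
  "halts_after P R T \<longleftrightarrow>
     pc (config_at P R T) \<ge> length P \<and> (\<forall>t < T. pc (config_at P R t) < length P)"

definition run_output :: "ram_program \<Rightarrow> graph_rep \<Rightarrow> nat \<Rightarrow> nat" where
  "run_output P R T = mem (config_at P R T) 0"

definition run_time :: "ram_program \<Rightarrow> graph_rep \<Rightarrow> nat \<Rightarrow> nat" where
  "run_time P R T = (\<Sum>t < T. instr_cost R (instr_at P R t) (config_at P R t))"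

definition run_space :: "ram_program \<Rightarrow> graph_rep \<Rightarrow> nat \<Rightarrow> nat" where
  "run_space P R T =
     card (\<Union>t < T. instr_cells (instr_at P R t) (config_at P R t)) +
     card (\<Union>t < T. instr_cursors (instr_at P R t))"

text \<open>Memory cells are bounded, so that unit-cost arithmetic cannot pack long data into one cell:
  if vertex labels and the input size fit in \<open>w\<close> bits, then a cell holds \<open>c * w\<close> bits, i.e. a
  constant number of words.\<close>

definition fits_word :: "nat \<Rightarrow> nat ugraph \<Rightarrow> bool" where
  "fits_word w G \<longleftrightarrow> 1 \<le> w \<and> input_size G < 2 ^ w \<and> (\<forall>v \<in> ugraph_verts G. v < 2 ^ w)"

definition run_within_bits :: "ram_program \<Rightarrow> graph_rep \<Rightarrow> nat \<Rightarrow> nat \<Rightarrow> bool" where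
  "run_within_bits P R T b \<longleftrightarrow> (\<forall>t \<le> T. \<forall>a. mem (config_at P R t) a < 2 ^ b)"

end

theory Submission
  imports Defs "HOL-Library.FuncSet"
begin

text \<open>The number of embeddings of \<open>C\<^sub>k\<close> is obtained from numbers of homomorphisms of quotients of
  \<open>C\<^sub>k\<close> by deletion-contraction (the homomorphisms with \<open>g u \<noteq> g v\<close> are all homomorphisms minus those
  of the quotient by \<open>u = v\<close>); dividing by the number of automorphisms of \<open>C\<^sub>k\<close> gives the number of
  subgraphs.

  Homomorphisms are counted by branching over images of vertices. Since the arcs are ordered by
  their first endpoint, one pass over them suffices to compute
  \<open>\<Sum>\<^sub>x \<Prod>\<^sub>j \<Sum>\<^sub>y f\<^sub>j x y\<close>, where \<open>x\<close> ranges over the vertices and \<open>y\<close> over the neighbours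
  of \<open>x\<close>: it is enough to keep one accumulator for every \<open>j\<close>. Hence one factor of \<open>m\<close> in the running time pays
  for fixing a vertex \<open>b\<close> together with one neighbour of \<open>b\<close> in every component that remains after the
  removal of \<open>b\<close>. Three such levels suffice for the quotients of \<open>C\<^sub>k\<close> with \<open>k \<le> 11\<close>: if some edge
  touches all but at most five edges, removing its endpoints leaves a graph that two levels
  dispose of; the other quotients are few and are checked one by one.\<close>

section \<open>Structured programs and their compilation\<close>

text \<open>Homomorphisms are counted instead of embeddings because only they decouple: once a
  vertex has its image, the parts of the pattern that it separates can be mapped independently and
  their counts multiply, whereas injectivity ties all parts together. The price is that every
  quotient of the cycle has to be handled, and the worst of them decides how many levels are needed.
  A quotient has at most \<open>k\<close> edges. Two levels suffice for five edges because either
  the endpoints of some edge can be removed so that at most two edges remain, or every edge touches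
  at most two edges, itself included, and all components are stars. Both the set of quotients and
  their elimination schemes depend on \<open>k\<close> alone. So the algorithm is one fixed program
  whose loops are nested at most three deep: its space is constant, and the exponent of the running
  time is its nesting depth.\<close>

datatype com = Op ram_instr | Seq com com | IfNZ nat com | For nat nat com

text \<open>Jumps and cursors are reserved for \<open>compile\<close>. Indirect addressing is
  excluded so that the cells an operation touches are visible in the program text, which is what the
  space bound rests on.\<close>

fun straight :: "ram_instr \<Rightarrow> bool" where
  "straight (Load_Ind a b) = False"
| "straight (Store_Ind a b) = False"
| "straight (Jump l) = False"
| "straight (Jump_Zero a l) = False"
| "straight (Reset_Cursor j) = False"
| "straight (Next_Arc j a b l) = False"
| "straight _ = True"

primrec wf_com :: "com \<Rightarrow> bool" where
  "wf_com (Op i) = straight i"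
| "wf_com (Seq c c') = (wf_com c \<and> wf_com c')"
| "wf_com (IfNZ a c) = wf_com c"
| "wf_com (For a b c) = wf_com c"

abbreviation mem_config :: "(nat \<Rightarrow> nat) \<Rightarrow> ram_config" where
  "mem_config m \<equiv> \<lparr>pc = 0, mem = m, cursor = (\<lambda>_. 0)\<rparr>"

primrec run :: "graph_rep \<Rightarrow> com \<Rightarrow> (nat \<Rightarrow> nat) \<Rightarrow> nat \<Rightarrow> nat" where
  "run R (Op i) = (\<lambda>m. mem (exec_instr R i (mem_config m)))"
| "run R (Seq c c') = (\<lambda>m. run R c' (run R c m))"
| "run R (IfNZ a c) = (\<lambda>m. if m a = 0 then m else run R c m)"
| "run R (For a b c) = fold (\<lambda>p m. run R c (m(a := fst p, b := snd p))) (arc_list R)"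

text \<open>The memory at the start of the body in iteration \<open>i\<close> of a loop with body semantics \<open>f\<close>.\<close>

definition iter_mem ::
  "graph_rep \<Rightarrow> nat \<Rightarrow> nat \<Rightarrow> ((nat \<Rightarrow> nat) \<Rightarrow> nat \<Rightarrow> nat) \<Rightarrow> (nat \<Rightarrow> nat) \<Rightarrow> nat \<Rightarrow> nat \<Rightarrow> nat" where
  "iter_mem R a b f m i =
     (fold (\<lambda>p m. f (m(a := fst p, b := snd p))) (take i (arc_list R)) m)
       (a := fst (arc_list R ! i), b := snd (arc_list R ! i))"

text \<open>In the cost of a loop, the outer 2 pays for \<open>Reset_Cursor\<close> and for the
  \<open>Next_Arc\<close> that discovers the end, the inner 2 for the \<open>Next_Arc\<close> and
  the back jump of an iteration.\<close>

primrec cost :: "graph_rep \<Rightarrow> com \<Rightarrow> (nat \<Rightarrow> nat) \<Rightarrow> nat" where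
  "cost R (Op i) = (\<lambda>m. instr_cost R i (mem_config m))"
| "cost R (Seq c c') = (\<lambda>m. cost R c m + cost R c' (run R c m))"
| "cost R (IfNZ a c) = (\<lambda>m. 1 + (if m a = 0 then 0 else cost R c m))"
| "cost R (For a b c) = (\<lambda>m. 2 + reset_cost R + (\<Sum>i\<le>length (arc_list R). next_cost R i)
     + (\<Sum>i<length (arc_list R). 2 + cost R c (iter_mem R a b (run R c) m i)))"

definition bounded_mem :: "nat \<Rightarrow> (nat \<Rightarrow> nat) \<Rightarrow> bool" where
  "bounded_mem B m \<longleftrightarrow> (\<forall>a. m a < B)"

lemma bounded_mem_upd: "bounded_mem B m \<Longrightarrow> v < B \<Longrightarrow> bounded_mem B (m(a := v))"
  by (simp add: bounded_mem_def)

text \<open>It is enough to constrain the memory after each operation and the labels loaded by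
  loops: with a bounded start, every intermediate memory is then bounded.\<close>

primrec ok :: "graph_rep \<Rightarrow> nat \<Rightarrow> com \<Rightarrow> (nat \<Rightarrow> nat) \<Rightarrow> bool" where
  "ok R B (Op i) = (\<lambda>m. bounded_mem B (run R (Op i) m))"
| "ok R B (Seq c c') = (\<lambda>m. ok R B c m \<and> ok R B c' (run R c m))"
| "ok R B (IfNZ a c) = (\<lambda>m. m a \<noteq> 0 \<longrightarrow> ok R B c m)"
| "ok R B (For a b c) = (\<lambda>m. \<forall>i<length (arc_list R).
     fst (arc_list R ! i) < B \<and> snd (arc_list R ! i) < B \<and> ok R B c (iter_mem R a b (run R c) m i))"

primrec com_length :: "com \<Rightarrow> nat" where
  "com_length (Op i) = 1"
| "com_length (Seq c c') = com_length c + com_length c'"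
| "com_length (IfNZ a c) = 1 + com_length c"
| "com_length (For a b c) = 3 + com_length c"

text \<open>The nesting depth \<open>d\<close> serves as the name of the cursor of the next loop; \<open>l\<close> is the position
  of the code in the program.\<close>

primrec compile :: "com \<Rightarrow> nat \<Rightarrow> nat \<Rightarrow> ram_program" where
  "compile (Op i) d l = [i]"
| "compile (Seq c c') d l = compile c d l @ compile c' d (l + com_length c)"
| "compile (IfNZ a c) d l = Jump_Zero a (l + 1 + com_length c) # compile c d (l + 1)"
| "compile (For a b c) d l =
     [Reset_Cursor d, Next_Arc d a b (l + 3 + com_length c)] @ compile c (Suc d) (l + 2) @ [Jump (l + 1)]"

lemma length_compile [simp]: "length (compile c d l) = com_length c"
  by (induction c arbitrary: d l) auto

text \<open>\<open>T\<close> counts instructions and \<open>C\<close> adds up their costs.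
  Boundedness is demanded at every configuration, the last one included, so that a single relation
  delivers both the running time and the word size.\<close>

inductive reach :: "ram_program \<Rightarrow> graph_rep \<Rightarrow> nat \<Rightarrow> ram_config \<Rightarrow> nat \<Rightarrow> nat \<Rightarrow> ram_config \<Rightarrow> bool"
  for P R B where
  reach_refl: "bounded_mem B (mem s) \<Longrightarrow> reach P R B s 0 0 s"
| reach_step: "\<lbrakk>pc s < length P; bounded_mem B (mem s);
     reach P R B (exec_instr R (P ! pc s) s) T C s'\<rbrakk>
     \<Longrightarrow> reach P R B s (Suc T) (instr_cost R (P ! pc s) s + C) s'"

lemma reach_trans:
  "reach P R B s T C s' \<Longrightarrow> reach P R B s' T' C' s'' \<Longrightarrow> reach P R B s (T + T') (C + C') s''"
  by (induction rule: reach.induct) (auto simp: add.assoc intro: reach_step)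

lemma reach_first:
  assumes "P ! pc s = i" "pc s < length P" "bounded_mem B (mem s)"
    "reach P R B (exec_instr R i s) T C s'" "C' = instr_cost R i s + C"
  shows "\<exists>T. reach P R B s T C' s'"
  using reach_step[of s P B R T C s'] assms by auto

lemma straight_exec:
  assumes "straight i"
  shows "exec_instr R i s = s\<lparr>pc := pc s + 1, mem := mem (exec_instr R i (mem_config (mem s)))\<rparr>"
    and "instr_cost R i s = instr_cost R i (mem_config (mem s))"
  using assms by (cases i; simp add: assign_def)+

lemma ok_bounded: "ok R B c m \<Longrightarrow> bounded_mem B m \<Longrightarrow> bounded_mem B (run R c m)"
proof (induction c arbitrary: m)
  case (For a b c)
  let ?f = "\<lambda>p m. run R c (m(a := fst p, b := snd p))"
  have "i \<le> length (arc_list R) \<Longrightarrow> bounded_mem B (fold ?f (take i (arc_list R)) m)" for i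
  proof (induction i)
    case (Suc i)
    let ?I = "iter_mem R a b (run R c) m i"
    have "ok R B c ?I" using For.prems Suc.prems by auto
    moreover have "bounded_mem B ?I"
      unfolding iter_mem_def
      by (intro bounded_mem_upd Suc.IH) (use For.prems Suc.prems in auto)
    ultimately have "ok R B c ?I" "bounded_mem B ?I" .
    then have "bounded_mem B (run R c ?I)" by (rule For.IH)
    moreover have "take (Suc i) (arc_list R) = take i (arc_list R) @ [arc_list R ! i]"
      using Suc.prems by (simp add: take_Suc_conv_app_nth)
    ultimately show ?case by (simp only: iter_mem_def fold_append fold.simps o_apply id_apply)
  qed (use For in simp)
  from this[of "length (arc_list R)"] show ?case by simp
qed auto

text \<open>The clause on the cursors below \<open>d\<close> carries the induction: the body of a
  loop with cursor \<open>d\<close> is compiled at depth \<open>d + 1\<close>, so it returns with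
  the cursor of its loop intact.\<close>

lemma compile_correct:
  assumes "P = xs @ compile c d (length xs) @ ys" "pc s = length xs"
    "ok R B c (mem s)" "bounded_mem B (mem s)" "wf_com c"
  shows "\<exists>T s'. reach P R B s T (cost R c (mem s)) s' \<and> pc s' = length xs + com_length c \<and>
    mem s' = run R c (mem s) \<and> (\<forall>j<d. cursor s' j = cursor s j)"
  using assms
proof (induction c arbitrary: d xs ys s)
  case (Op i)
  have nth: "P ! pc s = i" "pc s < length P" using Op.prems by auto
  have *: "reach P R B s (Suc 0) (instr_cost R (P ! pc s) s + 0) (exec_instr R i s)"
    using Op.prems nth straight_exec[of i R s]
    by (intro reach_step) (auto intro!: reach_refl)
  then show ?case using Op.prems nth straight_exec[of i R s]
    by (intro exI[of _ "Suc 0"] exI[of _ "exec_instr R i s"]) (auto simp del: exec_instr.simps)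
next
  case (Seq c c')
  obtain T s' where 1: "reach P R B s T (cost R c (mem s)) s'" "pc s' = length xs + com_length c"
    "mem s' = run R c (mem s)" "\<forall>j<d. cursor s' j = cursor s j"
    using Seq.IH(1)[of xs d "compile c' d (length xs + com_length c) @ ys" s] Seq.prems by auto
  obtain T' s'' where 2: "reach P R B s' T' (cost R c' (mem s')) s''"
    "pc s'' = length xs + com_length c + com_length c'"
    "mem s'' = run R c' (mem s')" "\<forall>j<d. cursor s'' j = cursor s' j"
    using Seq.IH(2)[of "xs @ compile c d (length xs)" d ys s'] Seq.prems 1 ok_bounded by auto
  show ?case using reach_trans[OF 1(1) 2(1)] 1 2
    by (intro exI[of _ "T + T'"] exI[of _ s'']) auto
next
  case (IfNZ a c)
  have nth: "P ! pc s = Jump_Zero a (length xs + 1 + com_length c)" "pc s < length P"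
    using IfNZ.prems by auto
  show ?case
  proof (cases "mem s a = 0")
    case True
    let ?s = "s\<lparr>pc := length xs + 1 + com_length c\<rparr>"
    have "reach P R B ?s 0 0 ?s" using IfNZ.prems by (intro reach_refl) simp
    then have "\<exists>T. reach P R B s T 1 ?s"
      using nth IfNZ.prems True by (intro reach_first[where C=0]) auto
    then obtain T where "reach P R B s T 1 ?s" by blast
    then show ?thesis using True by (intro exI[of _ T] exI[of _ ?s]) auto
  next
    case False
    let ?s = "s\<lparr>pc := length xs + 1\<rparr>"
    obtain T s' where 1: "reach P R B ?s T (cost R c (mem ?s)) s'" "pc s' = length xs + 1 + com_length c"
      "mem s' = run R c (mem ?s)" "\<forall>j<d. cursor s' j = cursor ?s j"
      using IfNZ.IH[of "xs @ [Jump_Zero a (length xs + 1 + com_length c)]" d ys ?s] IfNZ.prems False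
      by auto
    have "\<exists>T. reach P R B s T (1 + cost R c (mem s)) s'"
      using nth IfNZ.prems False 1 by (intro reach_first[where C="cost R c (mem s)"]) auto
    then obtain T where "reach P R B s T (1 + cost R c (mem s)) s'" by blast
    then show ?thesis using False 1 by (intro exI[of _ T] exI[of _ s']) auto
  qed
next
  case (For a b c)
  let ?n = "length (arc_list R)"
  let ?f = "\<lambda>p m. run R c (m(a := fst p, b := snd p))"
  define M where "M i = fold ?f (take i (arc_list R)) (mem s)" for i
  let ?I = "iter_mem R a b (run R c) (mem s)"
  have I: "?I i = (M i)(a := fst (arc_list R ! i), b := snd (arc_list R ! i))" for i
    by (simp add: iter_mem_def M_def)
  have MS: "M (Suc i) = run R c (?I i)" if "i < ?n" for i
    using that by (simp add: M_def iter_mem_def take_Suc_conv_app_nth)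
  have okI: "ok R B c (?I i)" "fst (arc_list R ! i) < B" "snd (arc_list R ! i) < B" if "i < ?n" for i
    using For.prems(3) that by auto
  have Mb: "i \<le> ?n \<Longrightarrow> bounded_mem B (M i)" for i
  proof (induction i)
    case 0 then show ?case using For.prems by (simp add: M_def)
  next
    case (Suc i)
    then have "bounded_mem B (?I i)" using okI[of i] unfolding I by (intro bounded_mem_upd) auto
    then show ?case using MS[of i] okI[of i] ok_bounded Suc by auto
  qed
  have arc_loaded: "P ! length xs = Reset_Cursor d"
    "P ! (length xs + 1) = Next_Arc d a b (length xs + 3 + com_length c)"
    "P ! (length xs + 2 + com_length c) = Jump (length xs + 1)"
    "length P \<ge> length xs + 3 + com_length c"
    using For.prems(1) by (auto simp: nth_append)
  \<comment> \<open>Here \<open>i\<close> is the number of remaining iterations, so that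
    \<open>?n - i\<close> is the index of the next arc.\<close>
  have loop: "\<exists>T s''. reach P R B s' T (\<Sum>j=?n-i..<?n. 1 + next_cost R j + 1 + cost R c (?I j)) s''
      \<and> pc s'' = length xs + 1 \<and> mem s'' = M ?n \<and> cursor s'' d = ?n \<and> (\<forall>j<d. cursor s'' j = cursor s j)"
    if "i \<le> ?n" "pc s' = length xs + 1" "mem s' = M (?n - i)" "cursor s' d = ?n - i"
      "\<forall>j<d. cursor s' j = cursor s j" for i s'
    using that
  proof (induction i arbitrary: s')
    case 0
    then show ?case using Mb[of ?n] by (auto intro!: exI[of _ s'] exI[of _ 0] reach_refl)
  next
    case (Suc i)
    let ?j = "?n - Suc i"
    have j: "?j < ?n" "Suc ?j = ?n - i" using Suc.prems by auto
    let ?s1 = "s'\<lparr>pc := length xs + 2, mem := ?I ?j, cursor := (cursor s')(d := ?n - i)\<rparr>"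
    have e1: "exec_instr R (Next_Arc d a b (length xs + 3 + com_length c)) s' = ?s1"
      using Suc.prems j by (auto simp: I Let_def split: prod.splits)
    have b1: "bounded_mem B (?I ?j)"
      using okI[OF j(1)] Mb[of ?j] j unfolding I by (intro bounded_mem_upd) auto
    obtain T2 s2 where 2: "reach P R B ?s1 T2 (cost R c (?I ?j)) s2" "pc s2 = length xs + 2 + com_length c"
      "mem s2 = run R c (?I ?j)" "\<forall>j<Suc d. cursor s2 j = cursor ?s1 j"
      using For.IH[of "xs @ [Reset_Cursor d, Next_Arc d a b (length xs + 3 + com_length c)]" "Suc d"
          "Jump (length xs + 1) # ys" ?s1] For.prems okI(1)[OF j(1)] b1
      by (auto simp: numeral_2_eq_2)
    let ?s3 = "s2\<lparr>pc := length xs + 1\<rparr>"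
    have m2: "mem s2 = M (?n - i)" using 2 MS[OF j(1)] j by simp
    obtain T4 s4 where 4: "reach P R B ?s3 T4 (\<Sum>j=?n-i..<?n. 1 + next_cost R j + 1 + cost R c (?I j)) s4"
      "pc s4 = length xs + 1" "mem s4 = M ?n" "cursor s4 d = ?n" "\<forall>j<d. cursor s4 j = cursor s j"
      using Suc.IH[of ?s3] Suc.prems 2 m2 by auto
    obtain T3 where 3: "reach P R B s2 T3
        (1 + (\<Sum>j=?n-i..<?n. 1 + next_cost R j + 1 + cost R c (?I j))) s4"
      using reach_first[of P s2 _ B R, OF _ _ _ _ refl, of "Jump (length xs + 1)"] 2 4 arc_loaded m2 Mb[of "?n-i"]
      by fastforce
    have 5: "reach P R B ?s1 (T2 + T3) (cost R c (?I ?j) +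
        (1 + (\<Sum>j=?n-i..<?n. 1 + next_cost R j + 1 + cost R c (?I j)))) s4"
      by (rule reach_trans[OF 2(1) 3])
    have sum: "(\<Sum>j=?j..<?n. 1 + next_cost R j + 1 + cost R c (?I j)) =
      (1 + next_cost R ?j) + (cost R c (?I ?j) +
        (1 + (\<Sum>j=?n-i..<?n. 1 + next_cost R j + 1 + cost R c (?I j))))"
      using j by (subst sum.atLeast_Suc_lessThan) auto
    have "\<exists>T. reach P R B s' T (\<Sum>j=?j..<?n. 1 + next_cost R j + 1 + cost R c (?I j)) s4"
    proof (rule reach_first)
      show "reach P R B (exec_instr R (Next_Arc d a b (length xs + 3 + com_length c)) s') (T2 + T3) (cost R c (?I ?j) +
        (1 + (\<Sum>j=?n-i..<?n. 1 + next_cost R j + 1 + cost R c (?I j)))) s4"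
        unfolding e1 by (rule 5)
    qed (use arc_loaded Suc.prems Mb[of ?j] sum in auto)
    then show ?case using 4 by blast
  qed
  let ?s0 = "s\<lparr>pc := length xs + 1, cursor := (cursor s)(d := 0)\<rparr>"
  obtain T1 s1 where 1: "reach P R B ?s0 T1 (\<Sum>j=?n-?n..<?n. 1 + next_cost R j + 1 + cost R c (?I j)) s1"
    "pc s1 = length xs + 1" "mem s1 = M ?n" "cursor s1 d = ?n" "\<forall>j<d. cursor s1 j = cursor s j"
    using loop[of ?n ?s0] by (auto simp: M_def)
  let ?s2 = "s1\<lparr>pc := length xs + 3 + com_length c\<rparr>"
  have "reach P R B ?s2 0 0 ?s2" using 1 Mb[of ?n] by (auto intro!: reach_refl)
  then have "\<exists>T. reach P R B s1 T (1 + next_cost R ?n) ?s2"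
    using arc_loaded 1 Mb[of ?n] by (intro reach_first[where C=0]) auto
  then obtain T2 where 2: "reach P R B s1 T2 (1 + next_cost R ?n) ?s2" by blast
  have 3: "reach P R B ?s0 (T1 + T2) ((\<Sum>j=0..<?n. 1 + next_cost R j + 1 + cost R c (?I j)) +
      (1 + next_cost R ?n)) ?s2"
    using reach_trans[OF 1(1) 2] by simp
  have c: "cost R (For a b c) (mem s) = (1 + reset_cost R) +
     ((\<Sum>j=0..<?n. 1 + next_cost R j + 1 + cost R c (?I j)) + (1 + next_cost R ?n))"
  proof -
    have "{..?n} = insert ?n {..<?n}" by auto
    then show ?thesis by (simp add: sum.distrib atLeast0LessThan del: sum_constant flip: sum.distrib)
  qed
  have "\<exists>T. reach P R B s T (cost R (For a b c) (mem s)) ?s2"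
  proof (rule reach_first)
    show "cost R (For a b c) (mem s) = instr_cost R (Reset_Cursor d) s +
     ((\<Sum>j=0..<?n. 1 + next_cost R j + 1 + cost R c (?I j)) + (1 + next_cost R ?n))"
      unfolding c by simp
    show "P ! pc s = Reset_Cursor d" "pc s < length P" "bounded_mem B (mem s)"
      using arc_loaded For.prems by auto
    show "reach P R B (exec_instr R (Reset_Cursor d) s) (T1 + T2)
      ((\<Sum>j=0..<?n. 1 + next_cost R j + 1 + cost R c (?I j)) + (1 + next_cost R ?n)) ?s2"
      using 3 For.prems by simp
  qed
  then obtain T where "reach P R B s T (cost R (For a b c) (mem s)) ?s2" by blast
  then show ?case using 1 by (intro exI[of _ T] exI[of _ ?s2]) (auto simp: M_def)
qed

lemma reach_funpow:
  assumes "reach P R B s T C s'"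
  shows "(step P R ^^ T) s = s' \<and> (\<forall>t<T. pc ((step P R ^^ t) s) < length P) \<and>
    (\<Sum>t<T. instr_cost R (P ! pc ((step P R ^^ t) s)) ((step P R ^^ t) s)) = C \<and>
    (\<forall>t\<le>T. bounded_mem B (mem ((step P R ^^ t) s)))"
  using assms
proof (induction rule: reach.induct)
  case (reach_step s T C s')
  define s1 where "s1 = exec_instr R (P ! pc s) s"
  have "step P R s = s1" using reach_step by (simp add: step_def s1_def)
  then have sw: "(step P R ^^ Suc t) s = (step P R ^^ t) s1" for t
    by (simp add: funpow_Suc_right del: funpow.simps)
  note IH = reach_step.IH[folded s1_def]
  have "pc ((step P R ^^ t) s) < length P" if "t < Suc T" for t
    using that reach_step(1) IH by (cases t) (simp_all only: sw funpow_0 Suc_less_eq)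
  moreover have "bounded_mem B (mem ((step P R ^^ t) s))" if "t \<le> Suc T" for t
    using that reach_step(2) IH by (cases t) (simp_all only: sw funpow_0 Suc_le_mono)
  ultimately show ?case
    using IH unfolding sum.lessThan_Suc_shift by (simp add: sw del: funpow.simps(2))
qed auto

section \<open>Constant space\<close>

fun direct :: "ram_instr \<Rightarrow> bool" where
  "direct (Load_Ind a b) = False"
| "direct (Store_Ind a b) = False"
| "direct _ = True"

lemma direct_compile: "wf_com c \<Longrightarrow> i \<in> set (compile c d l) \<Longrightarrow> direct i"
proof (induction c arbitrary: d l)
  case (Op j)
  then show ?case by (cases j) auto
qed auto

lemma direct_cells: "direct i \<Longrightarrow> instr_cells i s = instr_cells i init_config"
  by (cases i) auto

lemma finite_cells: "finite (instr_cells i s)" "finite (instr_cursors i)"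
  by (cases i; simp)+

text \<open>Without indirect addressing the cells of an instruction do not depend on the
  configuration. The bound is a property of the program text, hence the same for all host
  graphs.\<close>

lemma run_space_le:
  assumes "\<forall>i\<in>set P. direct i" "\<forall>t<T. pc (config_at P R t) < length P"
  shows "run_space P R T \<le>
    card (\<Union>i\<in>set P. instr_cells i init_config) + card (\<Union>i\<in>set P. instr_cursors i)"
proof -
  have in_P: "instr_at P R t \<in> set P" if "t < T" for t
    using that assms by (auto simp: instr_at_def)
  show ?thesis unfolding run_space_def
  proof (intro add_mono card_mono)
    show "(\<Union>t<T. instr_cells (instr_at P R t) (config_at P R t)) \<subseteq> (\<Union>i\<in>set P. instr_cells i init_config)"
    proof (intro UN_least)
      fix t assume t: "t \<in> {..<T}"
      have "instr_cells (instr_at P R t) (config_at P R t) = instr_cells (instr_at P R t) init_config"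
        using in_P[of t] t assms(1) by (intro direct_cells) auto
      then show "instr_cells (instr_at P R t) (config_at P R t) \<subseteq> (\<Union>i\<in>set P. instr_cells i init_config)"
        using in_P[of t] t by auto
    qed
    show "(\<Union>t<T. instr_cursors (instr_at P R t)) \<subseteq> (\<Union>i\<in>set P. instr_cursors i)"
      using in_P by auto
  qed (auto simp: finite_cells)
qed

lemma compiled_program:
  assumes "wf_com c" "ok R B c (\<lambda>_. 0)" "0 < B"
  shows "\<exists>T. halts_after (compile c 0 0) R T \<and> run_output (compile c 0 0) R T = run R c (\<lambda>_. 0) 0 \<and>
    run_time (compile c 0 0) R T = cost R c (\<lambda>_. 0) \<and>
    run_space (compile c 0 0) R T \<le> card (\<Union>i\<in>set (compile c 0 0). instr_cells i init_config)
       + card (\<Union>i\<in>set (compile c 0 0). instr_cursors i) \<and>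
    (\<forall>t\<le>T. \<forall>a. mem (config_at (compile c 0 0) R t) a < B)"
proof -
  let ?P = "compile c 0 0"
  obtain T s' where s': "reach ?P R B init_config T (cost R c (\<lambda>_. 0)) s'" "pc s' = com_length c"
    "mem s' = run R c (\<lambda>_. 0)"
    using compile_correct[of ?P "[]" c 0 "[]" init_config R B] assms
    by (auto simp: init_config_def bounded_mem_def)
  note r = reach_funpow[OF s'(1), folded config_at_def]
  show ?thesis
    using r s' run_space_le[of ?P T R] direct_compile[OF assms(1)]
    by (intro exI[of _ T])
      (auto simp: halts_after_def run_output_def run_time_def instr_at_def bounded_mem_def)
qed

section \<open>Counting the extensions of a partial homomorphism\<close>

definition arcs :: "graph_rep \<Rightarrow> (nat \<times> nat) set" where
  "arcs R = set (arc_list R)"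

text \<open>As arcs come in both orientations, these are the non-isolated vertices of the host
  graph. Programs meet vertices only as endpoints of arcs, and every vertex of a cycle has a
  neighbour, so nothing is lost by mapping into this set.\<close>

definition tails :: "graph_rep \<Rightarrow> nat set" where
  "tails R = fst ` arcs R"

lemma finite_arcs [simp]: "finite (arcs R)" "finite (tails R)"
  by (auto simp: arcs_def tails_def)

definition preserves :: "(nat \<times> nat) set \<Rightarrow> graph_rep \<Rightarrow> nat set \<Rightarrow> (nat \<Rightarrow> nat) \<Rightarrow> bool" where
  "preserves E R S g \<longleftrightarrow> (\<forall>(u, v)\<in>E. u \<in> S \<longrightarrow> v \<in> S \<longrightarrow> (g u, g v) \<in> arcs R)"

lemma preserves_cong: "(\<And>v. v \<in> S \<Longrightarrow> g v = g' v) \<Longrightarrow> preserves E R S g = preserves E R S g'"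
  unfolding preserves_def by (intro ball_cong refl) (auto split: prod.splits)

text \<open>Edges inside \<open>S\<close> are tested as well, so the number is 0 unless
  \<open>h\<close> itself preserves them. For empty \<open>C\<close> it is the indicator of this
  property, which serves as the base case of the recursion.\<close>

definition num_ext :: "(nat \<times> nat) set \<Rightarrow> graph_rep \<Rightarrow> nat set \<Rightarrow> (nat \<Rightarrow> nat) \<Rightarrow> nat set \<Rightarrow> nat" where
  "num_ext E R S h C =
     card {g \<in> PiE C (\<lambda>_. tails R). preserves E R (S \<union> C) (override_on h g C)}"

definition indep :: "(nat \<times> nat) set \<Rightarrow> nat set \<Rightarrow> nat set \<Rightarrow> bool" where
  "indep E A B \<longleftrightarrow> A \<inter> B = {} \<and> E \<inter> (A \<times> B \<union> B \<times> A) = {}"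

lemma num_ext_cong:
  assumes "\<And>v. v \<in> S \<Longrightarrow> h v = h' v"
  shows "num_ext E R S h C = num_ext E R S h' C"
proof -
  have "preserves E R (S \<union> C) (override_on h g C) = preserves E R (S \<union> C) (override_on h' g C)" for g
    by (rule preserves_cong) (use assms in \<open>auto simp: override_on_def\<close>)
  then show ?thesis by (simp add: num_ext_def)
qed

lemma num_ext_empty: "num_ext E R S h {} = of_bool (preserves E R S h)"
proof -
  have "{g \<in> PiE {} (\<lambda>_. tails R). preserves E R (S \<union> {}) (override_on h g {})} =
    (if preserves E R S h then {\<lambda>_. undefined} else {})" by auto
  then show ?thesis by (simp add: num_ext_def)
qed

lemma num_ext_le:
  assumes "finite C" "card (tails R) \<le> U"
  shows "num_ext E R S h C \<le> U ^ card C"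
proof -
  have "num_ext E R S h C \<le> card (PiE C (\<lambda>_. tails R))"
    unfolding num_ext_def by (intro card_mono finite_PiE) (auto simp: assms)
  also have "\<dots> = card (tails R) ^ card C" by (simp add: card_PiE assms)
  also have "\<dots> \<le> U ^ card C" using assms by (simp add: power_mono)
  finally show ?thesis .
qed

lemma num_ext_insert:
  assumes "finite C" "b \<notin> C"
  shows "num_ext E R S h (insert b C) = (\<Sum>x\<in>tails R. num_ext E R (insert b S) (h(b := x)) C)"
proof -
  let ?G = "\<lambda>x. {g \<in> PiE C (\<lambda>_. tails R). preserves E R (insert b S \<union> C) (override_on (h(b := x)) g C)}"
  have "bij_betw (\<lambda>(x, g). g(b := x)) (SIGMA x:tails R. ?G x)
    {g \<in> PiE (insert b C) (\<lambda>_. tails R). preserves E R (S \<union> insert b C) (override_on h g (insert b C))}"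
  proof (rule bij_betwI[where g = "\<lambda>g. (g b, g(b := undefined))"], goal_cases)
    case 1
    then show ?case
    proof (intro funcsetI, clarsimp, intro conjI, goal_cases)
      case (2 x g)
      have "override_on h (g(b := x)) (insert b C) = override_on (h(b := x)) g C"
        using assms by (auto simp: override_on_def)
      then show ?case using 2 by simp
    qed (auto simp: PiE_def extensional_def)
  next
    case 2
    then show ?case
    proof (intro funcsetI, clarsimp, intro conjI, goal_cases)
      case (3 g)
      have "override_on h g (insert b C) = override_on (h(b := g b)) (g(b := undefined)) C"
        using assms by (auto simp: override_on_def)
      then show ?case using 3 by simp
    qed (use assms in \<open>auto simp: PiE_def extensional_def\<close>)
  next
    case (3 x)
    then show ?case using assms by (auto simp: PiE_def extensional_def fun_eq_iff)
  next
    case (4 y)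
    then show ?case by auto
  qed
  then have "num_ext E R S h (insert b C) = card (SIGMA x:tails R. ?G x)"
    unfolding num_ext_def by (metis (no_types, lifting) bij_betw_same_card)
  also have "\<dots> = (\<Sum>x\<in>tails R. card (?G x))"
    using assms by (intro card_SigmaI ballI finite_subset[OF _ finite_PiE[of C "\<lambda>_. tails R"]]) auto
  finally show ?thesis by (simp add: num_ext_def)
qed

text \<open>As no pattern edge joins \<open>A\<close> and \<open>B\<close>, preservation splits into
  a condition on \<open>S \<union> A\<close> and one on \<open>S \<union> B\<close>. The edges
  inside \<open>S\<close> are tested by both factors, which is harmless for a condition that is
  either true or false.\<close>

lemma num_ext_union:
  assumes "finite A" "finite B" "indep E A B" "S \<inter> (A \<union> B) = {}"
  shows "num_ext E R S h (A \<union> B) = num_ext E R S h A * num_ext E R S h B"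
proof -
  let ?G = "\<lambda>A. {g \<in> PiE A (\<lambda>_. tails R). preserves E R (S \<union> A) (override_on h g A)}"
  have AB: "A \<inter> B = {}" using assms by (simp add: indep_def)
  have pres: "preserves E R (S \<union> (A \<union> B)) f \<longleftrightarrow> preserves E R (S \<union> A) f \<and> preserves E R (S \<union> B) f" for f
    using assms(3) by (fastforce simp: preserves_def indep_def)
  have A: "preserves E R (S \<union> A) (override_on h g (A \<union> B)) = preserves E R (S \<union> A) (override_on h g' A)"
    if "\<And>v. v \<in> A \<Longrightarrow> g v = g' v" for g g'
    by (rule preserves_cong) (use that assms AB in \<open>auto simp: override_on_def\<close>)
  have B: "preserves E R (S \<union> B) (override_on h g (A \<union> B)) = preserves E R (S \<union> B) (override_on h g' B)"
    if "\<And>v. v \<in> B \<Longrightarrow> g v = g' v" for g g'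
    by (rule preserves_cong) (use that assms AB in \<open>auto simp: override_on_def\<close>)
  have "bij_betw (\<lambda>g. (restrict g A, restrict g B)) (?G (A \<union> B)) (?G A \<times> ?G B)"
  proof (rule bij_betwI[where g = "\<lambda>(g, g') v. if v \<in> A then g v else g' v"], goal_cases)
    case 1
    show ?case
    proof (intro funcsetI, clarsimp, goal_cases)
      case (1 g)
      then show ?case using pres A[of g "restrict g A"] B[of g "restrict g B"] by auto
    qed
  next
    case 2
    show ?case
    proof (intro funcsetI, clarsimp, intro conjI, goal_cases)
      case (1 g g')
      then show ?case by (auto simp: PiE_def extensional_def)
    next
      case (2 g g')
      let ?f = "\<lambda>v. if v \<in> A then g v else g' v"
      have "preserves E R (S \<union> A) (override_on h ?f (A \<union> B))"
        using A[of ?f g] 2 by simp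
      moreover have "preserves E R (S \<union> B) (override_on h ?f (A \<union> B))"
      proof (subst B)
        show "?f v = g' v" if "v \<in> B" for v using that AB by auto
      qed (use 2 in simp)
      ultimately show ?case by (simp add: pres)
    qed
  next
    case (3 g)
    then show ?case by (auto simp: PiE_def extensional_def fun_eq_iff)
  next
    case (4 y)
    then show ?case using AB by (auto simp: PiE_def extensional_def fun_eq_iff restrict_def)
  qed
  then have "card (?G (A \<union> B)) = card (?G A \<times> ?G B)" by (rule bij_betw_same_card)
  then show ?thesis by (simp add: num_ext_def card_cartesian_product)
qed

section \<open>Hoare triples with resource bounds\<close>

text \<open>\<open>X\<close> bounds the price of a query, \<open>Y\<close> that of a full pass as
  well as the number of arcs, and \<open>U\<close> the labels and the number of non-isolated
  vertices. With these three parameters all later bounds are monomials, and \<open>2 \<le> U\<close>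
  lets powers of \<open>U\<close> absorb constants.\<close>

definition good :: "graph_rep \<Rightarrow> real \<Rightarrow> real \<Rightarrow> nat \<Rightarrow> bool" where
  "good R X Y U \<longleftrightarrow> distinct (arc_list R) \<and> sorted (map fst (arc_list R)) \<and>
     (\<forall>x y. (x, y) \<in> arcs R \<longrightarrow> (y, x) \<in> arcs R) \<and>
     (\<forall>u\<in>tails R. \<forall>v\<in>tails R. real (1 + adj_cost R u v) \<le> X) \<and>
     real (2 + reset_cost R + (\<Sum>i\<le>length (arc_list R). next_cost R i)) \<le> Y \<and>
     real (length (arc_list R)) \<le> Y \<and> 1 \<le> X \<and> 1 \<le> Y \<and>
     2 \<le> U \<and> card (tails R) \<le> U \<and> (\<forall>x\<in>tails R. x < U) \<and> (\<forall>x. (x, x) \<notin> arcs R)"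

type_synonym 'g assertion = "graph_rep \<Rightarrow> nat \<Rightarrow> 'g \<Rightarrow> (nat \<Rightarrow> nat) \<Rightarrow> bool"

text \<open>A Hoare triple with a logical variable \<open>g\<close>, which also bounds the running time by a constant
  times \<open>X * Y ^ r\<close> and all memory contents by a constant power of \<open>U\<close>.\<close>

definition triple :: "nat \<Rightarrow> 'g assertion \<Rightarrow> com \<Rightarrow> 'g assertion \<Rightarrow> bool" where
  "triple r Pre c Post \<longleftrightarrow> wf_com c \<and> (\<exists>A q. 0 \<le> A \<and> (\<forall>R X Y U B g m.
     good R X Y U \<longrightarrow> U ^ q \<le> B \<longrightarrow> bounded_mem B m \<longrightarrow> Pre R U g m \<longrightarrow>
     Post R U g (run R c m) \<and> real (cost R c m) \<le> A * X * Y ^ r \<and> ok R B c m))"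

lemma good_arc:
  assumes "good R X Y U" "i < length (arc_list R)"
  shows "fst (arc_list R ! i) \<in> tails R" "snd (arc_list R ! i) \<in> tails R"
    "(fst (arc_list R ! i), snd (arc_list R ! i)) \<in> arcs R"
proof -
  show a: "(fst (arc_list R ! i), snd (arc_list R ! i)) \<in> arcs R"
    using assms by (simp add: arcs_def)
  then have "(snd (arc_list R ! i), fst (arc_list R ! i)) \<in> arcs R"
    using assms by (simp add: good_def)
  then show "fst (arc_list R ! i) \<in> tails R" "snd (arc_list R ! i) \<in> tails R"
    using a by (force simp: tails_def)+
qed

lemma good_power_le:
  assumes "good R X Y U" "U ^ q' \<le> B" "q \<le> q'"
  shows "U ^ q \<le> B"
proof -
  have "U ^ q \<le> U ^ q'" using assms(1,3) by (intro power_increasing) (auto simp: good_def)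
  then show ?thesis using assms(2) by simp
qed

text \<open>The logical variable may change its value and even its type. A program specified for an
  arbitrary initial memory is thus reused in the middle of another one by choosing \<open>g'\<close>
  as the memory at that point.\<close>

lemma triple_conseq:
  assumes "triple r Pre c Post"
    and "\<And>R X Y U g m. good R X Y U \<Longrightarrow> Pre' R U g m \<Longrightarrow>
      \<exists>g'. Pre R U g' m \<and> (\<forall>m'. Post R U g' m' \<longrightarrow> Post' R U g m')"
  shows "triple r Pre' c Post'"
proof -
  obtain A q where Aq: "0 \<le> A" "\<And>R X Y U B g m. good R X Y U \<Longrightarrow> U ^ q \<le> B \<Longrightarrow> bounded_mem B m \<Longrightarrow> Pre R U g m
    \<Longrightarrow> Post R U g (run R c m) \<and> real (cost R c m) \<le> A * X * Y ^ r \<and> ok R B c m"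
    using assms(1) unfolding triple_def by blast
  show ?thesis unfolding triple_def
  proof (intro conjI exI[of _ A] exI[of _ q] allI impI, goal_cases)
    case 1 then show ?case using assms(1) by (simp add: triple_def)
  next
    case 2 show ?case by fact
  next
    case (3 R X Y U B g m) then show ?case using assms(2) Aq(2) by meson
  next
    case (4 R X Y U B g m) then show ?case using assms(2) Aq(2) by meson
  next
    case (5 R X Y U B g m) then show ?case using assms(2) Aq(2) by meson
  qed
qed

lemma triple_seq:
  assumes "triple r Pre c Mid" "triple r Mid c' Post"
  shows "triple r Pre (Seq c c') Post"
proof -
  obtain A q where 1: "0 \<le> A" "\<And>R X Y U B g m. good R X Y U \<Longrightarrow> U ^ q \<le> B \<Longrightarrow> bounded_mem B m \<Longrightarrow> Pre R U g m
    \<Longrightarrow> Mid R U g (run R c m) \<and> real (cost R c m) \<le> A * X * Y ^ r \<and> ok R B c m"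
    using assms(1) unfolding triple_def by blast
  obtain A' q' where 2: "0 \<le> A'" "\<And>R X Y U B g m. good R X Y U \<Longrightarrow> U ^ q' \<le> B \<Longrightarrow> bounded_mem B m \<Longrightarrow> Mid R U g m
    \<Longrightarrow> Post R U g (run R c' m) \<and> real (cost R c' m) \<le> A' * X * Y ^ r \<and> ok R B c' m"
    using assms(2) unfolding triple_def by blast
  have *: "Post R U g (run R (Seq c c') m) \<and> real (cost R (Seq c c') m) \<le> (A + A') * X * Y ^ r
      \<and> ok R B (Seq c c') m"
    if g: "good R X Y U" "U ^ max q q' \<le> B" "bounded_mem B m" "Pre R U g m" for R X Y U B g m
  proof -
    have "U ^ q \<le> B" "U ^ q' \<le> B"
      by (rule good_power_le[OF g(1,2)]; simp)+
    note U = this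
    note a = 1(2)[OF g(1) U(1) g(3,4)]
    have "bounded_mem B (run R c m)" using a g ok_bounded by blast
    note b = 2(2)[OF g(1) U(2) this conjunct1[OF a]]
    show ?thesis using a b by (auto simp: algebra_simps)
  qed
  show ?thesis unfolding triple_def
    using assms 1(1) 2(1) * by (intro conjI exI[of _ "A + A'"] exI[of _ "max q q'"]) (auto simp: triple_def)
qed

lemma triple_op:
  assumes "straight i" "\<And>R s. instr_cost R i s = 1"
    "\<And>R X Y U g m. good R X Y U \<Longrightarrow> Pre R U g m \<Longrightarrow>
       \<exists>a v. run R (Op i) m = m(a := v) \<and> v < U ^ q \<and> Post R U g (m(a := v))"
  shows "triple r Pre (Op i) Post"
  unfolding triple_def
proof (intro conjI exI[of _ "1::real"] exI[of _ q] allI impI)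
  fix R X Y U B g m assume *: "good R X Y U" "U ^ q \<le> B" "bounded_mem B m" "Pre R U g m"
  obtain a v where av: "run R (Op i) m = m(a := v)" "v < U ^ q" "Post R U g (m(a := v))"
    using assms(3)[OF *(1,4)] by blast
  show "Post R U g (run R (Op i) m)" using av by simp
  have "1 \<le> X" "1 \<le> Y ^ r" using *(1) by (auto simp: good_def)
  then have "1 * 1 \<le> X * Y ^ r" by (intro mult_mono) auto
  then show "real (cost R (Op i) m) \<le> 1 * X * Y ^ r" using assms(2) by simp
  have "bounded_mem B (m(a := v))" using * av by (intro bounded_mem_upd) auto
  then show "ok R B (Op i) m" using av(1) by (simp del: run.simps)
qed (use assms in auto)

lemma triple_query:
  assumes "\<And>R X Y U g m. good R X Y U \<Longrightarrow> Pre R U g m \<Longrightarrow> m b \<in> tails R \<and> m c \<in> tails R \<and>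
       Post R U g (m(a := of_bool ((m b, m c) \<in> arcs R)))"
  shows "triple r Pre (Op (Query_Adj a b c)) Post"
  unfolding triple_def
proof (intro conjI exI[of _ "1::real"] exI[of _ 1] allI impI)
  fix R X Y U B g m assume *: "good R X Y U" "U ^ 1 \<le> B" "bounded_mem B m" "Pre R U g m"
  have r: "run R (Op (Query_Adj a b c)) m = m(a := of_bool ((m b, m c) \<in> arcs R))"
    by (simp add: assign_def arcs_def)
  show "Post R U g (run R (Op (Query_Adj a b c)) m)" unfolding r using assms * by blast
  have "real (cost R (Op (Query_Adj a b c)) m) \<le> X * 1"
    using assms[OF *(1,4)] *(1) by (simp add: good_def)
  also have "\<dots> \<le> 1 * X * Y ^ r" using *(1) by (simp add: good_def mult_left_mono)
  finally show "real (cost R (Op (Query_Adj a b c)) m) \<le> 1 * X * Y ^ r" .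
  have "bounded_mem B (m(a := of_bool ((m b, m c) \<in> arcs R)))"
    using * by (intro bounded_mem_upd) (auto simp: good_def)
  then show "ok R B (Op (Query_Adj a b c)) m" unfolding ok.simps r .
qed auto

lemma triple_if:
  assumes "triple r (\<lambda>R U g m. Pre R U g m \<and> m a \<noteq> 0) c Post"
    "\<And>R X Y U g m. good R X Y U \<Longrightarrow> Pre R U g m \<Longrightarrow> m a = 0 \<Longrightarrow> Post R U g m"
  shows "triple r Pre (IfNZ a c) Post"
proof -
  obtain A q where 1: "0 \<le> A" "\<And>R X Y U B g m. good R X Y U \<Longrightarrow> U ^ q \<le> B \<Longrightarrow> bounded_mem B m \<Longrightarrow> Pre R U g m \<and> m a \<noteq> 0
    \<Longrightarrow> Post R U g (run R c m) \<and> real (cost R c m) \<le> A * X * Y ^ r \<and> ok R B c m"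
    using assms(1) unfolding triple_def by blast
  show ?thesis unfolding triple_def
  proof (intro conjI exI[of _ "A + 1"] exI[of _ q] allI impI)
    fix R X Y U B g m assume *: "good R X Y U" "U ^ q \<le> B" "bounded_mem B m" "Pre R U g m"
    note a = 1(2)[OF *(1,2,3), of g]
    show "Post R U g (run R (IfNZ a c) m)" using * a assms(2) by simp
    show "ok R B (IfNZ a c) m" using * a by simp
    have "1 \<le> X" "1 \<le> Y ^ r" using *(1) by (auto simp: good_def)
    then have b: "1 * 1 \<le> X * Y ^ r" by (intro mult_mono) auto
    then have "0 \<le> A * X * Y ^ r" using 1(1) by (simp add: mult.assoc)
    then show "real (cost R (IfNZ a c) m) \<le> (A + 1) * X * Y ^ r"
      using a * b by (cases "m a = 0") (auto simp: algebra_simps)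
  qed (use 1 assms(1) in \<open>auto simp: triple_def\<close>)
qed

text \<open>A pass makes at most \<open>Y\<close> iterations, whence the additional factor
  \<open>Y\<close>. The logical variable of the body is that of the loop paired with the index of
  the current arc.\<close>

lemma triple_for:
  assumes body: "triple r
      (\<lambda>R U (g, i) m. i < length (arc_list R) \<and> (\<exists>m'. I R U g i m' \<and>
          m = m'(a := fst (arc_list R ! i), b := snd (arc_list R ! i))))
      c (\<lambda>R U (g, i) m. I R U g (Suc i) m)"
    and init: "\<And>R X Y U g m. good R X Y U \<Longrightarrow> Pre R U g m \<Longrightarrow> I R U g 0 m"
    and final: "\<And>R X Y U g m. good R X Y U \<Longrightarrow> I R U g (length (arc_list R)) m \<Longrightarrow> Post R U g m"
  shows "triple (Suc r) Pre (For a b c) Post"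
proof -
  obtain A q where 1: "0 \<le> A" "\<And>R X Y U B g i m. good R X Y U \<Longrightarrow> U ^ q \<le> B \<Longrightarrow> bounded_mem B m
    \<Longrightarrow> i < length (arc_list R) \<and> (\<exists>m'. I R U g i m' \<and>
          m = m'(a := fst (arc_list R ! i), b := snd (arc_list R ! i)))
    \<Longrightarrow> I R U g (Suc i) (run R c m) \<and> real (cost R c m) \<le> A * X * Y ^ r \<and> ok R B c m"
    using body unfolding triple_def by (simp only: split_paired_All split_conv) blast
  show ?thesis unfolding triple_def
  \<comment> \<open>Of the 3, one is for the overhead of the pass and two are for the loop
    instructions of each iteration. The exponent \<open>q + 1\<close> ensures
    \<open>U \<le> B\<close> even if \<open>q\<close> is 0, so that the labels loaded by the loop
    fit.\<close>
  proof (intro conjI exI[of _ "A + 3"] exI[of _ "q + 1"] allI impI)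
    fix R X Y U B g m assume *: "good R X Y U" "U ^ (q + 1) \<le> B" "bounded_mem B m" "Pre R U g m"
    have U: "U ^ q \<le> B" "U \<le> B"
      using good_power_le[OF *(1,2), of q] good_power_le[OF *(1,2), of 1] by auto
    let ?n = "length (arc_list R)"
    define M where "M i = fold (\<lambda>p m. run R c (m(a := fst p, b := snd p))) (take i (arc_list R)) m" for i
    let ?I = "iter_mem R a b (run R c) m"
    have I: "?I i = (M i)(a := fst (arc_list R ! i), b := snd (arc_list R ! i))" for i
      by (simp add: iter_mem_def M_def)
    have lab: "fst (arc_list R ! i) < B" "snd (arc_list R ! i) < B" if "i < ?n" for i
      using good_arc[OF *(1) that] U *(1) by (fastforce simp: good_def)+
    have MS: "M (Suc i) = run R c (?I i)" if "i < ?n" for i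
      using that by (simp add: M_def iter_mem_def take_Suc_conv_app_nth)
    have inv: "i \<le> ?n \<Longrightarrow> I R U g i (M i) \<and> bounded_mem B (M i)" for i
    proof (induction i)
      case 0 then show ?case using * init by (simp add: M_def)
    next
      case (Suc i)
      then have i: "i < ?n" "I R U g i (M i)" "bounded_mem B (M i)" by auto
      have b: "bounded_mem B (?I i)" unfolding I using i lab[of i] by (intro bounded_mem_upd) auto
      have "I R U g (Suc i) (run R c (?I i)) \<and> ok R B c (?I i)"
        using 1(2)[OF *(1) U(1) b, of i g] i I[of i] by blast
      then show ?case using MS[of i] i ok_bounded[OF _ b] by auto
    qed
    have it: "real (cost R c (?I i)) \<le> A * X * Y ^ r \<and> ok R B c (?I i)" if "i < ?n" for i
    proof -
      have i: "I R U g i (M i)" "bounded_mem B (M i)" using inv[of i] that by auto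
      have b: "bounded_mem B (?I i)" unfolding I using i lab[OF that] by (intro bounded_mem_upd) auto
      show ?thesis using 1(2)[OF *(1) U(1) b, of i g] i that I[of i] by blast
    qed
    have "run R (For a b c) m = M ?n" by (simp add: M_def)
    then show "Post R U g (run R (For a b c) m)" using inv[of ?n] final[OF *(1)] by simp
    show "ok R B (For a b c) m" using it lab by simp
    have XY: "1 \<le> X" "1 \<le> Y" "1 \<le> Y ^ r" "real ?n \<le> Y" using *(1) by (auto simp: good_def)
    then have b: "1 * 1 \<le> X * Y ^ r" by (intro mult_mono) auto
    have "real (cost R (For a b c) m) = real (2 + reset_cost R + (\<Sum>i\<le>?n. next_cost R i)) +
        (\<Sum>i<?n. 2 + real (cost R c (?I i)))" by simp
    also have "\<dots> \<le> Y + (\<Sum>i<?n. 2 + A * X * Y ^ r)"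
      using *(1) it by (intro add_mono sum_mono) (auto simp: good_def)
    also have "\<dots> = Y * 1 + real ?n * (2 + A * X * Y ^ r)" by simp
    also have "\<dots> \<le> Y * (X * Y ^ r) + Y * (2 * (X * Y ^ r) + A * X * Y ^ r)"
      using XY b 1(1) by (intro add_mono mult_mono) auto
    also have "\<dots> = (A + 3) * X * Y ^ Suc r" by (simp add: algebra_simps)
    finally show "real (cost R (For a b c) m) \<le> (A + 3) * X * Y ^ Suc r" .
  qed (use 1 body in \<open>auto simp: triple_def\<close>)
qed

lemma good_U: "good R X Y U \<Longrightarrow> 2 \<le> U"
  by (simp add: good_def)

lemma triple_const:
  assumes "\<And>R X Y U g m. good R X Y U \<Longrightarrow> Pre R U g m \<Longrightarrow> v < U ^ q \<and> Post R U g (m(a := v))"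
  shows "triple r Pre (Op (Set_Const a v)) Post"
proof (rule triple_op)
  fix R X Y U g m assume "good R X Y U" "Pre R U g m"
  from assms[OF this] show "\<exists>a' v'. run R (Op (Set_Const a v)) m = m(a' := v') \<and> v' < U ^ q \<and> Post R U g (m(a' := v'))"
    by (intro exI[of _ a] exI[of _ v]) (simp add: assign_def)
qed auto

lemma triple_copy:
  assumes "\<And>R X Y U g m. good R X Y U \<Longrightarrow> Pre R U g m \<Longrightarrow> m b < U ^ q \<and> Post R U g (m(a := m b))"
  shows "triple r Pre (Op (Copy a b)) Post"
proof (rule triple_op)
  fix R X Y U g m assume "good R X Y U" "Pre R U g m"
  from assms[OF this] show "\<exists>a' v'. run R (Op (Copy a b)) m = m(a' := v') \<and> v' < U ^ q \<and> Post R U g (m(a' := v'))"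
    by (intro exI[of _ a] exI[of _ "m b"]) (simp add: assign_def)
qed auto

lemma triple_add:
  assumes "\<And>R X Y U g m. good R X Y U \<Longrightarrow> Pre R U g m \<Longrightarrow> m b + m c < U ^ q \<and> Post R U g (m(a := m b + m c))"
  shows "triple r Pre (Op (Add_Op a b c)) Post"
proof (rule triple_op)
  fix R X Y U g m assume "good R X Y U" "Pre R U g m"
  from assms[OF this] show "\<exists>a' v'. run R (Op (Add_Op a b c)) m = m(a' := v') \<and> v' < U ^ q \<and> Post R U g (m(a' := v'))"
    by (intro exI[of _ a] exI[of _ "m b + m c"]) (simp add: assign_def)
qed auto

lemma triple_sub:
  assumes "\<And>R X Y U g m. good R X Y U \<Longrightarrow> Pre R U g m \<Longrightarrow> m b - m c < U ^ q \<and> Post R U g (m(a := m b - m c))"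
  shows "triple r Pre (Op (Sub_Op a b c)) Post"
proof (rule triple_op)
  fix R X Y U g m assume "good R X Y U" "Pre R U g m"
  from assms[OF this] show "\<exists>a' v'. run R (Op (Sub_Op a b c)) m = m(a' := v') \<and> v' < U ^ q \<and> Post R U g (m(a' := v'))"
    by (intro exI[of _ a] exI[of _ "m b - m c"]) (simp add: assign_def)
qed auto

lemma triple_mult:
  assumes "\<And>R X Y U g m. good R X Y U \<Longrightarrow> Pre R U g m \<Longrightarrow> m b * m c < U ^ q \<and> Post R U g (m(a := m b * m c))"
  shows "triple r Pre (Op (Mult_Op a b c)) Post"
proof (rule triple_op)
  fix R X Y U g m assume "good R X Y U" "Pre R U g m"
  from assms[OF this] show "\<exists>a' v'. run R (Op (Mult_Op a b c)) m = m(a' := v') \<and> v' < U ^ q \<and> Post R U g (m(a' := v'))"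
    by (intro exI[of _ a] exI[of _ "m b * m c"]) (simp add: assign_def)
qed auto

lemma triple_div:
  assumes "\<And>R X Y U g m. good R X Y U \<Longrightarrow> Pre R U g m \<Longrightarrow> m b div m c < U ^ q \<and> Post R U g (m(a := m b div m c))"
  shows "triple r Pre (Op (Div_Op a b c)) Post"
proof (rule triple_op)
  fix R X Y U g m assume "good R X Y U" "Pre R U g m"
  from assms[OF this] show "\<exists>a' v'. run R (Op (Div_Op a b c)) m = m(a' := v') \<and> v' < U ^ q \<and> Post R U g (m(a' := v'))"
    by (intro exI[of _ a] exI[of _ "m b div m c"]) (simp add: assign_def)
qed auto

section \<open>Building blocks of a pass over the arcs\<close>

primrec check_edges :: "nat \<Rightarrow> (nat \<times> nat) list \<Rightarrow> com" where
  "check_edges t [] = Op (Set_Const t 1)"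
| "check_edges t (e # es) =
     Seq (check_edges t es) (Seq (Op (Query_Adj (t + 1) (fst e) (snd e))) (Op (Mult_Op t t (t + 1))))"

lemma triple_check_edges:
  assumes "\<forall>e\<in>set es. fst e < t \<and> snd e < t"
  shows "triple r (\<lambda>R U h m. (\<forall>a<t. m a = h a) \<and> (\<forall>e\<in>set es. h (fst e) \<in> tails R \<and> h (snd e) \<in> tails R))
    (check_edges t es)
    (\<lambda>R U h m. m t = of_bool (\<forall>e\<in>set es. (h (fst e), h (snd e)) \<in> arcs R) \<and> (\<forall>a<t. m a = h a))"
  using assms
proof (induction es)
  case Nil
  show ?case unfolding check_edges.simps
    by (rule triple_const[where q = 1]) (auto dest: good_U)
next
  case (Cons e es)
  let ?ok = "\<lambda>R h es. \<forall>e\<in>set es. (h (fst e), h (snd e)) \<in> arcs R"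
  let ?Pre = "\<lambda>R (U::nat) h m. (\<forall>a<t. m a = h a) \<and>
    (\<forall>e'\<in>set (e # es). h (fst e') \<in> tails R \<and> h (snd e') \<in> tails R)"
  have 1: "triple r ?Pre (check_edges t es) (\<lambda>R U h m. m t = of_bool (?ok R h es) \<and> ?Pre R U h m)"
  proof (rule triple_conseq[OF Cons.IH])
    fix R X Y U h m assume "good R X Y U" "?Pre R U h m"
    then show "\<exists>g'. ((\<forall>a<t. m a = g' a) \<and> (\<forall>e\<in>set es. g' (fst e) \<in> tails R \<and> g' (snd e) \<in> tails R)) \<and>
      (\<forall>m'. m' t = of_bool (?ok R g' es) \<and> (\<forall>a<t. m' a = g' a) \<longrightarrow> m' t = of_bool (?ok R h es) \<and> ?Pre R U h m')"
      by (intro exI[of _ h]) auto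
  qed (use Cons.prems in simp)
  have 2: "triple r (\<lambda>R U h m. m t = of_bool (?ok R h es) \<and> ?Pre R U h m)
    (Op (Query_Adj (t + 1) (fst e) (snd e)))
    (\<lambda>R U h m. m t = of_bool (?ok R h es) \<and> (\<forall>a<t. m a = h a) \<and>
        m (t + 1) = of_bool ((h (fst e), h (snd e)) \<in> arcs R))"
    using Cons.prems by (intro triple_query) auto
  have 3: "triple r (\<lambda>R U h m. m t = of_bool (?ok R h es) \<and> (\<forall>a<t. m a = h a) \<and>
        m (t + 1) = of_bool ((h (fst e), h (snd e)) \<in> arcs R)) (Op (Mult_Op t t (t + 1)))
     (\<lambda>R U h m. m t = of_bool (?ok R h (e # es)) \<and> (\<forall>a<t. m a = h a))"
    by (rule triple_mult[where q = 1]) (auto dest: good_U)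
  show ?case unfolding check_edges.simps by (rule triple_seq[OF 1 triple_seq[OF 2 3]])
qed

primrec clear_cells :: "nat \<Rightarrow> nat \<Rightarrow> nat \<Rightarrow> com" where
  "clear_cells p k 0 = Op (Set_Const p 0)"
| "clear_cells p k (Suc l) = Seq (clear_cells p k l) (Op (Set_Const (k + l) 0))"

lemma triple_clear_cells:
  assumes "p < k"
  shows "triple r (\<lambda>R U h m. m = h) (clear_cells p k l)
     (\<lambda>R U h m. m p = 0 \<and> (\<forall>i<l. m (k + i) = 0) \<and> (\<forall>a. a \<noteq> p \<and> (a < k \<or> k + l \<le> a) \<longrightarrow> m a = h a))"
proof (induction l)
  case 0
  show ?case unfolding clear_cells.simps by (rule triple_const[where q = 1]) (auto dest: good_U)
next
  case (Suc l)
  show ?case unfolding clear_cells.simps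
    by (rule triple_seq[OF Suc.IH], rule triple_const[where q = 1])
      (use assms in \<open>auto dest: good_U simp: less_Suc_eq\<close>)
qed

text \<open>\<open>Copy T T\<close> stands for the empty program, which \<open>com\<close> does not
  offer.\<close>

primrec multiply_cells :: "nat \<Rightarrow> nat \<Rightarrow> nat \<Rightarrow> com" where
  "multiply_cells T k 0 = Op (Copy T T)"
| "multiply_cells T k (Suc l) = Seq (multiply_cells T k l) (Op (Mult_Op T T (k + l)))"

lemma triple_multiply_cells:
  assumes "k + l \<le> T"
  shows "triple r (\<lambda>R U h m. m = h \<and> m T \<le> 1 \<and> (\<forall>i<l. m (k + i) < U ^ q)) (multiply_cells T k l)
     (\<lambda>R U h m. m T = h T * (\<Prod>i<l. h (k + i)) \<and> (\<forall>a. a \<noteq> T \<longrightarrow> m a = h a) \<and> h T \<le> 1 \<and> (\<forall>i<l. h (k + i) < U ^ q))"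
proof -
  have *: "triple r (\<lambda>R U h m. m = h \<and> m T \<le> 1 \<and> (\<forall>i<l. m (k + i) < U ^ q)) (multiply_cells T k l')
     (\<lambda>R U h m. m T = h T * (\<Prod>i<l'. h (k + i)) \<and> (\<forall>a. a \<noteq> T \<longrightarrow> m a = h a) \<and> h T \<le> 1 \<and> (\<forall>i<l. h (k + i) < U ^ q))"
    if "l' \<le> l" for l'
    using that
  proof (induction l')
    case 0
    show ?case unfolding multiply_cells.simps by (rule triple_copy[where q = 1]) (auto dest: good_U)
  next
    case (Suc l')
    then have IH: "triple r (\<lambda>R U h m. m = h \<and> m T \<le> 1 \<and> (\<forall>i<l. m (k + i) < U ^ q)) (multiply_cells T k l')
     (\<lambda>R U h m. m T = h T * (\<Prod>i<l'. h (k + i)) \<and> (\<forall>a. a \<noteq> T \<longrightarrow> m a = h a) \<and> h T \<le> 1 \<and> (\<forall>i<l. h (k + i) < U ^ q))"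
      by simp
    show ?case unfolding multiply_cells.simps
    proof (rule triple_seq[OF IH], rule triple_mult[where q = "1 + Suc l' * q"])
      fix R X Y U h m
      assume g: "good R X Y U" and m: "m T = h T * (\<Prod>i<l'. h (k + i)) \<and> (\<forall>a. a \<noteq> T \<longrightarrow> m a = h a) \<and>
        h T \<le> 1 \<and> (\<forall>i<l. h (k + i) < U ^ q)"
      have e: "m T * m (k + l') = h T * (\<Prod>i<Suc l'. h (k + i))"
        using m assms Suc.prems by simp
      have "h T * (\<Prod>i<Suc l'. h (k + i)) \<le> 1 * (\<Prod>i<Suc l'. U ^ q)"
        using m Suc.prems by (intro mult_mono prod_mono) (auto intro: less_imp_le)
      also have "\<dots> = U ^ (Suc l' * q)" by (simp add: power_add power_mult[symmetric] mult.commute)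
      also have "\<dots> < U ^ (1 + Suc l' * q)" using good_U[OF g] by (intro power_strict_increasing) auto
      finally show "m T * m (k + l') < U ^ (1 + Suc l' * q) \<and>
        ((m(T := m T * m (k + l'))) T = h T * (\<Prod>i<Suc l'. h (k + i)) \<and>
         (\<forall>a. a \<noteq> T \<longrightarrow> (m(T := m T * m (k + l'))) a = h a) \<and> h T \<le> 1 \<and> (\<forall>i<l. h (k + i) < U ^ q))"
        unfolding e using m by simp
    qed
  qed
  show ?thesis by (rule *) simp
qed

text \<open>Pattern vertices double as addresses: cell \<open>v\<close> holds the image of
  \<open>v\<close>. Cells from \<open>t\<close> on are scratch space. Below \<open>t\<close> only
  the cells of \<open>C\<close> may change, so a nested computation preserves the images fixed by
  the levels around it.\<close>

definition computes ::
  "(nat \<times> nat) set \<Rightarrow> nat \<Rightarrow> nat set \<Rightarrow> nat set \<Rightarrow> nat \<Rightarrow> com \<Rightarrow> bool" where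
  "computes E r S C t c \<longleftrightarrow> triple r (\<lambda>R U h m. m = h \<and> (\<forall>v\<in>S. h v \<in> tails R)) c
     (\<lambda>R U h m. m t = num_ext E R S h C \<and> (\<forall>a<t. a \<notin> C \<longrightarrow> m a = h a))"

lemma add_less_power:
  fixes U :: nat
  assumes "a < U ^ p" "b \<le> U ^ q" "2 \<le> U"
  shows "a + b < U ^ (p + q + 1)"
proof -
  have "U ^ p \<le> U ^ (p + q)" "U ^ q \<le> U ^ (p + q)" using assms(3) by (intro power_increasing; simp)+
  then have "a + b < 2 * U ^ (p + q)" using assms(1,2) by linarith
  also have "\<dots> \<le> U * U ^ (p + q)" using assms(3) by simp
  finally show ?thesis by simp
qed

text \<open>An entry \<open>((a, Q), c)\<close> stands for the component \<open>insert a Q\<close>,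
  entered through the neighbour \<open>a\<close> of the vertex fixed by the level; \<open>c\<close>
  counts the extensions to the remaining vertices \<open>Q\<close>.\<close>

primrec accumulate :: "nat \<Rightarrow> nat \<Rightarrow> nat \<Rightarrow> ((nat \<times> nat set) \<times> com) list \<Rightarrow> com" where
  "accumulate y T k [] = Op (Set_Const T 0)"
| "accumulate y T k (x # xs) = Seq (Op (Copy (fst (fst x)) y))
     (Seq (snd x) (Seq (Op (Add_Op k k T)) (accumulate y T (Suc k) xs)))"

text \<open>This is the \<open>f\<^sub>j x y\<close> of the overview: \<open>h\<close> already
  contains the image \<open>x\<close> of the fixed vertex, and \<open>y\<close> is the image of the
  entry vertex.\<close>

definition branch_value ::
  "(nat \<times> nat) set \<Rightarrow> nat set \<Rightarrow> graph_rep \<Rightarrow> (nat \<Rightarrow> nat) \<Rightarrow> nat \<Rightarrow> nat \<times> nat set \<Rightarrow> nat" where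
  "branch_value E S R h y p = num_ext E R (insert (fst p) S) (h(fst p := y)) (snd p)"

lemma branch_value_cong:
  "(\<And>v. v \<in> S \<Longrightarrow> h v = h' v) \<Longrightarrow> branch_value E S R h y p = branch_value E S R h' y p"
  unfolding branch_value_def by (rule num_ext_cong) auto

lemma branch_value_le:
  "finite (snd p) \<Longrightarrow> good R X Y U \<Longrightarrow> branch_value E S R h y p \<le> U ^ card (snd p)"
  unfolding branch_value_def by (rule num_ext_le) (auto simp: good_def)

lemma triple_accumulate:
  assumes "\<forall>x\<in>set xs. fst (fst x) < n \<and> snd (fst x) \<subseteq> {..<n} \<and> fst (fst x) \<notin> S \<and>
      fst (fst x) \<notin> snd (fst x) \<and> S \<inter> snd (fst x) = {} \<and>
      computes E r (insert (fst (fst x)) S) (snd (fst x)) T (snd x)"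
    and "S \<subseteq> {..<n}" "n \<le> y" "y < k" "k + length xs \<le> T"
  shows "triple r (\<lambda>R U h m. m = h \<and> (\<forall>v\<in>S. h v \<in> tails R) \<and> h y \<in> tails R \<and> (\<forall>j<length xs. h (k + j) < U ^ q))
    (accumulate y T k xs)
    (\<lambda>R U h m. (\<forall>j<length xs. m (k + j) = h (k + j) + branch_value E S R h (h y) (fst (xs ! j))) \<and>
      (\<forall>a<T. (a < n \<longrightarrow> (\<forall>x\<in>set xs. a \<noteq> fst (fst x) \<and> a \<notin> snd (fst x))) \<and> (a < k \<or> k + length xs \<le> a) \<longrightarrow> m a = h a))"
  using assms
proof (induction xs arbitrary: k)
  case Nil
  show ?case unfolding accumulate.simps by (rule triple_const[where q = 1]) (auto dest: good_U)
next
  case (Cons x xs)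
  let ?a = "fst (fst x)" and ?Q = "snd (fst x)" and ?xs = "x # xs"
  let ?F = "\<lambda>R U h. (\<forall>v\<in>S. h v \<in> tails R) \<and> h y \<in> tails R \<and> (\<forall>j<length ?xs. h (k + j) < U ^ q)"
  let ?v = "\<lambda>R h p. branch_value E S R h (h y) p"
  have x: "?a < n" "?Q \<subseteq> {..<n}" "?a \<notin> S" "?a \<notin> ?Q" "S \<inter> ?Q = {}"
    "computes E r (insert ?a S) ?Q T (snd x)" using Cons.prems(1) by auto
  have fQ: "finite ?Q" using x(2) finite_subset by blast
  have 1: "triple r (\<lambda>R U h m. m = h \<and> ?F R U h) (Op (Copy ?a y)) (\<lambda>R U h m. m = h(?a := h y) \<and> ?F R U h)"
    by (rule triple_copy[where q = 1]) (auto simp: good_def)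
  have 2: "triple r (\<lambda>R U h m. m = h(?a := h y) \<and> ?F R U h) (snd x)
    (\<lambda>R U h m. m T = ?v R h (fst x) \<and> (\<forall>a<T. a \<noteq> ?a \<and> a \<notin> ?Q \<longrightarrow> m a = h a) \<and> ?F R U h)"
  proof (rule triple_conseq[OF x(6)[unfolded computes_def]])
    fix R X Y U h m assume "good R X Y U" "m = h(?a := h y) \<and> ?F R U h"
    then show "\<exists>g'. (m = g' \<and> (\<forall>v\<in>insert ?a S. g' v \<in> tails R)) \<and>
      (\<forall>m'. m' T = num_ext E R (insert ?a S) g' ?Q \<and> (\<forall>a<T. a \<notin> ?Q \<longrightarrow> m' a = g' a) \<longrightarrow>
         m' T = ?v R h (fst x) \<and> (\<forall>a<T. a \<noteq> ?a \<and> a \<notin> ?Q \<longrightarrow> m' a = h a) \<and> ?F R U h)"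
      by (intro exI[of _ m]) (auto simp: branch_value_def)
  qed
  have 3: "triple r (\<lambda>R U h m. m T = ?v R h (fst x) \<and> (\<forall>a<T. a \<noteq> ?a \<and> a \<notin> ?Q \<longrightarrow> m a = h a) \<and> ?F R U h)
    (Op (Add_Op k k T))
    (\<lambda>R U h m. m k = h k + ?v R h (fst x) \<and> (\<forall>a<T. a \<noteq> ?a \<and> a \<notin> ?Q \<and> a \<noteq> k \<longrightarrow> m a = h a) \<and> ?F R U h)"
  proof (rule triple_add[where q = "q + card ?Q + 1"])
    fix R X Y U h m
    assume g: "good R X Y U" and m: "m T = ?v R h (fst x) \<and> (\<forall>a<T. a \<noteq> ?a \<and> a \<notin> ?Q \<longrightarrow> m a = h a) \<and> ?F R U h"
    have k: "k < T" "k \<noteq> ?a" "k \<notin> ?Q" using Cons.prems x by auto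
    have h: "h k < U ^ q" using m by (metis add.right_neutral length_greater_0_conv list.distinct(1))
    have "h k + ?v R h (fst x) < U ^ (q + card ?Q + 1)"
      using h good_U[OF g] branch_value_le[OF fQ g] by (intro add_less_power) auto
    then show "m k + m T < U ^ (q + card ?Q + 1) \<and> (m(k := m k + m T)) k = h k + ?v R h (fst x) \<and>
       (\<forall>a<T. a \<noteq> ?a \<and> a \<notin> ?Q \<and> a \<noteq> k \<longrightarrow> (m(k := m k + m T)) a = h a) \<and> ?F R U h"
      using m k by auto
  qed
  have IH: "triple r (\<lambda>R U h m. m = h \<and> (\<forall>v\<in>S. h v \<in> tails R) \<and> h y \<in> tails R \<and> (\<forall>j<length xs. h (Suc k + j) < U ^ q))
    (accumulate y T (Suc k) xs)
    (\<lambda>R U h m. (\<forall>j<length xs. m (Suc k + j) = h (Suc k + j) + branch_value E S R h (h y) (fst (xs ! j))) \<and>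
      (\<forall>a<T. (a < n \<longrightarrow> (\<forall>x\<in>set xs. a \<noteq> fst (fst x) \<and> a \<notin> snd (fst x))) \<and> (a < Suc k \<or> Suc k + length xs \<le> a) \<longrightarrow> m a = h a))"
    by (rule Cons.IH) (use Cons.prems in auto)
  have 4: "triple r (\<lambda>R U h m. m k = h k + ?v R h (fst x) \<and> (\<forall>a<T. a \<noteq> ?a \<and> a \<notin> ?Q \<and> a \<noteq> k \<longrightarrow> m a = h a) \<and> ?F R U h)
    (accumulate y T (Suc k) xs)
    (\<lambda>R U h m. (\<forall>j<length ?xs. m (k + j) = h (k + j) + ?v R h (fst (?xs ! j))) \<and>
      (\<forall>a<T. (a < n \<longrightarrow> (\<forall>x\<in>set ?xs. a \<noteq> fst (fst x) \<and> a \<notin> snd (fst x))) \<and> (a < k \<or> k + length ?xs \<le> a) \<longrightarrow> m a = h a))"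
  proof (rule triple_conseq[OF IH], intro exI conjI allI impI)
    fix R X Y U h m
    assume g: "good R X Y U" and m: "m k = h k + ?v R h (fst x) \<and>
      (\<forall>a<T. a \<noteq> ?a \<and> a \<notin> ?Q \<and> a \<noteq> k \<longrightarrow> m a = h a) \<and> ?F R U h"
    have same: "m a = h a" if "a < T" "n \<le> a" "a \<noteq> k" for a
    proof -
      have "a \<noteq> ?a" "a \<notin> ?Q" using that x by auto
      then show ?thesis using m that by auto
    qed
    have sS: "m v = h v" if "v \<in> S" for v
    proof -
      have "v < n" "v \<noteq> ?a" "v \<notin> ?Q" using that x Cons.prems(2) by auto
      then show ?thesis using m Cons.prems by simp
    qed
    have my: "m y = h y" using same[of y] Cons.prems by auto
    have hi: "m (Suc k + j) = h (Suc k + j)" if "j < length xs" for j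
      by (rule same) (use that Cons.prems in auto)
    show "m = m" ..
    show "\<forall>v\<in>S. m v \<in> tails R" using sS m by auto
    show "m y \<in> tails R" using my m by simp
    show "m (Suc k + j) < U ^ q" if "j < length xs" for j
    proof -
      have "h (k + Suc j) < U ^ q" using m that by (metis Suc_less_eq length_Cons)
      then show ?thesis using hi[OF that] by simp
    qed
    fix m' assume m': "(\<forall>j<length xs. m' (Suc k + j) = m (Suc k + j) + ?v R m (fst (xs ! j))) \<and>
      (\<forall>a<T. (a < n \<longrightarrow> (\<forall>x\<in>set xs. a \<noteq> fst (fst x) \<and> a \<notin> snd (fst x))) \<and> (a < Suc k \<or> Suc k + length xs \<le> a) \<longrightarrow> m' a = m a)"
    \<comment> \<open>The first branch has overwritten pattern cells of its own component. This does
      not disturb the later ones, because a branch value reads \<open>h\<close> only on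
      \<open>S\<close>.\<close>
    have v: "?v R m p = ?v R h p" for p unfolding my by (rule branch_value_cong) (rule sS)
    show "m' (k + j) = h (k + j) + ?v R h (fst (?xs ! j))" if "j < length ?xs" for j
    proof (cases j)
      case 0
      have "m' k = m k" using m' Cons.prems by auto
      then show ?thesis using 0 m by simp
    next
      case (Suc i)
      then have "m' (Suc k + i) = m (Suc k + i) + ?v R m (fst (xs ! i))" using m' that by auto
      then show ?thesis using Suc hi[of i] that v by simp
    qed
    fix a assume a: "a < T" "(a < n \<longrightarrow> (\<forall>x\<in>set ?xs. a \<noteq> fst (fst x) \<and> a \<notin> snd (fst x))) \<and> (a < k \<or> k + length ?xs \<le> a)"
    have "m' a = m a" using m' a by auto
    moreover have "m a = h a" using m a x by (cases "a < n") (auto intro: same)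
    ultimately show "m' a = h a" by simp
  qed
  show ?case unfolding accumulate.simps
    by (rule triple_seq[OF 1 triple_seq[OF 2 triple_seq[OF 3 4]]])
qed

section \<open>Elimination schemes\<close>

fun separated :: "(nat \<times> nat) set \<Rightarrow> (nat \<times> nat set) list \<Rightarrow> bool" where
  "separated E [] \<longleftrightarrow> True"
| "separated E (p # ps) \<longleftrightarrow>
     (\<forall>p'\<in>set ps. indep E (insert (fst p) (snd p)) (insert (fst p') (snd p'))) \<and> separated E ps"

text \<open>Used to restrict the images of an entry vertex to the neighbours of the image of
  \<open>b\<close>.\<close>

lemma num_ext_zero:
  assumes "(u, v) \<in> E" "u \<in> S" "v \<in> S" "(h u, h v) \<notin> arcs R" "S \<inter> C = {}"
  shows "num_ext E R S h C = 0"
proof -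
  have "u \<notin> C" "v \<notin> C" using assms by auto
  then have "\<not> preserves E R (S \<union> C) (override_on h g C)" for g
    using assms unfolding preserves_def by (intro notI) (drule bspec[OF _ assms(1)], simp)
  then show ?thesis by (simp add: num_ext_def)
qed

lemma preserves_iff:
  "(\<forall>e\<in>E \<inter> S \<times> S. (g (fst e), g (snd e)) \<in> arcs R) \<longleftrightarrow> preserves E R S g"
  by (auto simp: preserves_def Ball_def split_paired_All)

text \<open>The leading indicator matters when \<open>ps\<close> is empty; otherwise every factor of
  the product already contains it.\<close>

lemma num_ext_separated:
  assumes "separated E ps" "\<And>p. p \<in> set ps \<Longrightarrow> finite (snd p) \<and> S \<inter> insert (fst p) (snd p) = {}"
  shows "num_ext E R S h (\<Union>p\<in>set ps. insert (fst p) (snd p)) = of_bool (preserves E R S h) *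
    prod_list (map (\<lambda>p. num_ext E R S h (insert (fst p) (snd p))) ps)"
  using assms
proof (induction ps)
  case Nil
  then show ?case by (simp add: num_ext_empty)
next
  case (Cons p ps)
  let ?D = "\<Union>p\<in>set ps. insert (fst p) (snd p)"
  have "indep E (insert (fst p) (snd p)) ?D"
    using Cons.prems(1) by (fastforce simp: indep_def)
  then have "num_ext E R S h (insert (fst p) (snd p) \<union> ?D) =
    num_ext E R S h (insert (fst p) (snd p)) * num_ext E R S h ?D"
  proof (intro num_ext_union)
    show "finite (insert (fst p) (snd p))" "finite ?D" using Cons.prems(2) by auto
    have "S \<inter> insert (fst p) (snd p) = {}" using Cons.prems(2)[of p] by simp
    moreover have "S \<inter> ?D = {}"
    proof (rule equals0I)
      fix x assume "x \<in> S \<inter> ?D"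
      then obtain q where "q \<in> set ps" "x \<in> insert (fst q) (snd q)" "x \<in> S" by auto
      then show False using Cons.prems(2)[of q] by auto
    qed
    ultimately show "S \<inter> (insert (fst p) (snd p) \<union> ?D) = {}" by (simp only: Int_Un_distrib Un_empty)
  qed
  then show ?case using Cons by simp
qed

section \<open>One pass over the arcs\<close>

locale level =
  fixes E :: "(nat \<times> nat) set" and n r t b :: nat and S :: "nat set"
    and br :: "(nat \<times> nat set) list" and cs :: "com list"
  assumes fin_E: "finite E" and S: "S \<subseteq> {..<n}" and b: "b < n" "b \<notin> S" and nt: "n \<le> t"
    and len: "length cs = length br"
    and br: "\<And>j. j < length br \<Longrightarrow> fst (br ! j) < n \<and> snd (br ! j) \<subseteq> {..<n} \<and>
      fst (br ! j) \<notin> insert b S \<and> fst (br ! j) \<notin> snd (br ! j) \<and> insert b S \<inter> snd (br ! j) = {}"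
    \<comment> \<open>The programs of the branches get their scratch space behind the seven working
      cells of the level and its accumulators.\<close>
    and cs: "\<And>j. j < length br \<Longrightarrow>
      computes E r (insert (fst (br ! j)) (insert b S)) (snd (br ! j)) (t + 7 + length br) (cs ! j)"
begin

definition "l = length br"
definition "T = t + 7 + l"
definition "verts = insert b (\<Union>p\<in>set br. insert (fst p) (snd p))"

text \<open>This and the following quantities refer to a list \<open>L\<close> of arcs read so far,
  so that they can serve in the loop invariant; for the complete arc list \<open>sum_acc\<close> is
  the number wanted.\<close>

definition "V R h x y j = branch_value E (insert b S) R (h(b := x)) y (br ! j)"
definition "acc R h L x j = (\<Sum>y | (x, y) \<in> set L. V R h x y j)"
definition "prod_acc R h L x =
  of_bool (preserves E R (insert b S) (h(b := x))) * (\<Prod>j<l. acc R h L x j)"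
definition "sum_acc R h L = (\<Sum>x\<in>fst ` set L. prod_acc R h L x)"
text \<open>The share of \<open>x\<close> in \<open>sum_acc\<close> so far. The case distinction is
  essential for a level without branches: there \<open>prod_acc\<close> is an empty product,
  possibly 1, although an unseen \<open>x\<close> has contributed nothing yet.\<close>

definition "old R h L x = (if x \<in> fst ` set L then prod_acc R h L x else 0)"

definition check_list :: "(nat \<times> nat) list" where
  "check_list = (SOME es. set es = E \<inter> insert b S \<times> insert b S)"

text \<open>Cell \<open>t\<close> holds the sum, \<open>t + 3\<close> the current first endpoint plus one (0 before the first
  arc), \<open>t + 4\<close> the contribution of this endpoint to the sum so far, \<open>t + 6\<close> the second endpoint,
  and \<open>t + 7 + j\<close> the accumulator of branch \<open>j\<close>. The contribution is updated in the sum after every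
  arc, so that nothing remains to be added after the last one.\<close>

definition body :: com where
  "body =
    Seq (Seq (Op (Set_Const (t + 5) 1)) (Seq (Op (Add_Op (t + 5) b (t + 5))) (Op (Sub_Op (t + 3) (t + 5) (t + 3)))))
    (Seq (IfNZ (t + 3) (clear_cells (t + 4) (t + 7) l))
    (Seq (Op (Copy (t + 3) (t + 5)))
    (Seq (accumulate (t + 6) T (t + 7) (zip br cs))
    (Seq (check_edges T check_list)
    (Seq (multiply_cells T (t + 7) l)
    (Seq (Op (Add_Op t t T)) (Seq (Op (Sub_Op t t (t + 4))) (Op (Copy (t + 4) T)))))))))"

definition level_com :: com where
  "level_com = Seq (Op (Set_Const t 0)) (Seq (Op (Set_Const (t + 3) 0)) (For b (t + 6) body))"

lemma set_check_list: "set check_list = E \<inter> insert b S \<times> insert b S"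
  unfolding check_list_def by (rule someI_ex) (rule finite_list, use fin_E in simp)

lemma finite_row: "finite {y. (x, y) \<in> set L}"
  by (rule finite_subset[of _ "snd ` set L"]) (auto intro: rev_image_eqI)

lemma acc_snoc:
  assumes "(x, y) \<notin> set L"
  shows "acc R h (L @ [(x, y)]) x j = acc R h L x j + V R h x y j"
proof -
  have "{y'. (x, y') \<in> set (L @ [(x, y)])} = insert y {y'. (x, y') \<in> set L}" by auto
  then show ?thesis using assms by (simp add: acc_def finite_row)
qed

lemma acc_snoc_other: "x' \<noteq> x \<Longrightarrow> acc R h (L @ [(x, y)]) x' j = acc R h L x' j"
  by (simp add: acc_def)

text \<open>A new arc changes only the summand of its first endpoint. With \<open>old\<close> on the
  left-hand side there is no subtraction to justify; the truncated subtraction in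
  \<open>body\<close> is seen to be exact from this equation.\<close>

lemma sum_acc_snoc:
  "sum_acc R h (L @ [(x, y)]) + old R h L x = sum_acc R h L + prod_acc R h (L @ [(x, y)]) x"
proof -
  let ?A = "fst ` set L - {x}"
  have "prod_acc R h (L @ [(x, y)]) x' = prod_acc R h L x'" if "x' \<in> ?A" for x'
    using that by (simp add: prod_acc_def acc_snoc_other)
  then have s: "(\<Sum>x'\<in>?A. prod_acc R h (L @ [(x, y)]) x') = (\<Sum>x'\<in>?A. prod_acc R h L x')"
    by (intro sum.cong) auto
  have "fst ` set (L @ [(x, y)]) = insert x ?A" by auto
  then have 1: "sum_acc R h (L @ [(x, y)]) = prod_acc R h (L @ [(x, y)]) x + (\<Sum>x'\<in>?A. prod_acc R h L x')"
    unfolding sum_acc_def s[symmetric] by (simp only:) (rule sum.insert; simp)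
  have 2: "sum_acc R h L = old R h L x + (\<Sum>x'\<in>?A. prod_acc R h L x')"
    by (auto simp: sum_acc_def old_def sum.remove)
  show ?thesis using 1 2 by simp
qed

lemma card_tails:
  assumes "good R X Y U" "A \<subseteq> tails R"
  shows "card A \<le> U"
proof -
  have "card A \<le> card (tails R)" using assms by (intro card_mono) auto
  then show ?thesis using assms by (simp add: good_def)
qed

text \<open>By symmetry of the arcs there are at most \<open>U\<close> second endpoints, each
  contributing at most \<open>U ^ n\<close>; one more factor \<open>U\<close> makes the inequality
  strict.\<close>

lemma acc_less:
  assumes "good R X Y U" "set L \<subseteq> arcs R" "j < l"
  shows "acc R h L x j < U ^ (n + 2)"
proof -
  have j: "snd (br ! j) \<subseteq> {..<n}" using br assms(3) by (simp add: l_def)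
  then have c: "finite (snd (br ! j))" "card (snd (br ! j)) \<le> n"
    using finite_subset card_mono[of "{..<n}"] by fastforce+
  have U: "2 \<le> U" using assms(1) by (rule good_U)
  have v: "V R h x y j \<le> U ^ n" for y
  proof -
    have "V R h x y j \<le> U ^ card (snd (br ! j))"
      unfolding V_def by (rule branch_value_le[OF c(1) assms(1)])
    also have "\<dots> \<le> U ^ n" using U c by (intro power_increasing) auto
    finally show ?thesis .
  qed
  have "{y. (x, y) \<in> set L} \<subseteq> tails R"
  proof
    fix y assume "y \<in> {y. (x, y) \<in> set L}"
    then have "(y, x) \<in> arcs R" using assms by (auto simp: good_def)
    then show "y \<in> tails R" by (force simp: tails_def)
  qed
  then have "card {y. (x, y) \<in> set L} \<le> U" using assms(1) card_tails by blast
  moreover have "acc R h L x j \<le> of_nat (card {y. (x, y) \<in> set L}) * U ^ n"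
    unfolding acc_def by (rule sum_bounded_above) (rule v)
  ultimately have "acc R h L x j \<le> U * U ^ n" by (metis le_trans mult_le_mono1 of_nat_id)
  also have "\<dots> < U ^ (n + 2)" using U by (simp add: power_add power2_eq_square)
  finally show ?thesis .
qed

lemma prod_acc_le:
  assumes "good R X Y U" "set L \<subseteq> arcs R"
  shows "prod_acc R h L x \<le> U ^ ((n + 2) * l)"
proof -
  have "(\<Prod>j<l. acc R h L x j) \<le> (\<Prod>j<l. U ^ (n + 2))"
    using acc_less[OF assms] by (intro prod_mono) (auto intro: less_imp_le)
  also have "\<dots> = U ^ ((n + 2) * l)" by (simp only: prod_constant card_lessThan power_mult)
  finally show ?thesis unfolding prod_acc_def by simp
qed

lemma sum_acc_le:
  assumes "good R X Y U" "set L \<subseteq> arcs R"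
  shows "sum_acc R h L \<le> U ^ ((n + 2) * l + 1)"
proof -
  have "fst ` set L \<subseteq> tails R" using assms by (auto simp: tails_def)
  then have c: "card (fst ` set L) \<le> U" using card_tails[OF assms(1)] by blast
  have "sum_acc R h L \<le> of_nat (card (fst ` set L)) * U ^ ((n + 2) * l)"
    unfolding sum_acc_def by (rule sum_bounded_above) (rule prod_acc_le[OF assms])
  also have "\<dots> \<le> U * U ^ ((n + 2) * l)" using c by simp
  finally show ?thesis by simp
qed

definition arc_fst :: "graph_rep \<Rightarrow> nat \<Rightarrow> nat" where "arc_fst R i = fst (arc_list R ! i)"
definition arc_snd :: "graph_rep \<Rightarrow> nat \<Rightarrow> nat" where "arc_snd R i = snd (arc_list R ! i)"
definition arc_prefix :: "graph_rep \<Rightarrow> nat \<Rightarrow> (nat \<times> nat) list" where "arc_prefix R i = take i (arc_list R)"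

definition seen :: "graph_rep \<Rightarrow> nat \<Rightarrow> bool" where
  "seen R i \<longleftrightarrow> arc_fst R i \<in> fst ` set (arc_prefix R i)"

definition frame where
  "frame R h m \<longleftrightarrow> (\<forall>v\<in>S. h v \<in> tails R) \<and> (\<forall>a<t. a \<notin> verts \<longrightarrow> m a = h a)"

definition accs where
  "accs R h L x m \<longleftrightarrow> (\<forall>j<l. m (t + 7 + j) = acc R h L x j)"

text \<open>Between iterations the tag, the contribution and the accumulators belong to the first
  endpoint of the arc read last, which is arc \<open>i - 1\<close>.\<close>

definition loop_inv where
  "loop_inv R h i m \<longleftrightarrow> frame R h m \<and> m t = sum_acc R h (arc_prefix R i) \<and>
    (if i = 0 then m (t + 3) = 0
     else m (t + 3) = arc_fst R (i - 1) + 1 \<and> m (t + 4) = prod_acc R h (arc_prefix R i) (arc_fst R (i - 1)) \<and>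
       accs R h (arc_prefix R i) (arc_fst R (i - 1)) m)"

definition base where
  "base R h i m \<longleftrightarrow> i < length (arc_list R) \<and> frame R h m \<and> m b = arc_fst R i \<and> m (t + 6) = arc_snd R i"

definition arc_loaded where
  "arc_loaded R h i m \<longleftrightarrow> base R h i m \<and> m t = sum_acc R h (arc_prefix R i) \<and>
    (if seen R i
     then m (t + 3) = arc_fst R i + 1 \<and> m (t + 4) = prod_acc R h (arc_prefix R i) (arc_fst R i) \<and>
        accs R h (arc_prefix R i) (arc_fst R i) m
     else m (t + 3) \<le> arc_fst R i)"

text \<open>Cell \<open>t + 3\<close> now holds the truncated difference of the new tag and the old
  one. First endpoints never decrease, so it is 0 exactly if the first endpoint has stayed the same;
  the initial tag 0 makes the very first arc open a group.\<close>

definition group_compared where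
  "group_compared R h i m \<longleftrightarrow> base R h i m \<and> m t = sum_acc R h (arc_prefix R i) \<and> m (t + 5) = arc_fst R i + 1 \<and>
    (if seen R i
     then m (t + 3) = 0 \<and> m (t + 4) = prod_acc R h (arc_prefix R i) (arc_fst R i) \<and>
        accs R h (arc_prefix R i) (arc_fst R i) m
     else m (t + 3) \<noteq> 0)"

definition group_reset where
  "group_reset R h i m \<longleftrightarrow> base R h i m \<and> m t = sum_acc R h (arc_prefix R i) \<and>
     m (t + 4) = old R h (arc_prefix R i) (arc_fst R i)"

lemma b_ne [simp]: "b \<noteq> t" "b \<noteq> t + j" "t \<noteq> b" "t + j \<noteq> b"
  using b nt by auto

lemma b_verts: "b \<in> verts" by (simp add: verts_def)

lemma frame_upd: "t \<le> a \<or> a \<in> verts \<Longrightarrow> frame R h (m(a := v)) = frame R h m"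
  by (auto simp: frame_def)

lemma base_upd: "t \<le> a \<Longrightarrow> a \<noteq> t + 6 \<Longrightarrow> base R h i (m(a := v)) = base R h i m"
  using b nt by (auto simp: base_def frame_upd)

lemma accs_upd:
  assumes "a < t + 7 \<or> T \<le> a"
  shows "accs R h L x (m(a := v)) = accs R h L x m"
proof -
  have "t + 7 + j \<noteq> a" if "j < l" for j using that assms by (auto simp: T_def)
  then show ?thesis by (simp add: accs_def)
qed

lemma accs_upd_b: "accs R h L x (m(b := v)) = accs R h L x m"
  by (rule accs_upd) (use b nt in simp)

text \<open>Sortedness makes the arcs with a common first endpoint contiguous: if this endpoint has
  occurred at all, then already in the preceding arc, and the accumulators are the right ones.
  Otherwise the preceding endpoint is smaller, so its tag, which is larger by one, is at most the
  new endpoint.\<close>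

lemma loop_inv_arc_loaded:
  assumes "good R X Y U" "i < length (arc_list R)" "loop_inv R h i m"
  shows "arc_loaded R h i (m(b := fst (arc_list R ! i), t + 6 := snd (arc_list R ! i)))" (is "arc_loaded R h i ?m")
proof -
  have "frame R h m" "m t = sum_acc R h (arc_prefix R i)" using assms(3) by (simp_all add: loop_inv_def)
  then have 1: "base R h i ?m" "m t = sum_acc R h (arc_prefix R i)"
    using assms(2) b_verts by (simp_all add: base_def frame_upd arc_fst_def arc_snd_def)
  have sorted: "sorted (map fst (arc_list R))" using assms by (simp add: good_def)
  have le: "arc_fst R i' \<le> arc_fst R i" if "i' \<le> i" for i'
    using sorted_nth_mono[OF sorted that] assms(2) that by (simp add: arc_fst_def)
  have pre: "fst ` set (arc_prefix R i) = arc_fst R ` {..<i}"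
    using nth_image[of i "arc_list R"] assms(2)
    by (simp add: arc_prefix_def arc_fst_def image_image lessThan_atLeast0 flip: nth_image)
  have "if seen R i
     then m (t + 3) = arc_fst R i + 1 \<and> m (t + 4) = prod_acc R h (arc_prefix R i) (arc_fst R i) \<and>
        accs R h (arc_prefix R i) (arc_fst R i) m
     else m (t + 3) \<le> arc_fst R i"
  proof (cases i)
    case 0
    then show ?thesis using assms(3) pre by (simp add: loop_inv_def seen_def)
  next
    case (Suc i')
    show ?thesis
    proof (cases "seen R i")
      case True
      then obtain i'' where i'': "i'' < i" "arc_fst R i = arc_fst R i''" unfolding seen_def pre by auto
      have "arc_fst R i'' \<le> arc_fst R i'"
        using sorted_nth_mono[OF sorted, of i'' i'] i'' Suc assms(2) by (simp add: arc_fst_def)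
      then have "arc_fst R i' = arc_fst R i" using le[of i'] i'' Suc by simp
      then show ?thesis using assms(3) Suc True by (simp add: loop_inv_def)
    next
      case False
      then have "arc_fst R i \<notin> arc_fst R ` {..<i}" "i' \<in> {..<i}" using pre Suc by (auto simp: seen_def)
      then have "arc_fst R i' \<noteq> arc_fst R i" by (metis imageI)
      then have "arc_fst R i' < arc_fst R i" using le[of i'] Suc by simp
      then show ?thesis using assms(3) Suc False by (simp add: loop_inv_def)
    qed
  qed
  then show ?thesis using 1 by (auto simp: arc_loaded_def accs_upd accs_upd_b)
qed

lemma arc_fst_less: "good R X Y U \<Longrightarrow> i < length (arc_list R) \<Longrightarrow> arc_fst R i + 1 < U ^ 2"
proof -
  assume g: "good R X Y U" and i: "i < length (arc_list R)"
  have "arc_fst R i < U" using good_arc(1)[OF g i] g by (simp add: good_def arc_fst_def)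
  moreover have "U * 2 \<le> U * U" using good_U[OF g] by simp
  ultimately have "arc_fst R i + 1 < U * U" using good_U[OF g] by linarith
  then show ?thesis by (simp add: power2_eq_square)
qed

lemma arc_prefix_arcs: "set (arc_prefix R i) \<subseteq> arcs R"
  by (auto simp: arc_prefix_def arcs_def dest: in_set_takeD)

lemma arc_prefix_Suc: "i < length (arc_list R) \<Longrightarrow> arc_prefix R (Suc i) = arc_prefix R i @ [(arc_fst R i, arc_snd R i)]"
  by (simp add: arc_prefix_def arc_fst_def arc_snd_def take_Suc_conv_app_nth)

lemma arc_prefix_new:
  assumes "good R X Y U" "i < length (arc_list R)"
  shows "(arc_fst R i, arc_snd R i) \<notin> set (arc_prefix R i)"
proof
  assume "(arc_fst R i, arc_snd R i) \<in> set (arc_prefix R i)"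
  then obtain i' where "i' < i" "arc_list R ! i' = arc_list R ! i"
    using assms(2) by (auto simp: arc_prefix_def arc_fst_def arc_snd_def set_conv_nth)
  then show False using assms nth_eq_iff_index_eq[of "arc_list R" i' i] by (auto simp: good_def)
qed

definition group_entered where
  "group_entered R h i m \<longleftrightarrow> group_reset R h i m \<and> m (t + 3) = arc_fst R i + 1"

lemma triple_new_group:
  "triple r (\<lambda>R U (h, i) m. arc_loaded R h i m)
    (Seq (Op (Set_Const (t + 5) 1)) (Seq (Op (Add_Op (t + 5) b (t + 5))) (Op (Sub_Op (t + 3) (t + 5) (t + 3)))))
    (\<lambda>R U (h, i) m. group_compared R h i m)"
proof -
  have 1: "triple r (\<lambda>R U (h, i) m. arc_loaded R h i m) (Op (Set_Const (t + 5) 1))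
    (\<lambda>R U (h, i) m. arc_loaded R h i m \<and> m (t + 5) = 1)"
    by (rule triple_const[where q = 1]) (auto dest: good_U simp: arc_loaded_def base_upd accs_upd)
  have 2: "triple r (\<lambda>R U (h, i) m. arc_loaded R h i m \<and> m (t + 5) = 1) (Op (Add_Op (t + 5) b (t + 5)))
    (\<lambda>R U (h, i) m. arc_loaded R h i m \<and> m (t + 5) = arc_fst R i + 1)"
    by (rule triple_add[where q = 2])
      (auto dest: arc_fst_less simp: arc_loaded_def base_upd accs_upd base_def[of _ _ _ m for m] frame_upd)
  have 3: "triple r (\<lambda>R U (h, i) m. arc_loaded R h i m \<and> m (t + 5) = arc_fst R i + 1) (Op (Sub_Op (t + 3) (t + 5) (t + 3)))
    (\<lambda>R U (h, i) m. group_compared R h i m)"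
  proof (rule triple_sub[where q = 2], clarify)
    fix R X Y U h i m assume g: "good R X Y U" and p: "arc_loaded R h i m" and t3: "m (t + 5) = arc_fst R i + 1"
    have "arc_fst R i + 1 < U ^ 2" using arc_fst_less[OF g] p by (simp add: arc_loaded_def base_def)
    moreover have "0 < U" using good_U[OF g] by simp
    ultimately show "m (t + 5) - m (t + 3) < U ^ 2 \<and> group_compared R h i (m(t + 3 := m (t + 5) - m (t + 3)))"
      using p t3 by (auto simp: arc_loaded_def group_compared_def base_upd accs_upd)
  qed
  show ?thesis by (rule triple_seq[OF 1 triple_seq[OF 2 3]])
qed

lemma triple_reset:
  "triple r (\<lambda>R U (h, i) m. group_compared R h i m) (IfNZ (t + 3) (clear_cells (t + 4) (t + 7) l))
    (\<lambda>R U (h, i) m. group_reset R h i m \<and> m (t + 5) = arc_fst R i + 1 \<and> accs R h (arc_prefix R i) (arc_fst R i) m)"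
proof (rule triple_if, goal_cases)
  case 1
  show ?case
  proof (rule triple_conseq[OF triple_clear_cells[of "t + 4" "t + 7" r l]], goal_cases)
    case (2 R X Y U g m)
    obtain h i where g: "g = (h, i)" by (cases g)
    have p: "group_compared R h i m" "m (t + 3) \<noteq> 0" using 2 g by auto
    then have "\<not> seen R i" by (auto simp: group_compared_def)
    then have new: "arc_fst R i \<notin> fst ` set (arc_prefix R i)" by (simp add: seen_def)
    \<comment> \<open>No arc of the prefix starts at the new endpoint, so cleared accumulators hold
      the correct values.\<close>
    have a: "acc R h (arc_prefix R i) (arc_fst R i) j = 0" for j
    proof -
      have "{y. (arc_fst R i, y) \<in> set (arc_prefix R i)} = {}" using new by force
      then show ?thesis by (simp add: acc_def)
    qed
    have "group_reset R h i m' \<and> m' (t + 5) = arc_fst R i + 1 \<and> accs R h (arc_prefix R i) (arc_fst R i) m'"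
      if m': "m' (t + 4) = 0 \<and> (\<forall>i<l. m' (t + 7 + i) = 0) \<and>
        (\<forall>a. a \<noteq> t + 4 \<and> (a < t + 7 \<or> t + 7 + l \<le> a) \<longrightarrow> m' a = m a)" for m'
    proof -
      have "frame R h m'" using p m' by (auto simp: group_compared_def base_def frame_def)
      moreover have "m' b = m b" using b nt m' by auto
      ultimately have "base R h i m'" using p m' by (auto simp: group_compared_def base_def)
      moreover have "m' t = m t" "m' (t + 5) = m (t + 5)" using m' by auto
      ultimately show ?thesis using p m' new a by (auto simp: group_compared_def group_reset_def old_def accs_def)
    qed
    then show ?case using g by (intro exI[of _ m]) simp
  qed simp
next
  case 2
  then show ?case by (auto simp: group_compared_def group_reset_def old_def seen_def[symmetric] split: if_splits)
qed

lemma triple_copy_group: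
  "triple r (\<lambda>R U (h, i) m. group_reset R h i m \<and> m (t + 5) = arc_fst R i + 1 \<and> accs R h (arc_prefix R i) (arc_fst R i) m)
    (Op (Copy (t + 3) (t + 5)))
    (\<lambda>R U (h, i) m. group_entered R h i m \<and> accs R h (arc_prefix R i) (arc_fst R i) m)"
  by (rule triple_copy[where q = 2])
    (auto dest: arc_fst_less simp: group_reset_def group_entered_def base_upd accs_upd base_def frame_upd)

lemma S_verts: "v \<in> S \<Longrightarrow> v \<notin> verts"
proof
  assume vS: "v \<in> S" and "v \<in> verts"
  moreover have "v \<noteq> b" using vS b by auto
  ultimately obtain p where p: "p \<in> set br" "v = fst p \<or> v \<in> snd p" by (auto simp: verts_def)
  then obtain j where "j < length br" "p = br ! j" by (metis in_set_conv_nth)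
  then show False using br[of j] p vS by auto
qed

lemma triple_branches:
  "triple r (\<lambda>R U (h, i) m. group_entered R h i m \<and> accs R h (arc_prefix R i) (arc_fst R i) m)
    (accumulate (t + 6) T (t + 7) (zip br cs))
    (\<lambda>R U (h, i) m. group_entered R h i m \<and> accs R h (arc_prefix R (Suc i)) (arc_fst R i) m)"
proof -
  have ln: "length (zip br cs) = l" using len by (simp add: l_def)
  have el: "fst (fst x) < n \<and> snd (fst x) \<subseteq> {..<n} \<and> fst (fst x) \<notin> insert b S \<and>
      fst (fst x) \<notin> snd (fst x) \<and> insert b S \<inter> snd (fst x) = {} \<and>
      computes E r (insert (fst (fst x)) (insert b S)) (snd (fst x)) T (snd x)"
    if x: "x \<in> set (zip br cs)" for x
  proof -
    obtain j where "j < length (zip br cs)" "x = zip br cs ! j" using x by (metis in_set_conv_nth)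
    then have "j < length br" "x = (br ! j, cs ! j)" using len by auto
    then show ?thesis using br[of j] cs[of j] by (simp add: T_def l_def)
  qed
  have *: "triple r (\<lambda>R U h m. m = h \<and> (\<forall>v\<in>insert b S. h v \<in> tails R) \<and> h (t + 6) \<in> tails R \<and>
      (\<forall>j<length (zip br cs). h (t + 7 + j) < U ^ (n + 2)))
    (accumulate (t + 6) T (t + 7) (zip br cs))
    (\<lambda>R U h m. (\<forall>j<length (zip br cs). m (t + 7 + j) = h (t + 7 + j) +
        branch_value E (insert b S) R h (h (t + 6)) (fst (zip br cs ! j))) \<and>
      (\<forall>a<T. (a < n \<longrightarrow> (\<forall>x\<in>set (zip br cs). a \<noteq> fst (fst x) \<and> a \<notin> snd (fst x))) \<and>
        (a < t + 7 \<or> t + 7 + length (zip br cs) \<le> a) \<longrightarrow> m a = h a))"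
    by (rule triple_accumulate[where n = n]) (use el S b nt ln in \<open>auto simp: T_def\<close>)
  show ?thesis
  proof (rule triple_conseq[OF *], unfold ln, goal_cases)
    case (1 R X Y U gh m)
    obtain h i where gh: "gh = (h, i)" by (cases gh)
    have g: "good R X Y U" and q: "group_entered R h i m" and ac: "accs R h (arc_prefix R i) (arc_fst R i) m"
      using 1 gh by auto
    let ?x = "arc_fst R i" and ?y = "arc_snd R i"
    have i: "i < length (arc_list R)" and fr: "frame R h m" and mb: "m b = ?x" and my: "m (t + 6) = ?y"
      using q by (auto simp: group_entered_def group_reset_def base_def)
    have mS: "m v = (h(b := ?x)) v" if "v \<in> insert b S" for v
      using that fr S S_verts nt mb b by (auto simp: frame_def)
    have tl: "\<forall>v\<in>insert b S. m v \<in> tails R"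
      using mS fr good_arc(1)[OF g i] by (auto simp: frame_def arc_fst_def)
    have bd: "\<forall>j<l. m (t + 7 + j) < U ^ (n + 2)"
      using ac acc_less[OF g arc_prefix_arcs] by (simp add: accs_def)
    have "group_entered R h i m' \<and> accs R h (arc_prefix R (Suc i)) ?x m'"
      if m': "(\<forall>j<l. m' (t + 7 + j) = m (t + 7 + j) +
        branch_value E (insert b S) R m (m (t + 6)) (fst (zip br cs ! j)))"
        "(\<forall>a<T. (a < n \<longrightarrow> (\<forall>x\<in>set (zip br cs). a \<noteq> fst (fst x) \<and> a \<notin> snd (fst x))) \<and>
        (a < t + 7 \<or> t + 7 + l \<le> a) \<longrightarrow> m' a = m a)" for m'
    proof -
      have hi: "m' a = m a" if "n \<le> a" "a < t + 7" for a using m'(2) that by (simp add: T_def)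
      have lo: "m' a = m a" if "a < t" "a \<notin> verts \<or> a = b" for a
      proof -
        have "a \<noteq> fst (fst x) \<and> a \<notin> snd (fst x)" if "x \<in> set (zip br cs)" for x
          using el[OF that] \<open>a \<notin> verts \<or> a = b\<close> set_zip_leftD[of "fst x" "snd x" br cs] that
          by (auto simp: verts_def)
        then show ?thesis using m'(2) that by (simp add: T_def)
      qed
      have "frame R h m'" using fr lo by (auto simp: frame_def)
      moreover have "m' b = m b" using lo[of b] b nt by simp
      moreover have "m' (t + 6) = m (t + 6)" "m' t = m t" "m' (t + 3) = m (t + 3)" "m' (t + 4) = m (t + 4)"
        by (rule hi; use nt in simp)+
      ultimately have 1: "group_entered R h i m'" using q by (simp add: group_entered_def group_reset_def base_def)
      have "m' (t + 7 + j) = acc R h (arc_prefix R (Suc i)) ?x j" if j: "j < l" for j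
      proof -
        have "branch_value E (insert b S) R m (m (t + 6)) (fst (zip br cs ! j)) = V R h ?x ?y j"
          unfolding V_def my using j len by (subst branch_value_cong[OF mS]) (auto simp: l_def)
        then show ?thesis
          using m'(1) ac j acc_snoc[OF arc_prefix_new[OF g i]] i by (simp add: accs_def arc_prefix_Suc)
      qed
      then show ?thesis using 1 by (simp add: accs_def)
    qed
    then show ?case unfolding gh
      using tl bd my good_arc(2)[OF g i] by (intro exI[of _ m]) (auto simp: arc_snd_def)
  qed
qed

lemma group_entered_cong: "(\<And>a. a < T \<Longrightarrow> m' a = m a) \<Longrightarrow> group_entered R h i m' = group_entered R h i m"
  using b nt by (simp add: group_entered_def group_reset_def base_def frame_def T_def)

lemma accs_cong: "(\<And>a. a < T \<Longrightarrow> m' a = m a) \<Longrightarrow> accs R h L x m' = accs R h L x m"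
  by (simp add: accs_def T_def)

lemma base_values:
  assumes "good R X Y U" "base R h i m" "v \<in> insert b S"
  shows "m v = (h(b := arc_fst R i)) v" "m v \<in> tails R"
proof -
  show 1: "m v = (h(b := arc_fst R i)) v"
    using assms S nt S_verts b by (auto simp: base_def frame_def)
  have "arc_fst R i \<in> tails R" "\<forall>v\<in>S. h v \<in> tails R"
    using good_arc(1)[OF assms(1), of i] assms(2) by (auto simp: base_def frame_def arc_fst_def)
  then show "m v \<in> tails R" unfolding 1 using assms(3) by auto
qed

lemma triple_check:
  "triple r (\<lambda>R U (h, i) m. group_entered R h i m \<and> accs R h (arc_prefix R (Suc i)) (arc_fst R i) m)
    (check_edges T check_list)
    (\<lambda>R U (h, i) m. group_entered R h i m \<and> accs R h (arc_prefix R (Suc i)) (arc_fst R i) m \<and>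
       m T = of_bool (preserves E R (insert b S) (h(b := arc_fst R i))))"
proof -
  have in_S: "fst e \<in> insert b S" "snd e \<in> insert b S" if "e \<in> set check_list" for e
  proof -
    have "e \<in> insert b S \<times> insert b S" using that unfolding set_check_list by (rule IntD2)
    then show "fst e \<in> insert b S" "snd e \<in> insert b S" by (simp_all only: mem_Times_iff)
  qed
  have lt: "\<forall>e\<in>set check_list. fst e < T \<and> snd e < T"
  proof -
    have "v < T" if "v \<in> insert b S" for v
    proof -
      have "v < n" using that S b by auto
      then show ?thesis using nt by (simp add: T_def)
    qed
    then show ?thesis using in_S by blast
  qed
  show ?thesis
  proof (rule triple_conseq[OF triple_check_edges[OF lt]], goal_cases)
    case (1 R X Y U gh m)
    obtain h i where gh: "gh = (h, i)" by (cases gh)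
    have q: "group_entered R h i m" and ac: "accs R h (arc_prefix R (Suc i)) (arc_fst R i) m" using 1 gh by auto
    then have bs: "base R h i m" by (simp add: group_entered_def group_reset_def)
    have pr: "(\<forall>e\<in>set check_list. (m (fst e), m (snd e)) \<in> arcs R) \<longleftrightarrow>
      preserves E R (insert b S) (h(b := arc_fst R i))"
    proof -
      have "(\<forall>e\<in>set check_list. (m (fst e), m (snd e)) \<in> arcs R) \<longleftrightarrow> preserves E R (insert b S) m"
        unfolding set_check_list by (rule preserves_iff)
      also have "\<dots> \<longleftrightarrow> preserves E R (insert b S) (h(b := arc_fst R i))"
        by (rule preserves_cong) (rule base_values(1)[OF 1(1) bs])
      finally show ?thesis .
    qed
    have "group_entered R h i m' \<and> accs R h (arc_prefix R (Suc i)) (arc_fst R i) m'" if "\<forall>a<T. m' a = m a" for m'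
      using q ac group_entered_cong[of m' m] accs_cong[of m' m] that by simp
    moreover have "\<forall>e\<in>set check_list. m (fst e) \<in> tails R \<and> m (snd e) \<in> tails R"
      using in_S base_values(2)[OF 1(1) bs] by blast
    ultimately show ?case unfolding gh using pr
      by (intro exI[of _ m]) simp
  qed
qed

lemma triple_multiply:
  "triple r (\<lambda>R U (h, i) m. group_entered R h i m \<and> accs R h (arc_prefix R (Suc i)) (arc_fst R i) m \<and>
       m T = of_bool (preserves E R (insert b S) (h(b := arc_fst R i))))
    (multiply_cells T (t + 7) l)
    (\<lambda>R U (h, i) m. group_entered R h i m \<and> accs R h (arc_prefix R (Suc i)) (arc_fst R i) m \<and>
       m T = prod_acc R h (arc_prefix R (Suc i)) (arc_fst R i))"
proof (rule triple_conseq[OF triple_multiply_cells[where q = "n + 2"]], goal_cases)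
  case 1 show ?case by (simp add: T_def)
next
  case (2 R X Y U gh m)
  obtain h i where gh: "gh = (h, i)" by (cases gh)
  have q: "group_entered R h i m" and ac: "accs R h (arc_prefix R (Suc i)) (arc_fst R i) m"
    and mT: "m T = of_bool (preserves E R (insert b S) (h(b := arc_fst R i)))" using 2 gh by auto
  have "group_entered R h i m' \<and> accs R h (arc_prefix R (Suc i)) (arc_fst R i) m'" if "\<forall>a. a \<noteq> T \<longrightarrow> m' a = m a" for m'
    using q ac group_entered_cong[of m' m] accs_cong[of m' m] that by simp
  moreover have "m T * (\<Prod>j<l. m (t + 7 + j)) = prod_acc R h (arc_prefix R (Suc i)) (arc_fst R i)"
    using ac by (simp add: mT prod_acc_def accs_def)
  moreover have "\<forall>j<l. m (t + 7 + j) < U ^ (n + 2)"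
    using ac acc_less[OF 2(1) arc_prefix_arcs] by (simp add: accs_def)
  ultimately show ?case unfolding gh using mT by (intro exI[of _ m]) auto
qed

lemma triple_update:
  "triple r (\<lambda>R U (h, i) m. group_entered R h i m \<and> accs R h (arc_prefix R (Suc i)) (arc_fst R i) m \<and>
       m T = prod_acc R h (arc_prefix R (Suc i)) (arc_fst R i))
    (Seq (Op (Add_Op t t T)) (Seq (Op (Sub_Op t t (t + 4))) (Op (Copy (t + 4) T))))
    (\<lambda>R U (h, i) m. loop_inv R h (Suc i) m)"
proof -
  let ?M = "\<lambda>R h i m. base R h i m \<and> m (t + 3) = arc_fst R i + 1 \<and>
    accs R h (arc_prefix R (Suc i)) (arc_fst R i) m \<and> m T = prod_acc R h (arc_prefix R (Suc i)) (arc_fst R i)"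
  let ?e = "(n + 2) * l"
  have T: "t \<le> T" "t \<noteq> T" "t + 4 \<noteq> T" "t + 4 < t + 7" "t + 3 \<noteq> T" "T \<noteq> t + 4" "T \<noteq> t" by (auto simp: T_def)
  have 1: "triple r (\<lambda>R U (h, i) m. group_entered R h i m \<and> accs R h (arc_prefix R (Suc i)) (arc_fst R i) m \<and>
       m T = prod_acc R h (arc_prefix R (Suc i)) (arc_fst R i)) (Op (Add_Op t t T))
    (\<lambda>R U (h, i) m. ?M R h i m \<and> m (t + 4) = old R h (arc_prefix R i) (arc_fst R i) \<and>
       m t = sum_acc R h (arc_prefix R i) + prod_acc R h (arc_prefix R (Suc i)) (arc_fst R i))"
  proof (rule triple_add[where q = "(?e + 2) + ?e + 1"], goal_cases)
    case (1 R X Y U gh m)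
    obtain h i where gh: "gh = (h, i)" by (cases gh)
    have q: "group_entered R h i m" using 1 gh by auto
    have "sum_acc R h (arc_prefix R i) \<le> U ^ (?e + 1)" by (rule sum_acc_le[OF 1(1) arc_prefix_arcs])
    also have "\<dots> < U ^ (?e + 2)" using good_U[OF 1(1)] by (intro power_strict_increasing) auto
    finally have "sum_acc R h (arc_prefix R i) + prod_acc R h (arc_prefix R (Suc i)) (arc_fst R i) < U ^ ((?e + 2) + ?e + 1)"
      using prod_acc_le[OF 1(1) arc_prefix_arcs] good_U[OF 1(1)] by (intro add_less_power)
    then show ?case using 1(2) T unfolding gh by (simp add: group_entered_def group_reset_def base_upd accs_upd)
  qed
  have 2: "triple r (\<lambda>R U (h, i) m. ?M R h i m \<and> m (t + 4) = old R h (arc_prefix R i) (arc_fst R i) \<and>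
       m t = sum_acc R h (arc_prefix R i) + prod_acc R h (arc_prefix R (Suc i)) (arc_fst R i))
    (Op (Sub_Op t t (t + 4)))
    (\<lambda>R U (h, i) m. ?M R h i m \<and> m t = sum_acc R h (arc_prefix R (Suc i)))"
  proof (rule triple_sub[where q = "?e + 2"], goal_cases)
    case (1 R X Y U gh m)
    obtain h i where gh: "gh = (h, i)" by (cases gh)
    have m: "?M R h i m" "m (t + 4) = old R h (arc_prefix R i) (arc_fst R i)"
      "m t = sum_acc R h (arc_prefix R i) + prod_acc R h (arc_prefix R (Suc i)) (arc_fst R i)"
      using 1 gh by auto
    have e: "m t - m (t + 4) = sum_acc R h (arc_prefix R (Suc i))"
    proof -
      have "i < length (arc_list R)" using m(1) by (simp add: base_def)
      then show ?thesis
        using sum_acc_snoc[of R h "arc_prefix R i" "arc_fst R i" "arc_snd R i"] m(2,3) by (simp add: arc_prefix_Suc)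
    qed
    have "sum_acc R h (arc_prefix R (Suc i)) \<le> U ^ (?e + 1)" by (rule sum_acc_le[OF 1(1) arc_prefix_arcs])
    also have "\<dots> < U ^ (?e + 2)" using good_U[OF 1(1)] by (intro power_strict_increasing) auto
    finally show ?case using m(1) T unfolding gh e by (simp add: base_upd accs_upd)
  qed
  have 3: "triple r (\<lambda>R U (h, i) m. ?M R h i m \<and> m t = sum_acc R h (arc_prefix R (Suc i)))
    (Op (Copy (t + 4) T)) (\<lambda>R U (h, i) m. loop_inv R h (Suc i) m)"
  proof (rule triple_copy[where q = "?e + 1"], goal_cases)
    case (1 R X Y U gh m)
    obtain h i where gh: "gh = (h, i)" by (cases gh)
    have "prod_acc R h (arc_prefix R (Suc i)) (arc_fst R i) \<le> U ^ ?e" by (rule prod_acc_le[OF 1(1) arc_prefix_arcs])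
    also have "\<dots> < U ^ (?e + 1)" using good_U[OF 1(1)] by (intro power_strict_increasing) auto
    finally show ?case using 1(2) T unfolding gh by (simp add: loop_inv_def base_def frame_upd accs_upd)
  qed
  show ?thesis by (rule triple_seq[OF 1 triple_seq[OF 2 3]])
qed

lemma triple_body:
  "triple r (\<lambda>R U (h, i) m. i < length (arc_list R) \<and> (\<exists>m'. loop_inv R h i m' \<and>
       m = m'(b := fst (arc_list R ! i), t + 6 := snd (arc_list R ! i))))
    body (\<lambda>R U (h, i) m. loop_inv R h (Suc i) m)"
proof -
  have 0: "triple r (\<lambda>R U (h, i) m. arc_loaded R h i m) body (\<lambda>R U (h, i) m. loop_inv R h (Suc i) m)"
    unfolding body_def
    by (rule triple_seq[OF triple_new_group triple_seq[OF triple_reset triple_seq[OF triple_copy_group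
      triple_seq[OF triple_branches triple_seq[OF triple_check triple_seq[OF triple_multiply triple_update]]]]]])
  show ?thesis
  proof (rule triple_conseq[OF 0], goal_cases)
    case (1 R X Y U gh m)
    obtain h i where gh: "gh = (h, i)" by (cases gh)
    have "arc_loaded R h i m" using 1 loop_inv_arc_loaded[OF 1(1)] unfolding gh by auto
    then show ?case unfolding gh by (intro exI[of _ "(h, i)"]) simp
  qed
qed

lemma triple_level:
  "triple (Suc r) (\<lambda>R U h m. m = h \<and> (\<forall>v\<in>S. h v \<in> tails R)) level_com
    (\<lambda>R U h m. m t = sum_acc R h (arc_list R) \<and> (\<forall>a<t. a \<notin> verts \<longrightarrow> m a = h a))"
proof -
  have 1: "triple (Suc r) (\<lambda>R U h m. m = h \<and> (\<forall>v\<in>S. h v \<in> tails R)) (Op (Set_Const t 0))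
    (\<lambda>R U h m. frame R h m \<and> m t = 0)"
    by (rule triple_const[where q = 1]) (auto simp: frame_def dest: good_U)
  have 2: "triple (Suc r) (\<lambda>R U h m. frame R h m \<and> m t = 0) (Op (Set_Const (t + 3) 0))
    (\<lambda>R U h m. loop_inv R h 0 m)"
    by (rule triple_const[where q = 1])
      (auto simp: loop_inv_def frame_upd arc_prefix_def sum_acc_def dest: good_U)
  have 3: "triple (Suc r) (\<lambda>R U h m. loop_inv R h 0 m) (For b (t + 6) body)
    (\<lambda>R U h m. m t = sum_acc R h (arc_list R) \<and> (\<forall>a<t. a \<notin> verts \<longrightarrow> m a = h a))"
    by (rule triple_for[where I = "\<lambda>R U h i m. loop_inv R h i m"], rule triple_body)
      (auto simp: loop_inv_def frame_def arc_prefix_def)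
  show ?thesis unfolding level_com_def by (rule triple_seq[OF 1 triple_seq[OF 2 3]])
qed

text \<open>Once \<open>b\<close> has its image \<open>x\<close>, the counts of the components
  multiply. Each of them is a sum over the image of the entry vertex, and since that vertex is
  adjacent to \<open>b\<close>, the sum may run over the arcs that start in
  \<open>x\<close>.\<close>

lemma sum_acc_eq_num_ext:
  assumes sep: "separated E br" and adj: "\<And>p. p \<in> set br \<Longrightarrow> (b, fst p) \<in> E \<or> (fst p, b) \<in> E"
    and g: "good R X Y U"
  shows "sum_acc R h (arc_list R) = num_ext E R S h verts"
proof -
  let ?C = "\<Union>p\<in>set br. insert (fst p) (snd p)"
  have p: "fst p \<notin> insert b S" "fst p \<notin> snd p" "insert b S \<inter> snd p = {}" "finite (snd p)" if "p \<in> set br" for p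
  proof -
    from that obtain j where "j < length br" "p = br ! j" by (metis in_set_conv_nth)
    then show "fst p \<notin> insert b S" "fst p \<notin> snd p" "insert b S \<inter> snd p = {}" "finite (snd p)"
      using br[of j] finite_subset[of "snd p" "{..<n}"] by auto
  qed
  have fin: "finite ?C" using p by auto
  have bC: "b \<notin> ?C" using p by auto
  have sym: "(x, y) \<in> arcs R \<Longrightarrow> (y, x) \<in> arcs R" for x y using g by (simp add: good_def)
  have branch: "num_ext E R (insert b S) (h(b := x)) (insert (fst p) (snd p)) =
      (\<Sum>y | (x, y) \<in> arcs R. branch_value E (insert b S) R (h(b := x)) y p)" if pb: "p \<in> set br" for x p
  proof -
    have "num_ext E R (insert b S) (h(b := x)) (insert (fst p) (snd p)) =
      (\<Sum>y\<in>tails R. branch_value E (insert b S) R (h(b := x)) y p)"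
      unfolding branch_value_def by (rule num_ext_insert) (use p[OF pb] in auto)
    also have "\<dots> = (\<Sum>y | (x, y) \<in> arcs R. branch_value E (insert b S) R (h(b := x)) y p)"
    proof (rule sum.mono_neutral_right)
      show "{y. (x, y) \<in> arcs R} \<subseteq> tails R" using sym by (force simp: tails_def)
      show "\<forall>y\<in>tails R - {y. (x, y) \<in> arcs R}. branch_value E (insert b S) R (h(b := x)) y p = 0"
      proof
        fix y assume "y \<in> tails R - {y. (x, y) \<in> arcs R}"
        then have "(x, y) \<notin> arcs R" "(y, x) \<notin> arcs R" using sym by auto
        then show "branch_value E (insert b S) R (h(b := x)) y p = 0"
          unfolding branch_value_def using adj[OF pb] p[OF pb]
          by (elim disjE; intro num_ext_zero) auto
      qed
    qed simp
    finally show ?thesis .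
  qed
  have "num_ext E R S h verts = (\<Sum>x\<in>tails R. num_ext E R (insert b S) (h(b := x)) ?C)"
    unfolding verts_def by (rule num_ext_insert[OF fin bC])
  also have "\<dots> = (\<Sum>x\<in>tails R. prod_acc R h (arc_list R) x)"
  proof (rule sum.cong[OF refl])
    fix x assume "x \<in> tails R"
    have "num_ext E R (insert b S) (h(b := x)) ?C = of_bool (preserves E R (insert b S) (h(b := x))) *
      prod_list (map (\<lambda>p. num_ext E R (insert b S) (h(b := x)) (insert (fst p) (snd p))) br)"
      by (rule num_ext_separated[OF sep]) (use p in auto)
    also have "prod_list (map (\<lambda>p. num_ext E R (insert b S) (h(b := x)) (insert (fst p) (snd p))) br) =
      (\<Prod>j<l. acc R h (arc_list R) x j)"
      unfolding prod.list_conv_set_nth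
      by (rule prod.cong) (auto simp: l_def acc_def V_def branch arcs_def)
    finally show "num_ext E R (insert b S) (h(b := x)) ?C = prod_acc R h (arc_list R) x"
      unfolding prod_acc_def .
  qed
  also have "\<dots> = sum_acc R h (arc_list R)" by (simp add: sum_acc_def tails_def arcs_def)
  finally show ?thesis by simp
qed

lemma computes_level:
  assumes "separated E br" "\<And>p. p \<in> set br \<Longrightarrow> (b, fst p) \<in> E \<or> (fst p, b) \<in> E"
  shows "computes E (Suc r) S verts t level_com"
  unfolding computes_def
  by (rule triple_conseq[OF triple_level]) (use sum_acc_eq_num_ext[OF assms] in auto)

end

text \<open>The number \<open>r\<close> bounds the nesting depth of passes that dispose of
  \<open>C\<close>, whatever has been fixed outside. A union does not increase it, because the
  passes for the two parts run one after the other. A level removes \<open>b\<close> together with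
  one neighbour of \<open>b\<close> from each of the separated parts, and what is left of each part
  is treated inside the loop.\<close>

inductive eliminable :: "(nat \<times> nat) set \<Rightarrow> nat \<Rightarrow> nat set \<Rightarrow> bool" for E where
  eliminable_empty: "eliminable E r {}"
| eliminable_union: "eliminable E r A \<Longrightarrow> eliminable E r B \<Longrightarrow> indep E A B \<Longrightarrow> eliminable E r (A \<union> B)"
| eliminable_level: "separated E br \<Longrightarrow>
    (\<forall>p\<in>set br. fst p \<notin> snd p \<and> ((b, fst p) \<in> E \<or> (fst p, b) \<in> E) \<and> eliminable E r (snd p)) \<Longrightarrow>
    b \<notin> (\<Union>p\<in>set br. insert (fst p) (snd p)) \<Longrightarrow>
    eliminable E (Suc r) (insert b (\<Union>p\<in>set br. insert (fst p) (snd p)))"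

text \<open>The induction needs arbitrary \<open>S\<close> and \<open>t\<close>: a branch starts
  with more fixed vertices than its level, and its scratch space begins later.\<close>

lemma eliminable_computes:
  assumes "eliminable E r C" "finite E" "C \<subseteq> {..<n}" "S \<subseteq> {..<n}" "S \<inter> C = {}" "n \<le> t"
  shows "\<exists>c. computes E r S C t c"
  using assms
proof (induction arbitrary: S t rule: eliminable.induct)
  case (eliminable_empty r)
  obtain es where es: "set es = E \<inter> S \<times> S" using eliminable_empty(1) finite_list[of "E \<inter> S \<times> S"] by auto
  have lt: "\<forall>e\<in>set es. fst e < t \<and> snd e < t" using es eliminable_empty by fastforce
  have "computes E r S {} t (check_edges t es)"
    unfolding computes_def
  proof (rule triple_conseq[OF triple_check_edges[OF lt]], goal_cases)
    case (1 R X Y U h m)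
    have "(\<forall>e\<in>set es. (m (fst e), m (snd e)) \<in> arcs R) \<longleftrightarrow> preserves E R S m"
      unfolding es by (rule preserves_iff)
    then show ?case using 1 es by (intro exI[of _ m]) (auto simp: num_ext_empty)
  qed
  then show ?case ..
next
  case (eliminable_union r A B)
  have AB: "finite A" "finite B" using eliminable_union.prems(2) finite_subset[of _ "{..<n}"] by auto
  obtain c where c: "computes E r S A t c" using eliminable_union.IH(1)[of S t] eliminable_union.prems by auto
  obtain c' where c': "computes E r S B (t + 1) c'"
    using eliminable_union.IH(2)[of S "t + 1"] eliminable_union.prems by auto
  let ?M = "\<lambda>R U h m. m t = num_ext E R S h A \<and> (\<forall>v\<in>S. h v \<in> tails R) \<and> (\<forall>a<t. a \<notin> A \<longrightarrow> m a = h a)"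
  have 1: "triple r (\<lambda>R U h m. m = h \<and> (\<forall>v\<in>S. h v \<in> tails R)) c ?M"
    by (rule triple_conseq[OF c[unfolded computes_def]]) auto
  have 2: "triple r ?M c' (\<lambda>R U h m. m t = num_ext E R S h A \<and> m (t + 1) = num_ext E R S h B \<and>
      (\<forall>a<t. a \<notin> A \<union> B \<longrightarrow> m a = h a))"
  proof (rule triple_conseq[OF c'[unfolded computes_def]], goal_cases)
    case (1 R X Y U h m)
    have "m v = h v" if "v \<in> S" for v
    proof -
      have "v < t" "v \<notin> A" using that eliminable_union.prems by auto
      then show ?thesis using 1(2) by simp
    qed
    then have "num_ext E R S m B = num_ext E R S h B" "\<forall>v\<in>S. m v \<in> tails R"
      using 1(2) by (auto intro: num_ext_cong)
    moreover have "t \<notin> B" using eliminable_union.prems by auto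
    ultimately show ?case using 1(2) by (intro exI[of _ m]) auto
  qed
  have 3: "triple r (\<lambda>R U h m. m t = num_ext E R S h A \<and> m (t + 1) = num_ext E R S h B \<and>
      (\<forall>a<t. a \<notin> A \<union> B \<longrightarrow> m a = h a)) (Op (Mult_Op t t (t + 1)))
     (\<lambda>R U h m. m t = num_ext E R S h (A \<union> B) \<and> (\<forall>a<t. a \<notin> A \<union> B \<longrightarrow> m a = h a))"
  proof (rule triple_mult[where q = "card (A \<union> B) + 1"], goal_cases)
    case (1 R X Y U h m)
    have e: "m t * m (t + 1) = num_ext E R S h (A \<union> B)"
      using 1(2) num_ext_union[OF AB eliminable_union.hyps(3)] eliminable_union.prems by simp
    have "num_ext E R S h (A \<union> B) \<le> U ^ card (A \<union> B)"
      using AB 1(1) by (intro num_ext_le) (auto simp: good_def)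
    also have "\<dots> < U ^ (card (A \<union> B) + 1)" using good_U[OF 1(1)] by (intro power_strict_increasing) auto
    finally show ?case unfolding e using 1(2) by simp
  qed
  have "computes E r S (A \<union> B) t (Seq c (Seq c' (Op (Mult_Op t t (t + 1)))))"
    unfolding computes_def by (rule triple_seq[OF 1 triple_seq[OF 2 3]])
  then show ?case ..
next
  case (eliminable_level br b r)
  let ?C = "insert b (\<Union>p\<in>set br. insert (fst p) (snd p))"
  have b: "b < n" "b \<notin> S" using eliminable_level.prems by auto
  have p: "fst p < n" "snd p \<subseteq> {..<n}" "fst p \<notin> insert b S" "fst p \<notin> snd p" "insert b S \<inter> snd p = {}"
    if "p \<in> set br" for p
    using that eliminable_level.prems(2-4) eliminable_level.hyps eliminable_level.IH by auto
  have ex: "\<exists>c. computes E r (insert (fst p) (insert b S)) (snd p) (t + 7 + length br) c" if "p \<in> set br" for p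
  proof -
    have IH: "\<And>S t. finite E \<Longrightarrow> snd p \<subseteq> {..<n} \<Longrightarrow> S \<subseteq> {..<n} \<Longrightarrow> S \<inter> snd p = {} \<Longrightarrow> n \<le> t
      \<Longrightarrow> \<exists>c. computes E r S (snd p) t c"
      using eliminable_level.IH that by blast
    show ?thesis by (rule IH) (use p[OF that] b eliminable_level.prems in auto)
  qed
  then obtain f where f: "\<And>p. p \<in> set br \<Longrightarrow>
      computes E r (insert (fst p) (insert b S)) (snd p) (t + 7 + length br) (f p)" by metis
  interpret level E n r t b S br "map f br"
    by unfold_locales (use p f b eliminable_level.prems in auto)
  have "computes E (Suc r) S verts t level_com"
    by (rule computes_level) (use eliminable_level.hyps eliminable_level.IH in auto)
  then show ?case unfolding verts_def by blast
qed

section \<open>Sparse graphs have shallow elimination schemes\<close>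

lemma indep_sym: "indep E A B \<Longrightarrow> indep E B A"
  by (auto simp: indep_def)

text \<open>A level with a single branch, whose remainder is everything outside the edge and may
  well be disconnected.\<close>

lemma eliminable_edge:
  assumes "(u, v) \<in> E \<or> (v, u) \<in> E" "u \<noteq> v" "u \<in> C" "v \<in> C" "eliminable E r (C - {u, v})"
  shows "eliminable E (Suc r) C"
proof -
  have "C = insert u (\<Union>p\<in>set [(v, C - {u, v})]. insert (fst p) (snd p))" using assms by auto
  also have "eliminable E (Suc r) \<dots>" by (rule eliminable_level) (use assms in auto)
  finally show ?thesis .
qed

lemma separated_map:
  assumes "distinct xs" "\<And>x y. x \<in> set xs \<Longrightarrow> y \<in> set xs \<Longrightarrow> x \<noteq> y \<Longrightarrow>
    indep E (insert (fst (f x)) (snd (f x))) (insert (fst (f y)) (snd (f y)))"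
  shows "separated E (map f xs)"
  using assms by (induction xs) auto

text \<open>Every leaf is a branch of its own with nothing left behind its entry vertex, so one pass
  is enough.\<close>

lemma eliminable_star:
  assumes "finite L" "b \<notin> L" "\<And>a. a \<in> L \<Longrightarrow> (b, a) \<in> E \<or> (a, b) \<in> E" "E \<inter> L \<times> L = {}"
  shows "eliminable E (Suc r) (insert b L)"
proof -
  obtain xs where xs: "set xs = L" "distinct xs" using finite_distinct_list[OF assms(1)] by blast
  have "eliminable E (Suc r) (insert b (\<Union>p\<in>set (map (\<lambda>a. (a, {})) xs). insert (fst p) (snd p)))"
    by (rule eliminable_level)
      (use assms xs in \<open>auto intro!: separated_map eliminable_empty simp: indep_def\<close>)
  moreover have "(\<Union>p\<in>set (map (\<lambda>a. (a, {})) xs). insert (fst p) (snd p)) = L" using xs by auto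
  ultimately show ?thesis by simp
qed

lemma eliminable_single: "eliminable E (Suc r) {x}"
  using eliminable_star[of "{}" x E r] by simp

definition inner :: "(nat \<times> nat) set \<Rightarrow> nat set \<Rightarrow> (nat \<times> nat) set" where
  "inner E C = E \<inter> C \<times> C"

definition touching :: "(nat \<times> nat) set \<Rightarrow> nat set \<Rightarrow> nat \<Rightarrow> nat \<Rightarrow> (nat \<times> nat) set" where
  "touching E C u v = {(x, y) \<in> inner E C. x = u \<or> x = v \<or> y = u \<or> y = v}"

lemma eliminable_edgeless:
  "finite C \<Longrightarrow> inner E C = {} \<Longrightarrow> eliminable E (Suc r) C"
proof (induction C rule: finite_induct)
  case empty
  show ?case by (rule eliminable_empty)
next
  case (insert x F)
  have "inner E F = {}" using insert.prems by (auto simp: inner_def)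
  then have "eliminable E (Suc r) ({x} \<union> F)"
    using insert by (intro eliminable_union eliminable_single) (auto simp: indep_def inner_def)
  then show ?case by simp
qed

lemma card_three:
  assumes "finite A" "a \<in> A" "b \<in> A" "c \<in> A" "a \<noteq> b" "a \<noteq> c" "b \<noteq> c"
  shows "3 \<le> card A"
proof -
  have "card {a, b, c} \<le> card A" using assms by (intro card_mono) auto
  then show ?thesis using assms by simp
qed

text \<open>Here every component has at most two edges, so it is a star.\<close>

lemma eliminable_sparse:
  assumes "finite C" "finite E" "\<And>x. (x, x) \<notin> E" "\<And>u v. (u, v) \<in> inner E C \<Longrightarrow> card (touching E C u v) \<le> 2"
  shows "eliminable E (Suc r) C"
  using assms(1,4)
proof (induction "card C" arbitrary: C rule: less_induct)
  case less
  have fin: "finite (touching E C' u v)" for C' u v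
    using assms(2) by (rule rev_finite_subset) (auto simp: touching_def inner_def)
  show ?case
  proof (cases "inner E C = {}")
    case True
    then show ?thesis using less.prems by (intro eliminable_edgeless)
  next
    case False
    then obtain u v where uv: "(u, v) \<in> inner E C" by auto
    then have uvC: "u \<in> C" "v \<in> C" "(u, v) \<in> E" "u \<noteq> v" using assms(3) by (auto simp: inner_def)
    have split: ?thesis if "K \<subseteq> C" "K \<noteq> {}" "eliminable E (Suc r) K" "indep E K (C - K)" for K
    proof -
      have "eliminable E (Suc r) (C - K)"
      proof (rule less.hyps)
        show "card (C - K) < card C" using that less.prems(1) by (intro psubset_card_mono) auto
        show "finite (C - K)" using less.prems(1) by simp
        fix u v assume "(u, v) \<in> inner E (C - K)"
        then have "card (touching E C u v) \<le> 2" by (intro less.prems(2)) (auto simp: inner_def)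
        moreover have "card (touching E (C - K) u v) \<le> card (touching E C u v)"
          by (intro card_mono fin) (auto simp: touching_def inner_def)
        ultimately show "card (touching E (C - K) u v) \<le> 2" by simp
      qed
      then have "eliminable E (Suc r) (K \<union> (C - K))" using that by (intro eliminable_union)
      moreover have "K \<union> (C - K) = C" using that by auto
      ultimately show ?thesis by simp
    qed
    show ?thesis
    proof (cases "touching E C u v \<subseteq> {(u, v), (v, u)}")
      case True
      show ?thesis
      proof (rule split)
        show "eliminable E (Suc r) {u, v}"
          using uvC assms(3) by (intro eliminable_star) auto
        show "indep E {u, v} (C - {u, v})"
        proof -
          have "E \<inter> ({u, v} \<times> (C - {u, v}) \<union> (C - {u, v}) \<times> {u, v}) \<subseteq> touching E C u v"
            using uvC by (auto simp: touching_def inner_def)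
          then show ?thesis using True by (auto simp: indep_def)
        qed
      qed (use uvC in auto)
    next
      case False
      then obtain x y where g: "(x, y) \<in> touching E C u v" "(x, y) \<noteq> (u, v)" "(x, y) \<noteq> (v, u)" by auto
      then have xy: "x \<in> C" "y \<in> C" "(x, y) \<in> E" "x \<noteq> y" "(x, y) \<in> inner E C"
        using assms(3) by (auto simp: touching_def inner_def)
      \<comment> \<open>The two edges touch each other and themselves, so a third edge touching one
        of them would raise its count to 3.\<close>
      have only: "e = (u, v) \<or> e = (x, y)" if "e \<in> touching E C u v \<union> touching E C x y" for e
      proof (rule ccontr)
        assume ne: "\<not> (e = (u, v) \<or> e = (x, y))"
        have "(u, v) \<in> touching E C u v" "(u, v) \<in> touching E C x y" "(x, y) \<in> touching E C x y"
          using uv g xy by (auto simp: touching_def)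
        then have "3 \<le> card (touching E C u v) \<or> 3 \<le> card (touching E C x y)"
          using that ne g(1,2) card_three[OF fin, of e C u v "(u, v)" "(x, y)"]
            card_three[OF fin, of e C x y "(u, v)" "(x, y)"] by auto
        then show False using less.prems(2)[OF uv] less.prems(2)[OF xy(5)] by linarith
      qed
      \<comment> \<open>\<open>c\<close> is the common endpoint, the centre of the star. The edge
        \<open>(x, y)\<close> is not the reverse of \<open>(u, v)\<close>, hence \<open>z\<close> is
        a third vertex.\<close>
      obtain c d z where cdz: "{u, v} = {c, d}" "{x, y} = {c, z}" "z \<noteq> u" "z \<noteq> v" "c \<noteq> d"
        using g uvC xy by (auto simp: touching_def doubleton_eq_iff)
      have K: "{u, v, x, y} = insert c {d, z}" using cdz by auto
      have E_uv: "(p, q) \<in> E \<Longrightarrow> p \<in> C \<Longrightarrow> q \<in> C \<Longrightarrow> {p, q} \<inter> {u, v, x, y} \<noteq> {} \<Longrightarrow>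
        (p, q) = (u, v) \<or> (p, q) = (x, y)" for p q
        by (rule only) (auto simp: touching_def inner_def)
      show ?thesis
      proof (rule split)
        show "eliminable E (Suc r) {u, v, x, y}"
          unfolding K
        proof (rule eliminable_star)
          show "(c, a) \<in> E \<or> (a, c) \<in> E" if "a \<in> {d, z}" for a
            using that cdz uvC xy by (auto simp: doubleton_eq_iff)
          show "E \<inter> {d, z} \<times> {d, z} = {}"
          proof (rule ccontr)
            assume "E \<inter> {d, z} \<times> {d, z} \<noteq> {}"
            then obtain p q where pq: "(p, q) \<in> E" "p \<in> {d, z}" "q \<in> {d, z}" by auto
            have ne: "p \<noteq> q" using pq(1) assms(3) by auto
            have dz: "d \<in> {u, v}" "z \<in> {x, y}" using cdz by auto
            then have "p \<in> C" "q \<in> C" "{p, q} \<inter> {u, v, x, y} \<noteq> {}" using pq(2,3) uvC xy by auto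
            then have "(p, q) = (u, v) \<or> (p, q) = (x, y)" using E_uv[OF pq(1)] by blast
            moreover have "{p, q} = {d, z}" using pq(2,3) ne by auto
            ultimately have "{d, z} = {u, v} \<or> {d, z} = {x, y}" by auto
            then have "z \<in> {u, v} \<or> d \<in> {c, z}" using cdz(2) by auto
            then show False using cdz(3-5) dz(1) by auto
          qed
          show "c \<notin> {d, z}" using cdz by auto
        qed simp
        show "indep E {u, v, x, y} (C - {u, v, x, y})"
        proof -
          let ?K = "{u, v, x, y}"
          have "(p, q) \<notin> E" "(q, p) \<notin> E" if pq: "p \<in> ?K" "q \<in> C - ?K" for p q
          proof -
            have C: "p \<in> C" "q \<in> C" "{p, q} \<inter> ?K \<noteq> {}" "{q, p} \<inter> ?K \<noteq> {}" using pq uvC xy by auto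
            show "(p, q) \<notin> E" using E_uv[of p q] C pq(2) by auto
            show "(q, p) \<notin> E" using E_uv[of q p] C pq(2) by auto
          qed
          then show ?thesis unfolding indep_def by blast
        qed
      qed (use uvC xy in auto)
    qed
  qed
qed

lemma eliminable_two:
  assumes "finite C" "finite E" "\<And>x. (x, x) \<notin> E" "card (inner E C) \<le> 2"
  shows "eliminable E (Suc r) C"
proof (rule eliminable_sparse[OF assms(1-3)])
  fix u v
  have "card (touching E C u v) \<le> card (inner E C)"
    using assms(2) by (intro card_mono) (auto simp: touching_def inner_def)
  then show "card (touching E C u v) \<le> 2" using assms(4) by simp
qed

text \<open>If the endpoints of some edge can be removed so that at most two edges are left, one
  level removes them and a second one handles the rest. Otherwise at least three of the five edges
  avoid any given edge, so each edge touches at most two, and \<open>eliminable_sparse\<close>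
  applies.\<close>

lemma eliminable_five:
  assumes "finite C" "finite E" "\<And>x. (x, x) \<notin> E" "card (inner E C) \<le> 5"
  shows "eliminable E (Suc (Suc r)) C"
proof (cases "\<exists>u v. (u, v) \<in> inner E C \<and> card (inner E (C - {u, v})) \<le> 2")
  case True
  then obtain u v where uv: "(u, v) \<in> inner E C" "card (inner E (C - {u, v})) \<le> 2" by blast
  have "eliminable E (Suc r) (C - {u, v})" using assms uv by (intro eliminable_two) auto
  moreover have "u \<noteq> v" using uv assms(3) by (auto simp: inner_def)
  ultimately show ?thesis using uv by (auto simp: inner_def intro: eliminable_edge[of u v, rotated 4])
next
  case False
  show ?thesis
  proof (rule eliminable_sparse[OF assms(1-3)])
    fix u v assume uv: "(u, v) \<in> inner E C"
    have fin: "finite (inner E C)" using assms(2) by (simp add: inner_def)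
    have "inner E C = touching E C u v \<union> inner E (C - {u, v})"
      "touching E C u v \<inter> inner E (C - {u, v}) = {}" by (auto simp: touching_def inner_def)
    then have "card (inner E C) = card (touching E C u v) + card (inner E (C - {u, v}))"
      using fin by (metis card_Un_disjoint finite_Un)
    then show "card (touching E C u v) \<le> 2" using False uv assms(4) by force
  qed
qed

lemma eliminable_covered:
  assumes "finite C" "finite E" "\<And>x. (x, x) \<notin> E" "(u, v) \<in> inner E C" "card (inner E (C - {u, v})) \<le> 5"
  shows "eliminable E 3 C"
proof -
  have "eliminable E (Suc (Suc 0)) (C - {u, v})" using assms by (intro eliminable_five) auto
  moreover have "u \<noteq> v" using assms(3,4) by (auto simp: inner_def)
  ultimately have "eliminable E (Suc (Suc (Suc 0))) C"
    using assms(4) by (auto simp: inner_def intro: eliminable_edge[of u v, rotated 4])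
  then show ?thesis by (simp add: numeral_3_eq_3)
qed

section \<open>Quotients of cycles\<close>

text \<open>The connected components of the graph induced on the list.\<close>

primrec parts :: "(nat \<Rightarrow> nat \<Rightarrow> bool) \<Rightarrow> nat list \<Rightarrow> nat list list" where
  "parts adj [] = []"
| "parts adj (v # vs) = (let Qs = parts adj vs in
     (v # concat (filter (list_ex (adj v)) Qs)) # filter (\<lambda>Q. \<not> list_ex (adj v) Q) Qs)"

text \<open>\<open>eliminable\<close> as an exhaustive search: a vertex \<open>b\<close> is tried
  for every component, and then a neighbour of \<open>b\<close> for every component that its removal
  leaves.\<close>

primrec elim_check :: "(nat \<Rightarrow> nat \<Rightarrow> bool) \<Rightarrow> nat \<Rightarrow> nat list \<Rightarrow> bool" where
  "elim_check adj 0 C = (C = [])"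
| "elim_check adj (Suc r) C = list_all (\<lambda>Q. list_ex (\<lambda>b. list_all (\<lambda>Q'. list_ex (\<lambda>a. adj b a \<and>
     elim_check adj r (removeAll a Q')) Q') (parts adj (removeAll b Q))) Q) (parts adj C)"

lemma parts_partition:
  assumes adj: "\<And>u v. adj u v \<longleftrightarrow> (u, v) \<in> E \<or> (v, u) \<in> E" and "distinct vs"
  shows "(\<Union>Q\<in>set (parts adj vs). set Q) = set vs \<and> distinct (parts adj vs) \<and>
    (\<forall>Q\<in>set (parts adj vs). distinct Q) \<and>
    (\<forall>Q\<in>set (parts adj vs). \<forall>Q'\<in>set (parts adj vs). Q \<noteq> Q' \<longrightarrow> indep E (set Q) (set Q'))"
  using assms(2)
proof (induction vs)
  case (Cons v vs)
  define Qs where "Qs = parts adj vs"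
  define A where "A = filter (list_ex (adj v)) Qs"
  define B where "B = filter (\<lambda>Q. \<not> list_ex (adj v) Q) Qs"
  let ?H = "v # concat A"
  have p: "parts adj (v # vs) = ?H # B" by (simp add: A_def B_def Qs_def Let_def)
  have IH: "(\<Union>Q\<in>set Qs. set Q) = set vs" "distinct Qs" "\<And>Q. Q \<in> set Qs \<Longrightarrow> distinct Q"
    "\<And>Q Q'. Q \<in> set Qs \<Longrightarrow> Q' \<in> set Qs \<Longrightarrow> Q \<noteq> Q' \<Longrightarrow> indep E (set Q) (set Q')"
    using Cons by (auto simp: Qs_def)
  have AB: "set A \<union> set B = set Qs" "\<And>Q Q'. Q \<in> set A \<Longrightarrow> Q' \<in> set B \<Longrightarrow> Q \<noteq> Q'"
    by (auto simp: A_def B_def)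
  have v: "v \<notin> set Q" if "Q \<in> set Qs" for Q using that IH(1) Cons.prems by auto
  have un: "(\<Union>Q\<in>set (?H # B). set Q) = set (v # vs)"
  proof -
    have "(\<Union>Q\<in>set (?H # B). set Q) = insert v (\<Union>Q\<in>set A \<union> set B. set Q)" by auto
    then show ?thesis unfolding AB(1) using IH(1) by simp
  qed
  have "distinct (concat A)"
  proof (rule distinct_concat)
    show "distinct A" using IH(2) by (simp add: A_def)
    show "distinct Q" if "Q \<in> set A" for Q using that IH(3) AB(1) by auto
    show "set Q \<inter> set Q' = {}" if "Q \<in> set A" "Q' \<in> set A" "Q \<noteq> Q'" for Q Q'
      using that IH(4)[of Q Q'] AB(1) by (auto simp: indep_def)
  qed
  moreover have "v \<notin> set (concat A)" using v AB(1) by auto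
  ultimately have dH: "distinct ?H" by simp
  have "?H \<notin> set B" using v[of ?H] AB(1) by auto
  moreover have "distinct B" using IH(2) by (simp add: B_def)
  ultimately have d: "distinct (?H # B)" by simp
  have H: "indep E (set ?H) (set Q)" if Q: "Q \<in> set B" for Q
  proof -
    have "\<not> list_ex (adj v) Q" "v \<notin> set Q" using Q v AB(1) by (auto simp: B_def)
    then have "indep E {v} (set Q)" by (auto simp: indep_def list_ex_iff adj)
    moreover have "indep E (set Q') (set Q)" if "Q' \<in> set A" for Q'
      using that Q AB IH(4)[of Q' Q] by auto
    ultimately show ?thesis by (fastforce simp: indep_def)
  qed
  show ?case unfolding p
  proof (intro conjI ballI impI)
    have B: "set B \<subseteq> set Qs" using AB(1) by auto
    show "(\<Union>Q\<in>set (?H # B). set Q) = set (v # vs)" by (rule un)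
    show "distinct (?H # B)" by (rule d)
    show "distinct Q" if "Q \<in> set (?H # B)" for Q using that dH IH(3) B by auto
    show "indep E (set Q) (set Q')" if "Q \<in> set (?H # B)" "Q' \<in> set (?H # B)" "Q \<noteq> Q'" for Q Q'
    proof -
      consider "Q = ?H" "Q' \<in> set B" | "Q' = ?H" "Q \<in> set B" | "Q \<in> set B" "Q' \<in> set B"
        using \<open>Q \<in> set (?H # B)\<close> \<open>Q' \<in> set (?H # B)\<close> \<open>Q \<noteq> Q'\<close> by auto
      then show ?thesis
        using H indep_sym[OF H] IH(4) B \<open>Q \<noteq> Q'\<close> by cases blast+
    qed
  qed
qed simp

lemma eliminable_Union:
  assumes "distinct Ps" "\<And>Q. Q \<in> set Ps \<Longrightarrow> eliminable E r (set Q)"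
    "\<And>Q Q'. Q \<in> set Ps \<Longrightarrow> Q' \<in> set Ps \<Longrightarrow> Q \<noteq> Q' \<Longrightarrow> indep E (set Q) (set Q')"
  shows "eliminable E r (\<Union>Q\<in>set Ps. set Q)"
  using assms
proof (induction Ps)
  case (Cons Q Ps)
  have "indep E (set Q) (set Q')" if "Q' \<in> set Ps" for Q' using Cons.prems that by auto
  then have "indep E (set Q) (\<Union>Q\<in>set Ps. set Q)" by (fastforce simp: indep_def)
  moreover have "eliminable E r (\<Union>Q\<in>set Ps. set Q)" using Cons by auto
  moreover have "eliminable E r (set Q)" using Cons.prems(2) by simp
  ultimately have "eliminable E r (set Q \<union> (\<Union>Q\<in>set Ps. set Q))" by (intro eliminable_union)
  then show ?case by simp
qed (simp add: eliminable_empty)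

lemma elim_check_sound:
  assumes adj: "\<And>u v. adj u v \<longleftrightarrow> (u, v) \<in> E \<or> (v, u) \<in> E"
  shows "distinct C \<Longrightarrow> elim_check adj r C \<Longrightarrow> eliminable E r (set C)"
proof (induction r arbitrary: C)
  case 0
  then show ?case by (simp add: eliminable_empty)
next
  case (Suc r)
  note pC = parts_partition[OF adj Suc.prems(1)]
  have "eliminable E (Suc r) (set Q)" if Q: "Q \<in> set (parts adj C)" for Q
  proof -
    obtain b where b: "b \<in> set Q" and ex: "\<And>Q'. Q' \<in> set (parts adj (removeAll b Q)) \<Longrightarrow>
        \<exists>a\<in>set Q'. adj b a \<and> elim_check adj r (removeAll a Q')"
      using Suc.prems(2) Q by (auto simp: list_all_iff list_ex_iff)
    let ?Ps = "parts adj (removeAll b Q)"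
    have "distinct (removeAll b Q)" using pC Q by (simp add: distinct_removeAll)
    note pQ = parts_partition[OF adj this]
    obtain f where f: "\<And>Q'. Q' \<in> set ?Ps \<Longrightarrow> f Q' \<in> set Q' \<and> adj b (f Q') \<and> elim_check adj r (removeAll (f Q') Q')"
      using ex by metis
    let ?g = "\<lambda>Q'. (f Q', set (removeAll (f Q') Q'))"
    have ins: "insert (fst (?g Q')) (snd (?g Q')) = set Q'" if "Q' \<in> set ?Ps" for Q' using f[OF that] by auto
    have "eliminable E (Suc r) (insert b (\<Union>p\<in>set (map ?g ?Ps). insert (fst p) (snd p)))"
    proof (rule eliminable_level)
      show "separated E (map ?g ?Ps)" using pQ ins by (intro separated_map) auto
      have "eliminable E r (set (removeAll (f Q') Q'))" if "Q' \<in> set ?Ps" for Q'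
        using f[OF that] pQ that by (intro Suc.IH) (auto simp: distinct_removeAll)
      then show "\<forall>p\<in>set (map ?g ?Ps). fst p \<notin> snd p \<and> ((b, fst p) \<in> E \<or> (fst p, b) \<in> E) \<and> eliminable E r (snd p)"
        using f adj by auto
      show "b \<notin> (\<Union>p\<in>set (map ?g ?Ps). insert (fst p) (snd p))" using pQ f by fastforce
    qed
    moreover have "(\<Union>p\<in>set (map ?g ?Ps). insert (fst p) (snd p)) = (\<Union>Q'\<in>set ?Ps. set Q')"
      using ins by (auto simp del: set_removeAll)
    moreover have "insert b (\<Union>Q'\<in>set ?Ps. set Q') = set Q" using pQ b by auto
    ultimately show ?thesis by simp
  qed
  then have "eliminable E (Suc r) (\<Union>Q\<in>set (parts adj C). set Q)"
    using pC by (intro eliminable_Union) auto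
  then show ?case using pC by simp
qed

section \<open>Checking all quotients by evaluation\<close>

primrec at_least :: "nat \<Rightarrow> 'a list \<Rightarrow> bool" where
  "at_least n [] = (n = 0)"
| "at_least n (x # xs) = (case n of 0 \<Rightarrow> True | Suc n' \<Rightarrow> at_least n' xs)"

lemma at_least_iff: "at_least n xs \<longleftrightarrow> n \<le> length xs"
  by (induction xs arbitrary: n) (auto split: nat.split)

abbreviation touches :: "nat \<Rightarrow> nat \<Rightarrow> nat \<times> nat \<Rightarrow> bool" where
  "touches u v \<equiv> \<lambda>(x, y). x = u \<or> y = u \<or> x = v \<or> y = v"

text \<open>\<open>es\<close> supplies the edge to be chosen and \<open>es'\<close> the edges to be
  counted. They differ on an unfinished walk: an edge with only one known endpoint may be counted
  but cannot be chosen.\<close>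

definition covered :: "nat \<Rightarrow> (nat \<times> nat) list \<Rightarrow> (nat \<times> nat) list \<Rightarrow> bool" where
  "covered n es es' \<longleftrightarrow> list_ex (\<lambda>(u, v). at_least n (filter (touches u v) es')) es"

text \<open>The edges of the closed walk \<open>w\<close>. A list keeps multiplicities, so there are
  always as many as letters, also when a quotient identifies edges.\<close>

definition word_pairs :: "nat list \<Rightarrow> (nat \<times> nat) list" where
  "word_pairs w = (hd w, last w) # zip w (tl w)"

lemma word_pairs_map: "w \<noteq> [] \<Longrightarrow> word_pairs (map f w) = map (map_prod f f) (word_pairs w)"
  by (simp add: word_pairs_def hd_map last_map zip_map_map map_prod_def flip: map_tl)

lemma word_pairs_subset: "w \<noteq> [] \<Longrightarrow> set (word_pairs w) \<subseteq> set w \<times> set w"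
  by (auto simp: word_pairs_def dest: set_zip_leftD set_zip_rightD list.set_sel(2))

lemma length_word_pairs: "w \<noteq> [] \<Longrightarrow> length (word_pairs w) = length w"
  by (simp add: word_pairs_def)

text \<open>Of the \<open>length w\<close> edges of the walk, at least \<open>n\<close> touch
  \<open>(u, v)\<close>, so at most five avoid it. Counting with multiplicity can only overestimate
  the set of remaining edges. The comparison of \<open>es'\<close> with the walk is by numbers of
  touched edges, since entries of \<open>es'\<close> need not be edges.\<close>

lemma covered_sound:
  assumes w: "w \<noteq> []" "length w \<le> n + 5" and loops: "\<And>x. (x, x) \<notin> set (word_pairs w)"
    and es: "set es \<subseteq> set (word_pairs w)"
    and es': "\<And>u v. length (filter (touches u v) es') \<le> length (filter (touches u v) (word_pairs w))"
    and cov: "covered n es es'"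
  shows "eliminable (set (word_pairs w)) 3 (set w)"
proof -
  obtain u v where uv: "(u, v) \<in> set es" "n \<le> length (filter (touches u v) es')"
    using cov by (auto simp: covered_def list_ex_iff at_least_iff)
  let ?E = "set (word_pairs w)" and ?ps = "word_pairs w"
  have "inner ?E (set w - {u, v}) \<subseteq> set (filter (\<lambda>e. \<not> touches u v e) ?ps)" by (auto simp: inner_def)
  then have "card (inner ?E (set w - {u, v})) \<le> length (filter (\<lambda>e. \<not> touches u v e) ?ps)"
    by (meson card_length card_mono finite_set le_trans)
  moreover have "length (filter (touches u v) ?ps) + length (filter (\<lambda>e. \<not> touches u v e) ?ps) = length ?ps"
    by (rule sum_length_filter_compl)
  ultimately have "card (inner ?E (set w - {u, v})) \<le> 5"
    using es'[of u v] uv(2) w length_word_pairs[OF w(1)] by linarith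
  moreover have "(u, v) \<in> inner ?E (set w)" using uv(1) es word_pairs_subset[OF w(1)] by (auto simp: inner_def)
  ultimately show ?thesis using loops by (intro eliminable_covered) auto
qed

definition neighbours :: "(nat \<times> nat) list \<Rightarrow> nat \<Rightarrow> nat list" where
  "neighbours es u = map snd (filter (\<lambda>e. fst e = u) es) @ map fst (filter (\<lambda>e. snd e = u) es)"

definition adj_table :: "(nat \<times> nat list) list \<Rightarrow> nat \<Rightarrow> nat \<Rightarrow> bool" where
  "adj_table tab u v = (case map_of tab u of None \<Rightarrow> False | Some ns \<Rightarrow> v \<in> set ns)"

text \<open>Letters occurring more than once come first: they are the most promising choices for
  the search in \<open>elim_check\<close>.\<close>

definition repeated_first :: "nat list \<Rightarrow> nat list" where
  "repeated_first q = (let V = remdups q; f = (\<lambda>x. 1 < count_list q x) in filter f V @ filter (\<lambda>x. \<not> f x) V)"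

text \<open>A word with equal ends has a loop as its closing edge. It is accepted unchecked, because
  a loopless host graph admits no homomorphism from it. The test by \<open>covered\<close> spares
  most words the search.\<close>

definition word_ok :: "nat \<Rightarrow> nat list \<Rightarrow> bool" where
  "word_ok n q \<longleftrightarrow> hd q = last q \<or> (let es = (hd q, last q) # zip q (tl q) in covered n es es \<or>
     (let V = repeated_first q in elim_check (adj_table (map (\<lambda>u. (u, neighbours es u)) V)) 3 V))"

lemma word_ok_sound:
  assumes "w \<noteq> []" "length w \<le> n + 5" "\<And>x. (x, x) \<notin> set (word_pairs w)" "word_ok n w"
  shows "eliminable (set (word_pairs w)) 3 (set w)"
proof -
  let ?es = "word_pairs w" and ?V = "repeated_first w"
  have "hd w \<noteq> last w" using assms(3)[of "hd w"] by (auto simp: word_pairs_def)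
  then consider "covered n ?es ?es" | "elim_check (adj_table (map (\<lambda>u. (u, neighbours ?es u)) ?V)) 3 ?V"
    using assms(4) by (auto simp: word_ok_def word_pairs_def Let_def)
  then show ?thesis
  proof cases
    case 1
    then show ?thesis using assms by (intro covered_sound[of w n ?es ?es]) auto
  next
    case 2
    have V: "distinct ?V" "set ?V = set w" by (auto simp: repeated_first_def Let_def)
    have adj: "adj_table (map (\<lambda>u. (u, neighbours ?es u)) ?V) u v \<longleftrightarrow> (u, v) \<in> set ?es \<or> (v, u) \<in> set ?es" for u v
    proof -
      have "map_of (map (\<lambda>u. (u, neighbours ?es u)) ?V) u = (if u \<in> set w then Some (neighbours ?es u) else None)"
        using V(2) by (simp add: map_of_map_restrict restrict_map_def)
      moreover have "v \<in> set (neighbours ?es u) \<longleftrightarrow> (u, v) \<in> set ?es \<or> (v, u) \<in> set ?es"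
        by (force simp: neighbours_def)
      moreover have "(u, v) \<in> set ?es \<or> (v, u) \<in> set ?es \<Longrightarrow> u \<in> set w"
        using word_pairs_subset[OF assms(1)] by auto
      ultimately show ?thesis by (auto simp: adj_table_def)
    qed
    show ?thesis using elim_check_sound[OF adj V(1) 2] V(2) by simp
  qed
qed

text \<open>A closed walk is encoded by the reversed list of its vertices, where a vertex is named after
  the time of its first visit. The argument \<open>l\<close> is the length of the word \<open>q\<close> read so far, and \<open>f\<close>
  is the number of letters to come. The two loops added to the edges stand for the next edge and
  for the closing edge, of which one endpoint is already known.\<close>

primrec words_ok :: "nat \<Rightarrow> nat \<Rightarrow> nat \<Rightarrow> nat list \<Rightarrow> bool" where
  "words_ok n 0 l q = word_ok n q"
| "words_ok n (Suc f) l q = ((let es = zip q (tl q) in covered n es ((hd q, hd q) # (last q, last q) # es)) \<or>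
     list_all (\<lambda>x. x = hd q \<or> words_ok n f (Suc l) (x # q)) (l # remdups q))"

text \<open>Canonical words of a given length correspond to the set partitions of their positions, a
  block being named after its smallest element, with positions counted from the end of the
  list.\<close>

fun canonical :: "nat list \<Rightarrow> bool" where
  "canonical [] \<longleftrightarrow> True"
| "canonical (x # q) \<longleftrightarrow> (x = length q \<or> x \<in> set q) \<and> canonical q"

lemma canonical_append: "canonical (p @ q) \<Longrightarrow> canonical q"
  by (induction p) auto

lemma canonical_less: "canonical w \<Longrightarrow> x \<in> set w \<Longrightarrow> x < length w"
  by (induction w) auto

text \<open>A letter enters at the position that is its name, so one that is smaller than
  \<open>length q\<close> has entered within \<open>q\<close>.\<close>

lemma canonical_mem_suffix: "canonical (p @ q) \<Longrightarrow> y \<in> set (p @ q) \<Longrightarrow> y < length q \<Longrightarrow> y \<in> set q"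
  by (induction p) auto

text \<open>An edge that touches \<open>n\<close> edges of an unfinished walk does so in all
  completions, which settles a whole branch of the search at once. Continuing with
  \<open>hd q\<close> would create a loop, so that letter is excluded by the last
  hypothesis.\<close>

lemma words_ok_sound:
  assumes "words_ok n f (length q) q" "q \<noteq> []" "canonical (p @ q)" "length p = f" "length (p @ q) \<le> n + 5"
    "\<And>x. (x, x) \<notin> set (word_pairs (p @ q))"
  shows "eliminable (set (word_pairs (p @ q))) 3 (set (p @ q))"
  using assms
proof (induction f arbitrary: p q)
  case 0
  then show ?case using word_ok_sound[of q n] by simp
next
  case (Suc f)
  then obtain p' x where p: "p = p' @ [x]" "length p' = f"
    by (metis length_Suc_conv_rev)
  let ?w = "p @ q" and ?es = "zip q (tl q)"
  have w: "?w = p' @ (x # q)" using p by simp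
  have zip_w: "\<exists>r. word_pairs ?w = (hd ?w, last q) # r @ [(x, hd q)] @ ?es"
  proof -
    have "\<exists>r. zip (p' @ x # q) (tl (p' @ x # q)) = r @ (x, hd q) # ?es" for p'
    proof (induction p')
      case Nil
      then show ?case using Suc.prems(2) by (cases q) auto
    next
      case (Cons a p')
      then obtain r where r: "zip (p' @ x # q) (tl (p' @ x # q)) = r @ (x, hd q) # ?es" by blast
      have "zip ((a # p') @ x # q) (tl ((a # p') @ x # q)) =
        (a, hd (p' @ x # q)) # zip (p' @ x # q) (tl (p' @ x # q))" by (cases p') auto
      then show ?case using r by (metis append_Cons)
    qed
    then show ?thesis using Suc.prems(2) by (simp add: word_pairs_def p)
  qed
  then obtain r where r: "word_pairs ?w = (hd ?w, last q) # r @ [(x, hd q)] @ ?es" by blast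
  have "covered n ?es ((hd q, hd q) # (last q, last q) # ?es) \<or> words_ok n f (length (x # q)) (x # q)"
  proof -
    have "(x, hd q) \<in> set (word_pairs ?w)" using r by simp
    then have "x \<noteq> hd q" using Suc.prems(6) by auto
    moreover have "x = length q \<or> x \<in> set q" using canonical_append[of p' "x # q"] Suc.prems(3) w by auto
    ultimately show ?thesis using Suc.prems(1) by (auto simp: Let_def list_all_iff)
  qed
  then show ?case
  proof
    assume "covered n ?es ((hd q, hd q) # (last q, last q) # ?es)"
    then show ?thesis
    proof (rule covered_sound[rotated 5])
      fix u v
      show "length (filter (touches u v) ((hd q, hd q) # (last q, last q) # ?es)) \<le>
        length (filter (touches u v) (word_pairs ?w))"
        unfolding r by auto
    qed (use Suc.prems r in auto)
  next
    assume "words_ok n f (length (x # q)) (x # q)"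
    then show ?thesis using Suc.IH[of "x # q" p'] Suc.prems p by simp
  qed
qed

section \<open>Deletion-contraction\<close>

text \<open>The counterpart of \<open>computes\<close> without fixed images. All pattern vertices
  are smaller than \<open>n\<close>, so the cells below \<open>n\<close> are free to be overwritten,
  while intermediate results from \<open>n\<close> on survive.\<close>

definition calculable :: "nat \<Rightarrow> nat \<Rightarrow> (graph_rep \<Rightarrow> nat) \<Rightarrow> bool" where
  "calculable n r f \<longleftrightarrow> (\<forall>t\<ge>n. \<exists>c. triple r (\<lambda>R U h m. m = h) c
     (\<lambda>R U h m. m t = f R \<and> (\<forall>a<t. n \<le> a \<longrightarrow> m a = h a)))"

lemma calculable_cong:
  assumes "calculable n r f" "\<And>R X Y U. good R X Y U \<Longrightarrow> f R = g R"
  shows "calculable n r g"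
  unfolding calculable_def
proof (intro allI impI)
  fix t assume "n \<le> t"
  then obtain c where c: "triple r (\<lambda>R U h m. m = h) c (\<lambda>R U h m. m t = f R \<and> (\<forall>a<t. n \<le> a \<longrightarrow> m a = h a))"
    using assms(1) unfolding calculable_def by blast
  have "triple r (\<lambda>R U h m. m = h) c (\<lambda>R U h m. m t = g R \<and> (\<forall>a<t. n \<le> a \<longrightarrow> m a = h a))"
    by (rule triple_conseq[OF c]) (use assms(2) in auto)
  then show "\<exists>c. triple r (\<lambda>R U h m. m = h) c (\<lambda>R U h m. m t = g R \<and> (\<forall>a<t. n \<le> a \<longrightarrow> m a = h a))" ..
qed

lemma calculable_zero: "calculable n r (\<lambda>R. 0)"
  unfolding calculable_def
proof (intro allI impI exI)
  fix t
  show "triple r (\<lambda>R U h m. m = h) (Op (Set_Const t 0)) (\<lambda>R U h m. m t = 0 \<and> (\<forall>a<t. n \<le> a \<longrightarrow> m a = h a))"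
    by (rule triple_const[where q = 1]) (auto dest: good_U)
qed

lemma calculable_diff:
  assumes "calculable n r f" "calculable n r g" "\<And>R X Y U. good R X Y U \<Longrightarrow> f R \<le> U ^ q"
  shows "calculable n r (\<lambda>R. f R - g R)"
  unfolding calculable_def
proof (intro allI impI)
  fix t assume t: "n \<le> t"
  obtain c where c: "triple r (\<lambda>R U h m. m = h) c (\<lambda>R U h m. m t = f R \<and> (\<forall>a<t. n \<le> a \<longrightarrow> m a = h a))"
    using assms(1) t unfolding calculable_def by blast
  obtain c' where c': "triple r (\<lambda>R U h m. m = h) c' (\<lambda>R U h m. m (t + 1) = g R \<and> (\<forall>a<t + 1. n \<le> a \<longrightarrow> m a = h a))"
    using assms(2) t unfolding calculable_def by (meson le_add1 le_trans)
  have 1: "triple r (\<lambda>R U h m. m t = f R \<and> (\<forall>a<t. n \<le> a \<longrightarrow> m a = h a)) c'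
    (\<lambda>R U h m. m t = f R \<and> m (t + 1) = g R \<and> (\<forall>a<t. n \<le> a \<longrightarrow> m a = h a))"
    by (rule triple_conseq[OF c']) (use t in auto)
  have 2: "triple r (\<lambda>R U h m. m t = f R \<and> m (t + 1) = g R \<and> (\<forall>a<t. n \<le> a \<longrightarrow> m a = h a)) (Op (Sub_Op t t (t + 1)))
     (\<lambda>R U h m. m t = f R - g R \<and> (\<forall>a<t. n \<le> a \<longrightarrow> m a = h a))"
  proof (rule triple_sub[where q = "q + 1"], goal_cases)
    case (1 R X Y U h m)
    have "f R \<le> U ^ q" by (rule assms(3)[OF 1(1)])
    also have "\<dots> < U ^ (q + 1)" using good_U[OF 1(1)] by (intro power_strict_increasing) auto
    finally show ?case using 1(2) by auto
  qed
  have "triple r (\<lambda>R U h m. m = h) (Seq c (Seq c' (Op (Sub_Op t t (t + 1)))))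
     (\<lambda>R U h m. m t = f R - g R \<and> (\<forall>a<t. n \<le> a \<longrightarrow> m a = h a))"
    by (rule triple_seq[OF c triple_seq[OF 1 2]])
  then show "\<exists>c. triple r (\<lambda>R U h m. m = h) c (\<lambda>R U h m. m t = f R - g R \<and> (\<forall>a<t. n \<le> a \<longrightarrow> m a = h a))" ..
qed

text \<open>\<open>w\<close> names a quotient and \<open>Ps\<close> lists the inequations still
  imposed: with none of them these are the homomorphisms, with all pairs of letters the injective
  ones.\<close>

definition word_maps :: "nat list \<Rightarrow> (nat \<times> nat) list \<Rightarrow> graph_rep \<Rightarrow> (nat \<Rightarrow> nat) set" where
  "word_maps w Ps R = {g \<in> set w \<rightarrow>\<^sub>E tails R. preserves (set (word_pairs w)) R (set w) g \<and> (\<forall>(u, v)\<in>set Ps. g u \<noteq> g v)}"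

lemma finite_word_maps: "finite (word_maps w Ps R)"
  by (rule finite_subset[OF _ finite_PiE[of "set w" "\<lambda>_. tails R"]]) (auto simp: word_maps_def)

lemma card_word_maps_le:
  assumes "good R X Y U" "length w = n"
  shows "card (word_maps w Ps R) \<le> U ^ n"
proof -
  have U: "1 \<le> U" "card (tails R) \<le> U" using assms by (auto simp: good_def)
  have "card (word_maps w Ps R) \<le> card (set w \<rightarrow>\<^sub>E tails R)"
    by (rule card_mono) (auto simp: word_maps_def intro: finite_PiE)
  also have "\<dots> = card (tails R) ^ card (set w)" by (simp add: card_PiE)
  also have "\<dots> \<le> U ^ card (set w)" using U by (intro power_mono) auto
  also have "\<dots> \<le> U ^ n" using U assms(2) card_length[of w] by (intro power_increasing) auto
  finally show ?thesis .
qed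

lemma word_maps_Nil: "card (word_maps w [] R) = num_ext (set (word_pairs w)) R {} h (set w)"
proof -
  have "preserves (set (word_pairs w)) R (set w) g = preserves (set (word_pairs w)) R ({} \<union> set w) (override_on h g (set w))" for g
    by (simp, rule preserves_cong) simp
  then show ?thesis by (simp add: word_maps_def num_ext_def)
qed

definition merge :: "nat \<Rightarrow> nat \<Rightarrow> nat \<Rightarrow> nat" where
  "merge u v x = (if x = v then u else x)"

lemma preserves_word_pairs:
  "w \<noteq> [] \<Longrightarrow> preserves (set (word_pairs w)) R (set w) g \<longleftrightarrow> (\<forall>(x, y)\<in>set (word_pairs w). (g x, g y) \<in> arcs R)"
  using word_pairs_subset[of w] unfolding preserves_def by blast

text \<open>The smaller name has to survive: where \<open>v\<close> occurs for the first time, the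
  letter \<open>u\<close> has already been read because \<open>u < v\<close>, so the renamed letter
  is a legitimate revisit.\<close>

lemma canonical_merge:
  assumes "canonical w" "u \<in> set w" "u < v"
  shows "canonical (map (merge u v) w)"
proof -
  \<comment> \<open>\<open>p\<close> is carried along because \<open>u\<close> is only known to
    occur somewhere in the whole word; that it occurs in the suffix is derived where
    \<open>v\<close> enters.\<close>
  have "canonical (p @ q) \<Longrightarrow> u \<in> set (p @ q) \<Longrightarrow> canonical (map (merge u v) q)" for p q
  proof (induction q arbitrary: p)
    case (Cons x q)
    have can: "canonical (map (merge u v) q)" using Cons.IH[of "p @ [x]"] Cons.prems by simp
    have x: "x = length q \<or> x \<in> set q" using canonical_append[OF Cons.prems(1)] by simp
    have "merge u v x = length q \<or> merge u v x \<in> set (map (merge u v) q)"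
    proof (cases "x = length q")
      case True
      show ?thesis
      proof (cases "x = v")
        case True
        then have "u \<in> set q"
          using canonical_mem_suffix[of "p @ [x]" q u] Cons.prems \<open>x = length q\<close> assms(3) by auto
        then show ?thesis using True assms(3) by (auto simp: merge_def image_iff intro!: bexI[of _ u])
      qed (use \<open>x = length q\<close> in \<open>simp add: merge_def\<close>)
    next
      case False
      then have "x \<in> set q" using x by simp
      then show ?thesis by auto
    qed
    then show ?case using can by simp
  qed simp
  from this[of "[]" w] show ?thesis using assms by simp
qed

lemma word_maps_Cons:
  assumes "w \<noteq> []" "u \<in> set w" "v \<in> set w" "u \<noteq> v" "set Ps \<subseteq> set w \<times> set w"
  shows "card (word_maps w ((u, v) # Ps) R) =
    card (word_maps w Ps R) - card (word_maps (map (merge u v) w) (map (map_prod (merge u v) (merge u v)) Ps) R)"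
proof -
  let ?f = "merge u v"
  let ?w = "map ?f w" and ?Ps = "map (map_prod ?f ?f) Ps"
  let ?B = "{g \<in> word_maps w Ps R. g u = g v}"
  have fw: "?f x \<in> set ?w" if "x \<in> set w" for x using that by simp
  have sw: "set ?w \<subseteq> set w" "v \<notin> set ?w" using assms by (auto simp: merge_def split: if_splits)
  have fix_w: "?f x = x" if "x \<in> set ?w" for x using that sw by (auto simp: merge_def)
  have pw: "set (word_pairs ?w) = map_prod ?f ?f ` set (word_pairs w)"
    using word_pairs_map[OF assms(1), of ?f] by simp
  have pres: "preserves (set (word_pairs ?w)) R (set ?w) g \<longleftrightarrow> preserves (set (word_pairs w)) R (set w) (\<lambda>x. g (?f x))" for g
  proof -
    have "?w \<noteq> []" using assms(1) by simp
    then show ?thesis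
      unfolding preserves_word_pairs[OF assms(1)] preserves_word_pairs[OF \<open>?w \<noteq> []\<close>] unfolding pw by auto
  qed
  have ineq: "(\<forall>(x, y)\<in>set ?Ps. g x \<noteq> g y) \<longleftrightarrow> (\<forall>(x, y)\<in>set Ps. g (?f x) \<noteq> g (?f y))" for g :: "nat \<Rightarrow> nat"
    by auto
  have "bij_betw (\<lambda>g. restrict (\<lambda>x. g (?f x)) (set w)) (word_maps ?w ?Ps R) ?B"
  \<comment> \<open>Precomposition with the contraction and restriction to the surviving letters are
    inverse to each other.\<close>
  proof (rule bij_betwI[where g = "\<lambda>g. restrict g (set ?w)"], goal_cases)
    case 1
    show ?case
    proof
      fix g assume g: "g \<in> word_maps ?w ?Ps R"
      let ?g = "restrict (\<lambda>x. g (?f x)) (set w)"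
      have "preserves (set (word_pairs w)) R (set w) ?g"
      proof -
        have "preserves (set (word_pairs w)) R (set w) (\<lambda>x. g (?f x))" using g pres by (simp add: word_maps_def)
        also have "preserves (set (word_pairs w)) R (set w) (\<lambda>x. g (?f x)) = preserves (set (word_pairs w)) R (set w) ?g"
          by (rule preserves_cong) simp
        finally show ?thesis .
      qed
      moreover have "\<forall>(x, y)\<in>set Ps. ?g x \<noteq> ?g y"
      proof -
        have *: "\<forall>(x, y)\<in>set Ps. g (?f x) \<noteq> g (?f y)" using g ineq by (simp add: word_maps_def)
        have "?g x \<noteq> ?g y" if "(x, y) \<in> set Ps" for x y
        proof -
          have "x \<in> set w" "y \<in> set w" using that assms(5) by auto
          then show ?thesis using bspec[OF * that] by simp
        qed
        then show ?thesis by blast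
      qed
      moreover have "?g \<in> set w \<rightarrow>\<^sub>E tails R"
      proof (rule restrict_PiE_iff[THEN iffD2], rule ballI)
        fix x assume "x \<in> set w"
        then show "g (?f x) \<in> tails R" using g fw by (auto simp: word_maps_def)
      qed
      moreover have "?g u = ?g v" using assms by (simp add: merge_def)
      ultimately show "?g \<in> ?B" by (simp add: word_maps_def)
    qed
  next
    case 2
    show ?case
    proof
      fix g assume g: "g \<in> ?B"
      let ?g = "restrict g (set ?w)"
      have eq: "?g (?f x) = g x" if "x \<in> set w" for x
        using that g fw[OF that] by (cases "x = v") (auto simp: merge_def)
      have "preserves (set (word_pairs ?w)) R (set ?w) ?g"
      proof -
        have "preserves (set (word_pairs w)) R (set w) (\<lambda>x. ?g (?f x)) = preserves (set (word_pairs w)) R (set w) g"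
          by (rule preserves_cong) (rule eq)
        then show ?thesis using g pres by (simp add: word_maps_def)
      qed
      moreover have "\<forall>(x, y)\<in>set ?Ps. ?g x \<noteq> ?g y"
        unfolding ineq using g assms(5) eq by (fastforce simp: word_maps_def)
      moreover have "?g \<in> set ?w \<rightarrow>\<^sub>E tails R" using g sw(1) by (auto simp: word_maps_def simp del: set_map)
      ultimately show "?g \<in> word_maps ?w ?Ps R" unfolding word_maps_def by blast
    qed
  next
    case (3 g)
    then have g: "g \<in> set ?w \<rightarrow>\<^sub>E tails R" by (simp add: word_maps_def)
    show ?case
    proof
      fix x
      show "restrict (restrict (\<lambda>x. g (?f x)) (set w)) (set ?w) x = g x"
        using g fix_w[of x] sw(1) by (cases "x \<in> set ?w") (auto simp: PiE_def extensional_def simp del: set_map)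
    qed
  next
    case (4 g)
    then have g: "g \<in> set w \<rightarrow>\<^sub>E tails R" "g u = g v" by (auto simp: word_maps_def)
    show ?case
    proof
      fix x
      show "restrict (\<lambda>x. restrict g (set ?w) (?f x)) (set w) x = g x"
        using g fw[of x] by (cases "x \<in> set w"; cases "x = v") (auto simp: PiE_def extensional_def merge_def)
    qed
  qed
  then have B: "card (word_maps ?w ?Ps R) = card ?B" by (rule bij_betw_same_card)
  have "word_maps w ((u, v) # Ps) R = word_maps w Ps R - ?B" by (auto simp: word_maps_def)
  then show ?thesis unfolding B by (simp add: card_Diff_subset finite_word_maps)
qed

text \<open>Each inequation is traded for a difference of two instances with one inequation fewer.
  Merging renames letters without shortening the word, so the hypothesis on words of length
  \<open>n\<close> covers all quotients that arise; those with a loop contribute 0.\<close>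

lemma calculable_word_maps:
  assumes elim: "\<And>w. canonical w \<Longrightarrow> length w = n \<Longrightarrow> (\<And>x. (x, x) \<notin> set (word_pairs w)) \<Longrightarrow>
      eliminable (set (word_pairs w)) r (set w)" and n: "0 < n"
  shows "canonical w \<Longrightarrow> length w = n \<Longrightarrow> set Ps \<subseteq> set w \<times> set w \<Longrightarrow>
    calculable n r (\<lambda>R. card (word_maps w Ps R))"
proof (induction "length Ps" arbitrary: w Ps)
  case 0
  then have Ps: "Ps = []" by simp
  have ne: "w \<noteq> []" using 0 n by auto
  show ?case
  proof (cases "\<exists>x. (x, x) \<in> set (word_pairs w)")
    case True
    then obtain x where x: "(x, x) \<in> set (word_pairs w)" by blast
    then have xw: "x \<in> set w" using word_pairs_subset[OF ne] by auto
    have empty: "word_maps w Ps R = {}" if "good R X Y U" for R X Y U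
    proof -
      have "\<not> preserves (set (word_pairs w)) R (set w) g" for g
        using x xw that unfolding preserves_def good_def by (metis (mono_tags, lifting) case_prodD)
      then show ?thesis by (simp add: word_maps_def)
    qed
    show ?thesis by (rule calculable_cong[OF calculable_zero]) (simp add: empty)
  next
    case False
    then have "eliminable (set (word_pairs w)) r (set w)" using elim 0 by blast
    moreover have "set w \<subseteq> {..<n}" using canonical_less 0 by auto
    ultimately have ex: "\<exists>c. computes (set (word_pairs w)) r {} (set w) t c" if "n \<le> t" for t
      using eliminable_computes[of _ r "set w" n "{}" t] that by simp
    show ?thesis unfolding calculable_def
    proof (intro allI impI)
      fix t assume "n \<le> t"
      then obtain c where c: "computes (set (word_pairs w)) r {} (set w) t c" using ex by blast
      have "triple r (\<lambda>R U h m. m = h) c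
        (\<lambda>R U h m. m t = card (word_maps w Ps R) \<and> (\<forall>a<t. n \<le> a \<longrightarrow> m a = h a))"
      proof (rule triple_conseq[OF c[unfolded computes_def]], goal_cases)
        case (1 R X Y U h m)
        have "a \<notin> set w" if "n \<le> a" for a using that \<open>set w \<subseteq> {..<n}\<close> by auto
        then show ?case using 1(2) unfolding Ps word_maps_Nil[of w R h] by (intro exI[of _ h]) auto
      qed
      then show "\<exists>c. triple r (\<lambda>R U h m. m = h) c
        (\<lambda>R U h m. m t = card (word_maps w Ps R) \<and> (\<forall>a<t. n \<le> a \<longrightarrow> m a = h a))" ..
    qed
  qed
next
  case (Suc l)
  then obtain p Ps' where Ps: "Ps = p # Ps'" "l = length Ps'" by (metis length_Suc_conv)
  have ne: "w \<noteq> []" using Suc.prems n by auto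
  obtain u v where p: "p = (u, v)" by (cases p)
  have step: "calculable n r (\<lambda>R. card (word_maps w ((u, v) # Ps') R))"
    if uv: "u \<in> set w" "v \<in> set w" "u < v" for u v
  proof -
    let ?w = "map (merge u v) w" and ?Ps = "map (map_prod (merge u v) (merge u v)) Ps'"
    have sub: "set Ps' \<subseteq> set w \<times> set w" using Suc.prems Ps by simp
    then have "set ?Ps \<subseteq> set ?w \<times> set ?w" by auto
    then have "calculable n r (\<lambda>R. card (word_maps ?w ?Ps R))"
      using Suc.hyps(1)[of ?Ps ?w] Ps canonical_merge[OF Suc.prems(1) uv(1,3)] Suc.prems(2) by simp
    moreover have "calculable n r (\<lambda>R. card (word_maps w Ps' R))"
      using Suc.hyps(1)[of Ps' w] Ps Suc.prems sub by simp
    ultimately have "calculable n r (\<lambda>R. card (word_maps w Ps' R) - card (word_maps ?w ?Ps R))"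
      using card_word_maps_le[OF _ Suc.prems(2)] by (intro calculable_diff)
    then show ?thesis
      using word_maps_Cons[OF ne uv(1,2) _ sub] uv(3) by simp
  qed
  have uv: "u \<in> set w" "v \<in> set w" using Suc.prems Ps p by auto
  consider "u = v" | "u < v" | "v < u" by linarith
  then show ?case
  proof cases
    case 1
    then have "word_maps w Ps R = {}" for R by (auto simp: word_maps_def Ps p)
    then show ?thesis using calculable_zero by simp
  next
    case 2
    then show ?thesis using step[OF uv] Ps p by simp
  next
    case 3
    \<comment> \<open>Inequations are symmetric, so the smaller letter can be put first, as the
      contraction requires.\<close>
    have "word_maps w Ps R = word_maps w ((v, u) # Ps') R" for R by (auto simp: word_maps_def Ps p)
    then show ?thesis using step[OF uv(2,1) 3] by simp
  qed
qed

section \<open>Embeddings and subgraphs\<close>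

definition embeddings :: "'a ugraph \<Rightarrow> 'b ugraph \<Rightarrow> ('a \<Rightarrow> 'b) set" where
  "embeddings F G = {g \<in> ugraph_verts F \<rightarrow>\<^sub>E ugraph_verts G. inj_on g (ugraph_verts F) \<and>
     (\<forall>e\<in>ugraph_edges F. g ` e \<in> ugraph_edges G)}"

definition automorphisms :: "'a ugraph \<Rightarrow> ('a \<Rightarrow> 'a) set" where
  "automorphisms F = {f \<in> ugraph_verts F \<rightarrow>\<^sub>E ugraph_verts F. inj_on f (ugraph_verts F) \<and>
     (\<lambda>e. f ` e) ` ugraph_edges F = ugraph_edges F}"

definition image_graph :: "('a \<Rightarrow> 'b) \<Rightarrow> 'a ugraph \<Rightarrow> 'b ugraph" where
  "image_graph g F = (g ` ugraph_verts F, (\<lambda>e. g ` e) ` ugraph_edges F)"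

lemma simple_edge:
  assumes "simple_ugraph G" "e \<in> ugraph_edges G"
  obtains u v where "e = {u, v}" "u \<noteq> v" "u \<in> ugraph_verts G" "v \<in> ugraph_verts G"
  using assms unfolding simple_ugraph_def by (metis card_2_iff insert_subset)

lemma inj_image_verts:
  assumes "simple_ugraph F" "inj_on g (ugraph_verts F)" "e \<subseteq> ugraph_verts F" "e' \<subseteq> ugraph_verts F" "g ` e = g ` e'"
  shows "e = e'"
  using assms inj_on_image_eq_iff by blast

lemma embedding_image:
  assumes "simple_ugraph F" "simple_ugraph G" "g \<in> embeddings F G"
  shows "ugraph_subgraph (image_graph g F) G \<and> ugraph_iso F (image_graph g F)"
proof
  have g: "g \<in> ugraph_verts F \<rightarrow> ugraph_verts G" "inj_on g (ugraph_verts F)"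
    "\<And>e. e \<in> ugraph_edges F \<Longrightarrow> g ` e \<in> ugraph_edges G"
    using assms(3) by (auto simp: embeddings_def)
  have F: "finite (ugraph_verts F)" "\<And>e. e \<in> ugraph_edges F \<Longrightarrow> e \<subseteq> ugraph_verts F \<and> card e = 2"
    using assms(1) by (auto simp: simple_ugraph_def)
  have "card (g ` e) = 2" if "e \<in> ugraph_edges F" for e
    using F(2)[OF that] g(2) by (metis card_image inj_on_subset)
  moreover have "g ` e \<subseteq> g ` ugraph_verts F" if "e \<in> ugraph_edges F" for e
    using F(2)[OF that] by auto
  ultimately show "ugraph_subgraph (image_graph g F) G"
    using g F(1) by (auto simp: ugraph_subgraph_def simple_ugraph_def image_graph_def ugraph_verts_def ugraph_edges_def)
  have "{u, v} \<in> ugraph_edges F" if "u \<in> ugraph_verts F" "v \<in> ugraph_verts F" "e \<in> ugraph_edges F" "{g u, g v} = g ` e" for u v e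
  proof -
    have "{u, v} = e" by (rule inj_image_verts[OF assms(1) g(2)]) (use that F(2) in auto)
    then show ?thesis using that by simp
  qed
  moreover have "{g u, g v} \<in> (\<lambda>e. g ` e) ` ugraph_edges F" if "{u, v} \<in> ugraph_edges F" for u v
    using imageI[OF that, of "\<lambda>e. g ` e"] by simp
  ultimately show "ugraph_iso F (image_graph g F)"
    unfolding ugraph_iso_def image_graph_def ugraph_verts_def[of "(_, _)"] ugraph_edges_def[of "(_, _)"] fst_conv snd_conv
    by (intro exI[of _ g]) (use g(2) in \<open>auto simp: bij_betw_def\<close>)
qed

lemma subgraph_image:
  assumes "simple_ugraph F" "ugraph_subgraph S G" "ugraph_iso F S"
  shows "\<exists>g\<in>embeddings F G. image_graph g F = S"
proof -
  obtain f where f: "bij_betw f (ugraph_verts F) (ugraph_verts S)"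
    "\<And>u v. u \<in> ugraph_verts F \<Longrightarrow> v \<in> ugraph_verts F \<Longrightarrow> {u, v} \<in> ugraph_edges F \<longleftrightarrow> {f u, f v} \<in> ugraph_edges S"
    using assms(3) unfolding ugraph_iso_def by blast
  have S: "simple_ugraph S" "ugraph_verts S \<subseteq> ugraph_verts G" "ugraph_edges S \<subseteq> ugraph_edges G"
    using assms(2) by (auto simp: ugraph_subgraph_def)
  let ?g = "restrict f (ugraph_verts F)"
  have gV: "?g ` ugraph_verts F = ugraph_verts S" "inj_on ?g (ugraph_verts F)"
    using f(1) by (auto simp: bij_betw_def inj_on_def)
  have sub: "?g ` e \<in> ugraph_edges S" if e: "e \<in> ugraph_edges F" for e
  proof -
    obtain u v where "e = {u, v}" "u \<in> ugraph_verts F" "v \<in> ugraph_verts F"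
      using simple_edge[OF assms(1) e] by metis
    then show ?thesis using f(2) e by simp
  qed
  have sup: "e' \<in> (\<lambda>e. ?g ` e) ` ugraph_edges F" if e': "e' \<in> ugraph_edges S" for e'
  proof -
    obtain a b where ab: "e' = {a, b}" "a \<in> ugraph_verts S" "b \<in> ugraph_verts S"
      using simple_edge[OF S(1) e'] by metis
    then obtain u v where uv: "u \<in> ugraph_verts F" "v \<in> ugraph_verts F" "a = ?g u" "b = ?g v"
      using gV(1) by (metis imageE)
    then have "{u, v} \<in> ugraph_edges F" using f(2)[of u v] e' ab by simp
    moreover have "e' = ?g ` {u, v}" using uv ab by simp
    ultimately show ?thesis by (rule rev_image_eqI)
  qed
  have "?g \<in> embeddings F G"
    using gV sub S by (auto simp: embeddings_def simp del: restrict_apply intro!: PiE_I)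
  moreover have "image_graph ?g F = S"
  proof -
    have "(\<lambda>e. ?g ` e) ` ugraph_edges F = ugraph_edges S" using sub sup by blast
    then show ?thesis using gV(1)
      by (simp add: image_graph_def ugraph_verts_def ugraph_edges_def prod_eq_iff del: restrict_apply)
  qed
  ultimately show ?thesis by blast
qed

text \<open>Embeddings with the same image graph differ by an automorphism: \<open>f\<close> is sent
  to \<open>g\<close> after \<open>f\<close>, and \<open>g'\<close> is sent back to the inverse of
  \<open>g\<close> after \<open>g'\<close>.\<close>

lemma card_fibre:
  assumes "simple_ugraph F" "g \<in> embeddings F G"
  shows "card {g' \<in> embeddings F G. image_graph g' F = image_graph g F} = card (automorphisms F)"
proof -
  let ?V = "ugraph_verts F" and ?E = "ugraph_edges F"
  have g: "inj_on g ?V" "g \<in> ?V \<rightarrow> ugraph_verts G" "\<And>e. e \<in> ?E \<Longrightarrow> g ` e \<in> ugraph_edges G"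
    using assms(2) by (auto simp: embeddings_def)
  have F: "finite ?V" "\<And>e. e \<in> ?E \<Longrightarrow> e \<subseteq> ?V" using assms(1) by (auto simp: simple_ugraph_def)
  have "bij_betw (\<lambda>f. restrict (\<lambda>v. g (f v)) ?V) (automorphisms F)
    {g' \<in> embeddings F G. image_graph g' F = image_graph g F}"
  proof (rule bij_betwI[where g = "\<lambda>g'. restrict (\<lambda>v. the_inv_into ?V g (g' v)) ?V"], goal_cases)
    case 1
    show ?case
    proof
      fix f assume f: "f \<in> automorphisms F"
      let ?g' = "restrict (\<lambda>v. g (f v)) ?V"
      have fV: "f \<in> ?V \<rightarrow> ?V" "inj_on f ?V" "(\<lambda>e. f ` e) ` ?E = ?E"
        using f by (auto simp: automorphisms_def)
      have "f ` ?V = ?V" using fV F(1) by (intro endo_inj_surj) auto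
      have im: "?g' ` e = g ` f ` e" if "e \<subseteq> ?V" for e using that by (force simp: image_image)
      have E: "(\<lambda>e. ?g' ` e) ` ?E = (\<lambda>e. g ` e) ` ?E"
      proof -
        have "(\<lambda>e. ?g' ` e) ` ?E = (\<lambda>e. g ` f ` e) ` ?E" using im F(2) by (intro image_cong[OF refl]) simp
        also have "\<dots> = (\<lambda>e. g ` e) ` (\<lambda>e. f ` e) ` ?E" by (simp only: image_image)
        finally show ?thesis using fV(3) by simp
      qed
      have "?g' ` e \<in> ugraph_edges G" if "e \<in> ?E" for e
      proof -
        have "?g' ` e \<in> (\<lambda>e. g ` e) ` ?E" unfolding E[symmetric] using that by blast
        then show ?thesis using g(3) by auto
      qed
      moreover have "inj_on ?g' ?V" using g(1) fV by (auto simp: inj_on_def Pi_iff)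
      moreover have "?g' \<in> ?V \<rightarrow>\<^sub>E ugraph_verts G" using g(2) fV(1) by auto
      moreover have "image_graph ?g' F = image_graph g F"
        unfolding image_graph_def E using im[of ?V] \<open>f ` ?V = ?V\<close> by simp
      ultimately show "?g' \<in> {g' \<in> embeddings F G. image_graph g' F = image_graph g F}"
        by (simp add: embeddings_def)
    qed
  next
    case 2
    show ?case
    proof
      fix g' assume "g' \<in> {g' \<in> embeddings F G. image_graph g' F = image_graph g F}"
      then have g': "inj_on g' ?V" "g' ` ?V = g ` ?V" "(\<lambda>e. g' ` e) ` ?E = (\<lambda>e. g ` e) ` ?E"
        by (auto simp: embeddings_def image_graph_def)
      let ?f = "restrict (\<lambda>v. the_inv_into ?V g (g' v)) ?V"
      have gf: "g (?f v) = g' v" "?f v \<in> ?V" if "v \<in> ?V" for v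
      proof -
        have "g' v \<in> g ` ?V" using that g'(2) by blast
        then have "g (the_inv_into ?V g (g' v)) = g' v" "the_inv_into ?V g (g' v) \<in> ?V"
          using f_the_inv_into_f[OF g(1)] the_inv_into_into[OF g(1) _ order_refl] by blast+
        then show "g (?f v) = g' v" "?f v \<in> ?V" using that by simp_all
      qed
      have im: "g ` ?f ` e = g' ` e" if "e \<subseteq> ?V" for e
        unfolding image_image using that gf by (intro image_cong) auto
      have "inj_on ?f ?V"
      proof (rule inj_onI)
        fix a b assume ab: "a \<in> ?V" "b \<in> ?V" "?f a = ?f b"
        have "g' a = g (?f a)" by (rule gf(1)[OF ab(1), symmetric])
        also have "\<dots> = g (?f b)" by (rule arg_cong[OF ab(3)])
        also have "\<dots> = g' b" by (rule gf(1)[OF ab(2)])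
        finally show "a = b" using g'(1) ab(1,2) by (auto dest: inj_onD)
      qed
      moreover have "(\<lambda>e. ?f ` e) ` ?E = ?E"
      proof -
        have sub: "?f ` e \<subseteq> ?V" if "e \<in> ?E" for e using gf F(2)[OF that] by blast
        have 1: "?f ` e \<in> ?E" if e: "e \<in> ?E" for e
        proof -
          have "g' ` e \<in> (\<lambda>e. g ` e) ` ?E" unfolding g'(3)[symmetric] using e by blast
          then obtain e' where e': "e' \<in> ?E" "g' ` e = g ` e'" by blast
          then have "g ` ?f ` e = g ` e'" using im F(2)[OF e] by simp
          then have "?f ` e = e'" using inj_image_verts[OF assms(1) g(1) sub[OF e] F(2)[OF e'(1)]] by simp
          then show ?thesis using e' by simp
        qed
        moreover have "\<exists>e\<in>?E. e' = ?f ` e" if e': "e' \<in> ?E" for e'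
        proof -
          have "g ` e' \<in> (\<lambda>e. g' ` e) ` ?E" unfolding g'(3) using e' by blast
          then obtain e where e: "e \<in> ?E" "g ` e' = g' ` e" by blast
          then have "g ` ?f ` e = g ` e'" using im F(2)[OF e(1)] by simp
          then have "?f ` e = e'" using inj_image_verts[OF assms(1) g(1) sub[OF e(1)] F(2)[OF e']] by simp
          then show ?thesis using e by blast
        qed
        ultimately show ?thesis by blast
      qed
      moreover have "?f \<in> ?V \<rightarrow>\<^sub>E ?V" using gf(2) by (intro restrict_PiE_iff[THEN iffD2]) (simp add: Pi_iff)
      ultimately show "?f \<in> automorphisms F" by (simp add: automorphisms_def)
    qed
  next
    case (3 f)
    have "f \<in> ?V \<rightarrow>\<^sub>E ?V" using 3 by (simp add: automorphisms_def)
    then show ?case using g(1)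
      by (intro ext) (auto simp: the_inv_into_f_f PiE_iff extensional_def)
  next
    case (4 g')
    then have g': "g' \<in> extensional ?V" "g' ` ?V = g ` ?V"
      by (auto simp: embeddings_def image_graph_def PiE_def)
    show ?case
    proof
      fix v
      show "restrict (\<lambda>v. g (restrict (\<lambda>v. the_inv_into ?V g (g' v)) ?V v)) ?V v = g' v"
      proof (cases "v \<in> ?V")
        case True
        then have "g' v \<in> g ` ?V" using g'(2) by blast
        then have "g (the_inv_into ?V g (g' v)) = g' v" by (rule f_the_inv_into_f[OF g(1)])
        then show ?thesis using True by simp
      qed (use g'(1) in \<open>simp add: extensional_def\<close>)
    qed
  qed
  then show ?thesis by (rule bij_betw_same_card[symmetric])
qed

text \<open>The copies of \<open>F\<close> are the image graphs of its embeddings, and all fibres of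
  this map have the same size by \<open>card_fibre\<close>.\<close>

lemma card_embeddings:
  assumes "simple_ugraph F" "simple_ugraph G"
  shows "card (embeddings F G) = num_subgraphs_iso F G * card (automorphisms F)"
proof -
  let ?S = "{S. ugraph_subgraph S G \<and> ugraph_iso F S}"
  have S: "?S = (\<lambda>g. image_graph g F) ` embeddings F G"
    using embedding_image[OF assms] subgraph_image[OF assms(1)] by blast
  have fin: "finite (embeddings F G)"
    using assms by (intro finite_subset[OF _ finite_PiE[of "ugraph_verts F" "\<lambda>_. ugraph_verts G"]])
      (auto simp: embeddings_def simple_ugraph_def)
  have "card (embeddings F G) = (\<Sum>S\<in>?S. card {g \<in> embeddings F G. image_graph g F = S})"
    unfolding S card_eq_sum by (rule sum.image_gen[OF fin])
  also have "\<dots> = (\<Sum>S\<in>?S. card (automorphisms F))"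
    unfolding S by (intro sum.cong refl) (auto simp: card_fibre[OF assms(1)])
  finally show ?thesis by (simp add: num_subgraphs_iso_def)
qed

lemma card_automorphisms_pos:
  assumes "simple_ugraph F"
  shows "0 < card (automorphisms F)"
proof -
  have "finite (automorphisms F)"
    using assms by (intro finite_subset[OF _ finite_PiE[of "ugraph_verts F" "\<lambda>_. ugraph_verts F"]])
      (auto simp: automorphisms_def simple_ugraph_def)
  moreover have "restrict (\<lambda>v. v) (ugraph_verts F) \<in> automorphisms F"
  proof -
    have "restrict (\<lambda>v. v) (ugraph_verts F) ` e = e" if "e \<in> ugraph_edges F" for e
      using that assms by (force simp: simple_ugraph_def)
    then have "(\<lambda>e. restrict (\<lambda>v. v) (ugraph_verts F) ` e) ` ugraph_edges F = ugraph_edges F" by force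
    then show ?thesis by (simp add: automorphisms_def inj_on_def)
  qed
  ultimately show ?thesis by (auto simp: card_gt_0_iff)
qed

section \<open>Counting cycles\<close>

text \<open>The 2 in \<open>X\<close> absorbs the unit cost of the query instruction and the 3 in
  \<open>Y\<close> the two instructions added to a pass in \<open>good\<close>; \<open>Y\<close>
  also dominates the number of arcs, which is at most twice that of the edges. \<open>K\<close> is
  arbitrary, possibly negative, whence the maximum with 1.\<close>

lemma good_rep:
  assumes H: "simple_ugraph H" and R: "represents R H" and eff: "efficient_rep K e R H" and fit: "fits_word w H"
  defines "X \<equiv> 2 * max K 1 * polylog e H" and "Y \<equiv> 3 * max K 1 * edge_bound 1 H * polylog e H"
  shows "good R X Y (2 ^ w)"
proof -
  let ?K = "max K 1" and ?p = "polylog e H" and ?b = "edge_bound 1 H"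
  have arcs: "arcs R = {(x, y). {x, y} \<in> ugraph_edges H}" using R by (simp add: arcs_def represents_def)
  have fin: "finite (ugraph_verts H)" and edge: "\<And>d. d \<in> ugraph_edges H \<Longrightarrow> d \<subseteq> ugraph_verts H \<and> card d = 2"
    using H by (auto simp: simple_ugraph_def)
  have finE: "finite (ugraph_edges H)"
    by (rule finite_subset[of _ "Pow (ugraph_verts H)"]) (use edge fin in auto)
  have tails: "tails R \<subseteq> ugraph_verts H" using arcs edge by (force simp: tails_def)
  have p: "1 \<le> ?p" by (simp add: polylog_def one_le_log_cancel_iff)
  have b: "1 \<le> ?b" by (simp add: edge_bound_def)
  have K: "1 \<le> ?K" "K \<le> ?K" by auto
  have Kp: "1 \<le> ?K * ?p" using mult_mono[OF K(1) p] K by simp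
  have Kbp: "1 \<le> ?K * ?b * ?p" using mult_mono[OF mult_mono[OF K(1) b] p] K b by simp
  have len: "length (arc_list R) \<le> 2 * num_edges H"
  proof -
    have "length (arc_list R) = card (arcs R)"
      unfolding arcs_def by (rule distinct_card[symmetric]) (use R in \<open>simp add: represents_def\<close>)
    also have "arcs R = (\<Union>d\<in>ugraph_edges H. {(x, y). {x, y} = d})" unfolding arcs by auto
    also have "card \<dots> \<le> (\<Sum>d\<in>ugraph_edges H. card {(x, y). {x, y} = d})"
      by (rule card_UN_le[OF finE])
    also have "\<dots> \<le> (\<Sum>d\<in>ugraph_edges H. 2)"
    proof (rule sum_mono)
      fix d assume "d \<in> ugraph_edges H"
      then obtain u v where "d = {u, v}" using edge[of d] by (metis card_2_iff)
      then have "{(x, y). {x, y} = d} \<subseteq> {(u, v), (v, u)}" by (auto simp: doubleton_eq_iff)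
      then have "card {(x, y). {x, y} = d} \<le> card {(u, v), (v, u)}" by (intro card_mono) auto
      also have "\<dots> \<le> 2" by (cases "u = v") simp_all
      finally show "card {(x, y). {x, y} = d} \<le> 2" .
    qed
    finally show ?thesis by (simp add: num_edges_def mult.commute)
  qed
  show ?thesis unfolding good_def
  proof (intro conjI ballI allI impI)
    show "distinct (arc_list R)" "sorted (map fst (arc_list R))" using R by (auto simp: represents_def)
    show "(y, x) \<in> arcs R" if "(x, y) \<in> arcs R" for x y using that by (simp add: arcs insert_commute)
    show "real (1 + adj_cost R u v) \<le> X" if "u \<in> tails R" "v \<in> tails R" for u v
    proof -
      have "real (adj_cost R u v) \<le> K * ?p" using eff that tails by (auto simp: efficient_rep_def)
      also have "\<dots> \<le> ?K * ?p" using p K by (intro mult_right_mono) auto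
      finally show ?thesis using Kp by (simp add: X_def)
    qed
    have "real (reset_cost R + (\<Sum>i\<le>length (arc_list R). next_cost R i)) \<le> K * ?b * ?p"
      using eff by (simp add: efficient_rep_def)
    also have "\<dots> \<le> ?K * ?b * ?p" using p b K by (intro mult_right_mono) auto
    finally show "real (2 + reset_cost R + (\<Sum>i\<le>length (arc_list R). next_cost R i)) \<le> Y"
      using Kbp by (simp add: Y_def)
    have "real (length (arc_list R)) \<le> 2 * real (max 1 (num_edges H))" using len by simp
    also have "\<dots> = 2 * ?b * 1" by (simp add: edge_bound_def)
    also have "\<dots> \<le> 3 * ?b * (?K * ?p)" using Kp b by (intro mult_mono) auto
    finally show "real (length (arc_list R)) \<le> Y" by (simp add: Y_def mult_ac)
    show "1 \<le> X" "1 \<le> Y" using Kp Kbp by (auto simp: X_def Y_def)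
    have "2 ^ 1 \<le> (2::nat) ^ w" using fit by (intro power_increasing) (auto simp: fits_word_def)
    then show "2 \<le> (2::nat) ^ w" by simp
    have "card (tails R) \<le> card (ugraph_verts H)" using tails fin by (rule card_mono[rotated])
    then show "card (tails R) \<le> 2 ^ w" using fit by (simp add: fits_word_def input_size_def)
    show "x < 2 ^ w" if "x \<in> tails R" for x using that tails fit by (auto simp: fits_word_def)
    show "(x, x) \<notin> arcs R" for x using edge[of "{x}"] by (auto simp: arcs)
  qed
qed

section \<open>The cycle as a pattern\<close>

lemma cycle_edges: "ugraph_edges (cycle_ugraph k) = (\<lambda>i. {i, (i + 1) mod k}) ` {..<k}"
  by (auto simp: cycle_ugraph_def ugraph_edges_def)

lemma cycle_verts: "ugraph_verts (cycle_ugraph k) = {..<k}"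
  by (simp add: cycle_ugraph_def ugraph_verts_def)

lemma simple_cycle:
  assumes "3 \<le> k"
  shows "simple_ugraph (cycle_ugraph k)"
proof -
  have "{i, (i + 1) mod k} \<subseteq> {..<k} \<and> card {i, (i + 1) mod k} = 2" if "i < k" for i
  proof -
    have "(i + 1) mod k \<noteq> i" using that assms by (simp add: mod_Suc)
    then show ?thesis using that by simp
  qed
  then show ?thesis by (simp add: simple_ugraph_def cycle_edges cycle_verts)
qed

definition all_pairs :: "nat \<Rightarrow> (nat \<times> nat) list" where
  "all_pairs k = filter (\<lambda>(i, j). i < j) (List.product [0..<k] [0..<k])"

lemma set_zip_rev_upt: "set (zip (rev [0..<k]) (tl (rev [0..<k]))) = {(Suc i, i) | i. Suc i < k}"
proof (induction k)
  case (Suc k)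
  show ?case
  proof (cases k)
    case (Suc j)
    then have "zip (rev [0..<Suc k]) (tl (rev [0..<Suc k])) = (k, j) # zip (rev [0..<k]) (tl (rev [0..<k]))" by simp
    then show ?thesis using Suc.IH Suc by (auto simp: less_Suc_eq)
  qed simp
qed simp

lemma canonical_rev_upt: "canonical (rev [0..<k])"
  by (induction k) auto

text \<open>\<open>rev [0..<k]\<close> is the canonical word of the partition into singletons, that
  is, of the cycle itself.\<close>

lemma word_maps_cycle:
  assumes "3 \<le> k" "simple_ugraph H" "represents R H"
  shows "word_maps (rev [0..<k]) (all_pairs k) R = embeddings (cycle_ugraph k) H"
proof -
  let ?w = "rev [0..<k]"
  have ne: "?w \<noteq> []" using assms by simp
  have arcs: "(x, y) \<in> arcs R \<longleftrightarrow> {x, y} \<in> ugraph_edges H" for x y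
    using assms(3) by (simp add: arcs_def represents_def)
  have wp: "set (word_pairs ?w) = insert (k - 1, 0) {(Suc i, i) | i. Suc i < k}"
    using assms(1) by (simp add: word_pairs_def set_zip_rev_upt hd_rev last_rev)
  have hom: "preserves (set (word_pairs ?w)) R (set ?w) g \<longleftrightarrow> (\<forall>i<k. {g i, g ((i + 1) mod k)} \<in> ugraph_edges H)" for g
  proof -
    have "preserves (set (word_pairs ?w)) R (set ?w) g \<longleftrightarrow>
      {g (k - 1), g 0} \<in> ugraph_edges H \<and> (\<forall>i. Suc i < k \<longrightarrow> {g (Suc i), g i} \<in> ugraph_edges H)"
      unfolding preserves_word_pairs[OF ne] unfolding wp by (auto simp: arcs)
    also have "\<dots> \<longleftrightarrow> (\<forall>i<k. {g i, g ((i + 1) mod k)} \<in> ugraph_edges H)"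
    proof (intro iffI conjI allI impI)
      fix i assume h: "{g (k - 1), g 0} \<in> ugraph_edges H \<and> (\<forall>i. Suc i < k \<longrightarrow> {g (Suc i), g i} \<in> ugraph_edges H)" and i: "i < k"
      show "{g i, g ((i + 1) mod k)} \<in> ugraph_edges H"
      proof (cases "Suc i = k")
        case True
        then have "i = k - 1" by simp
        then show ?thesis using h True by simp
      next
        case False
        then have "Suc i < k" using i by simp
        then show ?thesis using h by (simp add: insert_commute)
      qed
    next
      assume h: "\<forall>i<k. {g i, g ((i + 1) mod k)} \<in> ugraph_edges H"
      have "{g (k - 1), g ((k - 1 + 1) mod k)} \<in> ugraph_edges H"
        by (rule h[rule_format]) (use assms(1) in simp)
      then show "{g (k - 1), g 0} \<in> ugraph_edges H" using assms(1) by simp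
      fix i assume i: "Suc i < k"
      then have "{g i, g ((i + 1) mod k)} \<in> ugraph_edges H" by (intro h[rule_format]) simp
      then show "{g (Suc i), g i} \<in> ugraph_edges H" using i by (simp add: insert_commute)
    qed
    finally show ?thesis .
  qed
  have img: "(\<forall>d\<in>ugraph_edges (cycle_ugraph k). g ` d \<in> ugraph_edges H) \<longleftrightarrow>
    (\<forall>i<k. {g i, g ((i + 1) mod k)} \<in> ugraph_edges H)" for g
    by (auto simp: cycle_edges)
  have inj: "(\<forall>(i, j)\<in>set (all_pairs k). g i \<noteq> g j) \<longleftrightarrow> inj_on g {..<k}" for g :: "nat \<Rightarrow> nat"
  proof
    assume h: "\<forall>(i, j)\<in>set (all_pairs k). g i \<noteq> g j"
    show "inj_on g {..<k}"
    proof (rule linorder_inj_onI)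
      fix i j :: nat assume "i < j" "i \<in> {..<k}" "j \<in> {..<k}"
      then show "g i \<noteq> g j" using h by (auto simp: all_pairs_def)
    qed auto
  qed (auto simp: all_pairs_def inj_on_def)
  have tails: "tails R \<subseteq> ugraph_verts H"
    using assms(2) arcs by (force simp: tails_def simple_ugraph_def)
  \<comment> \<open>Every vertex of the cycle has a neighbour, so its image is never
    isolated.\<close>
  have PiE: "g \<in> {..<k} \<rightarrow>\<^sub>E tails R \<longleftrightarrow> g \<in> {..<k} \<rightarrow>\<^sub>E ugraph_verts H"
    if h: "\<forall>i<k. {g i, g ((i + 1) mod k)} \<in> ugraph_edges H" for g
  proof -
    have "g i \<in> tails R" if "i < k" for i
    proof -
      have "(g i, g ((i + 1) mod k)) \<in> arcs R" using h that arcs by simp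
      then show ?thesis by (force simp: tails_def)
    qed
    then show ?thesis using tails by (auto simp: PiE_iff)
  qed
  have "set ?w = {..<k}" by auto
  then show ?thesis unfolding word_maps_def embeddings_def hom img inj
    using PiE by (auto simp: cycle_verts)
qed

lemma counting_program:
  assumes k: "3 \<le> k" and elim: "\<And>w. canonical w \<Longrightarrow> length w = k \<Longrightarrow> (\<And>x. (x, x) \<notin> set (word_pairs w)) \<Longrightarrow>
      eliminable (set (word_pairs w)) r (set w)"
  shows "\<exists>c. triple r (\<lambda>R U h m. m = h) c (\<lambda>R U (h :: nat \<Rightarrow> nat) m.
    m 0 = card (word_maps (rev [0..<k]) (all_pairs k) R) div card (automorphisms (cycle_ugraph k)))"
proof -
  let ?f = "\<lambda>R. card (word_maps (rev [0..<k]) (all_pairs k) R)" and ?a = "card (automorphisms (cycle_ugraph k))"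
  have "calculable k r ?f"
    by (rule calculable_word_maps[OF elim]) (use k in \<open>auto simp: canonical_rev_upt all_pairs_def\<close>)
  then obtain c where c: "triple r (\<lambda>R U h m. m = h) c (\<lambda>R U h m. m k = ?f R \<and> (\<forall>a<k. k \<le> a \<longrightarrow> m a = h a))"
    unfolding calculable_def by blast
  have 1: "triple r (\<lambda>R U h m. m k = ?f R \<and> (\<forall>a<k. k \<le> a \<longrightarrow> m a = h a)) (Op (Set_Const (k + 1) ?a))
    (\<lambda>R U h m. m k = ?f R \<and> m (k + 1) = ?a)"
  \<comment> \<open>The divisor is a constant of the program; \<open>?a\<close> itself is an
    exponent large enough for \<open>?a < 2 ^ ?a\<close>.\<close>
  proof (rule triple_const[where q = ?a], goal_cases)
    case (1 R X Y U h m)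
    have "?a < 2 ^ ?a" by simp
    also have "\<dots> \<le> U ^ ?a" using good_U[OF 1(1)] by (intro power_mono) auto
    finally show ?case using 1 by simp
  qed
  have 2: "triple r (\<lambda>R U h m. m k = ?f R \<and> m (k + 1) = ?a) (Op (Div_Op 0 k (k + 1)))
    (\<lambda>R U (h :: nat \<Rightarrow> nat) m. m 0 = ?f R div ?a)"
  proof (rule triple_div[where q = "k + 1"], goal_cases)
    case (1 R X Y U h m)
    have "?f R div ?a \<le> ?f R" by (rule div_le_dividend)
    also have "\<dots> \<le> U ^ k" by (rule card_word_maps_le[OF 1(1)]) simp
    also have "\<dots> < U ^ (k + 1)" using good_U[OF 1(1)] by (intro power_strict_increasing) auto
    finally show ?case using 1 by simp
  qed
  show ?thesis using triple_seq[OF c triple_seq[OF 1 2]] by blast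
qed

lemma counting_theorem:
  assumes k: "3 \<le> k" and elim: "\<And>w. canonical w \<Longrightarrow> length w = k \<Longrightarrow> (\<And>x. (x, x) \<notin> set (word_pairs w)) \<Longrightarrow>
      eliminable (set (word_pairs w)) 3 (set w)"
  shows "\<exists>(P :: ram_program) (S :: nat) (c :: nat).
    \<forall>(K :: real) (e :: nat). \<exists>(C :: real) (d :: nat).
      \<forall>(H :: nat ugraph) (R :: graph_rep) (w :: nat).
        simple_ugraph H \<longrightarrow> represents R H \<longrightarrow> efficient_rep K e R H \<longrightarrow> fits_word w H \<longrightarrow>
        (\<exists>T. halts_after P R T \<and>
             run_output P R T = num_subgraphs_iso (cycle_ugraph k) H \<and>
             real (run_time P R T) \<le> C * edge_bound 3 H * polylog d H \<and>
             run_space P R T \<le> S \<and>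
             run_within_bits P R T (c * w))"
proof -
  let ?a = "card (automorphisms (cycle_ugraph k))"
  obtain c where c: "triple 3 (\<lambda>R U h m. m = h) c (\<lambda>R U (h :: nat \<Rightarrow> nat) m.
    m 0 = card (word_maps (rev [0..<k]) (all_pairs k) R) div ?a)"
    using counting_program[OF assms] by blast
  have wf: "wf_com c" using c by (simp add: triple_def)
  obtain A q where A: "0 \<le> A" and Aq: "\<And>R X Y U B g m. good R X Y U \<Longrightarrow> U ^ q \<le> B \<Longrightarrow> bounded_mem B m \<Longrightarrow> m = g \<Longrightarrow>
      run R c m 0 = card (word_maps (rev [0..<k]) (all_pairs k) R) div ?a \<and>
      real (cost R c m) \<le> A * X * Y ^ 3 \<and> ok R B c m"
    using c unfolding triple_def by blast
  let ?P = "compile c 0 0"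
  let ?S = "card (\<Union>i\<in>set ?P. instr_cells i init_config) + card (\<Union>i\<in>set ?P. instr_cursors i)"
  \<comment> \<open>The bound is \<open>A * X * Y ^ 3\<close> written out: 54 is
    \<open>2 * 3 ^ 3\<close>, and the fourth power of \<open>max K 1\<close> and the exponent
    \<open>4 * e\<close> come from one factor \<open>X\<close> and three factors \<open>Y\<close>.
    The word size is \<open>q * w\<close> because \<open>U\<close> is \<open>2 ^ w\<close>.\<close>
  have main: "\<exists>T. halts_after ?P R T \<and>
      run_output ?P R T = num_subgraphs_iso (cycle_ugraph k) H \<and>
      real (run_time ?P R T) \<le> (54 * A * max K 1 ^ 4) * edge_bound 3 H * polylog (4 * e) H \<and>
      run_space ?P R T \<le> ?S \<and> run_within_bits ?P R T (q * w)"
    if H: "simple_ugraph H" "represents R H" "efficient_rep K e R H" "fits_word w H" for K e H R w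
  proof -
    let ?B = "2 ^ (q * w) :: nat"
    have B: "(2 ^ w) ^ q \<le> ?B" by (simp add: mult.commute flip: power_mult)
    have m0: "bounded_mem ?B (\<lambda>_. 0)" by (simp add: bounded_mem_def)
    note r = Aq[OF good_rep[OF H] B m0 refl]
    have "card (word_maps (rev [0..<k]) (all_pairs k) R) = num_subgraphs_iso (cycle_ugraph k) H * ?a"
      using word_maps_cycle[OF k H(1,2)] card_embeddings[OF simple_cycle[OF k] H(1)] by simp
    then have out: "run R c (\<lambda>_. 0) 0 = num_subgraphs_iso (cycle_ugraph k) H"
      using r card_automorphisms_pos[OF simple_cycle[OF k]] by simp
    have "real (cost R c (\<lambda>_. 0)) \<le> A * (2 * max K 1 * polylog e H) * (3 * max K 1 * edge_bound 1 H * polylog e H) ^ 3"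
      using r by simp
    also have "\<dots> = (54 * A * max K 1 ^ 4) * edge_bound 3 H * polylog (4 * e) H"
    proof -
      have "edge_bound 3 H = edge_bound 1 H ^ 3" by (simp add: edge_bound_def)
      moreover have "polylog (4 * e) H = polylog e H ^ 4" by (simp add: polylog_def mult.commute flip: power_mult)
      ultimately show ?thesis by (simp add: power_mult_distrib eval_nat_numeral)
    qed
    finally have time: "real (cost R c (\<lambda>_. 0)) \<le> (54 * A * max K 1 ^ 4) * edge_bound 3 H * polylog (4 * e) H" .
    have okc: "ok R ?B c (\<lambda>_. 0)" using r by simp
    obtain T where "halts_after ?P R T" "run_output ?P R T = run R c (\<lambda>_. 0) 0"
      "run_time ?P R T = cost R c (\<lambda>_. 0)" "run_space ?P R T \<le> ?S"
      "\<forall>t\<le>T. \<forall>a. mem (config_at ?P R t) a < ?B"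
      using compiled_program[OF wf okc] by auto
    then show ?thesis using out time unfolding run_within_bits_def by (intro exI[of _ T]) simp
  qed
  show ?thesis
  proof (rule exI[of _ ?P], rule exI[of _ ?S], rule exI[of _ q], intro allI)
    fix K :: real and e :: nat
    show "\<exists>(C :: real) (d :: nat). \<forall>(H :: nat ugraph) (R :: graph_rep) (w :: nat).
        simple_ugraph H \<longrightarrow> represents R H \<longrightarrow> efficient_rep K e R H \<longrightarrow> fits_word w H \<longrightarrow>
        (\<exists>T. halts_after ?P R T \<and>
             run_output ?P R T = num_subgraphs_iso (cycle_ugraph k) H \<and>
             real (run_time ?P R T) \<le> C * edge_bound 3 H * polylog d H \<and>
             run_space ?P R T \<le> ?S \<and>
             run_within_bits ?P R T (q * w))"
      by (rule exI[of _ "54 * A * max K 1 ^ 4"], rule exI[of _ "4 * e"]) (intro allI impI main)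
  qed
qed

text \<open>The threshold \<open>k - 5\<close> is the number of edges that an edge has to touch for at most five
  edges to remain.\<close>

lemma words_ok_small: "list_all (\<lambda>k. words_ok (k - 5) (k - 1) 1 [0]) [3, 4, 5, 6, 7, 8, 9, 10, 11]"
  by code_simp

lemma eliminable_quotient:
  assumes "3 \<le> k" "k \<le> 11" "canonical w" "length w = k" "\<And>x. (x, x) \<notin> set (word_pairs w)"
  shows "eliminable (set (word_pairs w)) 3 (set w)"
proof -
  have "w \<noteq> []" using assms by auto
  then have w: "w = butlast w @ [last w]" by simp
  \<comment> \<open>The last letter belongs to the first visit, at time 0, so the search may start
    from \<open>[0]\<close>.\<close>
  then have "canonical [last w]" using canonical_append assms(3) by metis
  then have w0: "w = butlast w @ [0]" using w by simp
  have "k \<in> set [3, 4, 5, 6, 7, 8, 9, 10, 11]" using assms(1,2) by auto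
  then have "words_ok (k - 5) (k - 1) 1 [0]"
    by (rule bspec[OF words_ok_small[unfolded list_all_iff]])
  then have ok: "words_ok (k - 5) (k - 1) (length [0::nat]) [0]" by simp
  have "eliminable (set (word_pairs (butlast w @ [0]))) 3 (set (butlast w @ [0]))"
    by (rule words_ok_sound[OF ok]) (use assms w0 in auto)
  then show ?thesis using w0 by simp
qed

theorem theorem2:
  fixes k :: nat
  assumes "3 \<le> k" and "k \<le> 11"
  shows "\<exists>(P :: ram_program) (S :: nat) (c :: nat).
    \<forall>(K :: real) (e :: nat). \<exists>(C :: real) (d :: nat).
      \<forall>(H :: nat ugraph) (R :: graph_rep) (w :: nat).
        simple_ugraph H \<longrightarrow> represents R H \<longrightarrow> efficient_rep K e R H \<longrightarrow> fits_word w H \<longrightarrow>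
        (\<exists>T. halts_after P R T \<and>
             run_output P R T = num_subgraphs_iso (cycle_ugraph k) H \<and>
             real (run_time P R T) \<le> C * edge_bound 3 H * polylog d H \<and>
             run_space P R T \<le> S \<and>
             run_within_bits P R T (c * w))"
  by (rule counting_theorem[OF assms(1)]) (rule eliminable_quotient[OF assms])

end
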